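(* Let $\mathbb{k}$ be an algebraically closed field of characteristic $p>3$, let $\ell\geq 0$ be an integer, and let $\chi\in W_\ell^*$ be a linear form whose height $r=r(\chi)$ satisfies $1<r<p-1$ and such that $\chi(e_{r-1}t^{\ell})\neq 0$. Let $s=\lfloor r/2\rfloor$. Then up to isomorphism there is a unique simple $U_\chi(W_\ell)$-module $S$, and it is represented by $$U_\chi(W_\ell)\otimes_{U_\chi(W_{\ell,(s)})}\mathbb{k}_\chi,$$ where $\mathbb{k}_\chi$ is the one-dimensional simple $U_\chi(W_{\ell,(s)})$-module. In particular, $\dim_{\mathbb{k}}S=p^{(\ell+1)(s+1)}$.
   Context: The Witt algebra $W$ is the Lie algebra of derivations of $\mathbb{k}[X]/(X^p)$, with basis $e_i=x^{i+1}\partial$, $-1\le i\le p-2$, and bracket $[e_i,e_j]=(j-i)e_{i+j}$, where $e_{i+j}:=0$ if $i+j\notin\{-1,\dots,p-2\}$. For an integer $\ell\ge 0$, the truncated current Lie algebra is $W_\ell:=W\otimes\mathbb{k}[t]/(t^{\ell+1})$, with basis $e_it^j:=e_i\otimes t^j$ ($-1\le i\le p-2$, $0\le j\le\ell$) and bracket $[e_it^k,e_jt^l]=(j-i)e_{i+j}t^{k+l}$. It is a restricted Lie algebra with $p$-map determined by $(e_it^k)^{[p]}=\delta_{i,0}\,e_it^{kp}$ (with $t^m=0$ for $m>\ell$). Set $W_{\ell,[i]}:=\mathbb{k}e_i\otimes\mathbb{k}[t]/(t^{\ell+1})$ and $W_{\ell,(i)}:=\sum_{j\ge i}W_{\ell,[j]}$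 for $i\geq -1$. For $\chi\in W_\ell^*$, the height $r(\chi)$ is the smallest integer $i\ge -1$ with $\chi(W_{\ell,(i)})=(0)$. For a restricted Lie algebra $L$ and $\chi\in L^*$, the reduced enveloping algebra is $U_\chi(L):=U(L)/(x^p-x^{[p]}-\chi(x)^p\cdot 1:\ x\in L)$; for a restricted subalgebra $L'\subseteq L$, $U_\chi(L')$ is formed with $\chi|_{L'}$. Under the hypotheses of the claim, $U_\chi(W_{\ell,(s)})$ has, up to isomorphism, a unique simple module; it is one-dimensional, is determined by $\chi$ (each $x\in W_{\ell,(s)}$ acts as the scalar $\chi(x)$), and is denoted $\mathbb{k}_\chi$. *)

theory Defs
  imports
    "HOL-Algebra.QuotRing"
    "HOL-Algebra.Free_Abelian_Groups"
    "HOL-Computational_Algebra.Computational_Algebra"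
    "Jordan_Normal_Form.VS_Connect"
begin

section \<open>Modules over a noncommutative ring\<close>

text \<open>The library locale \<^locale>\<open>module\<close> demands a commutative ring of scalars.\<close>

locale left_module = R?: ring R + M?: abelian_group M
  for R :: "('r, 'x) ring_scheme" and M :: "('r, 'm, 'y) module_scheme" (structure) +
  assumes smult_closed [simp, intro]:
      "\<lbrakk>a \<in> carrier R; x \<in> carrier M\<rbrakk> \<Longrightarrow> a \<odot>\<^bsub>M\<^esub> x \<in> carrier M"
    and smult_l_distr:
      "\<lbrakk>a \<in> carrier R; b \<in> carrier R; x \<in> carrier M\<rbrakk> \<Longrightarrow>
      (a \<oplus>\<^bsub>R\<^esub> b) \<odot>\<^bsub>M\<^esub> x = a \<odot>\<^bsub>M\<^esub> x \<oplus>\<^bsub>M\<^esub> b \<odot>\<^bsub>M\<^esub> x"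
    and smult_r_distr:
      "\<lbrakk>a \<in> carrier R; x \<in> carrier M; y \<in> carrier M\<rbrakk> \<Longrightarrow>
      a \<odot>\<^bsub>M\<^esub> (x \<oplus>\<^bsub>M\<^esub> y) = a \<odot>\<^bsub>M\<^esub> x \<oplus>\<^bsub>M\<^esub> a \<odot>\<^bsub>M\<^esub> y"
    and smult_assoc:
      "\<lbrakk>a \<in> carrier R; b \<in> carrier R; x \<in> carrier M\<rbrakk> \<Longrightarrow>
      (a \<otimes>\<^bsub>R\<^esub> b) \<odot>\<^bsub>M\<^esub> x = a \<odot>\<^bsub>M\<^esub> (b \<odot>\<^bsub>M\<^esub> x)"
    and smult_one [simp]:
      "x \<in> carrier M \<Longrightarrow> \<one>\<^bsub>R\<^esub> \<odot>\<^bsub>M\<^esub> x = x"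

definition simple_left_module :: "'r ring \<Rightarrow> ('r, 'm) module \<Rightarrow> bool" where
  "simple_left_module R M \<longleftrightarrow>
     left_module R M \<and> carrier M \<noteq> {\<zero>\<^bsub>M\<^esub>} \<and>
     (\<forall>N. Module.submodule N R M \<longrightarrow> N = {\<zero>\<^bsub>M\<^esub>} \<or> N = carrier M)"

definition left_module_isomorphic ::
  "'r ring \<Rightarrow> ('r, 'm) module \<Rightarrow> ('r, 'n) module \<Rightarrow> bool" where
  "left_module_isomorphic R M N \<longleftrightarrow>
     (\<exists>h \<in> iso (add_monoid M) (add_monoid N).
        \<forall>a \<in> carrier R. \<forall>x \<in> carrier M. h (a \<odot>\<^bsub>M\<^esub> x) = a \<odot>\<^bsub>N\<^esub> h x)"

text \<open>The fields \<^const>\<open>monoid.mult\<close> and \<^const>\<open>monoid.one\<close> of a module record carry no meaning.\<close>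

definition restrict_scalars :: "('q \<Rightarrow> 'r) \<Rightarrow> ('r, 'm) module \<Rightarrow> ('q, 'm) module" where
  "restrict_scalars \<phi> M =
     \<lparr>carrier = carrier M, monoid.mult = undefined, monoid.one = undefined,
      ring.zero = \<zero>\<^bsub>M\<^esub>, ring.add = add M, module.smult = (\<lambda>a. smult M (\<phi> a))\<rparr>"

text \<open>For a ring homomorphism \<open>\<phi>: R \<rightarrow> S\<close> and a left \<open>R\<close>-module \<open>N\<close>, the left \<open>S\<close>-module
  \<open>S \<otimes>\<^sub>R N\<close>: the free abelian group on the pairs \<open>(a, n)\<close> modulo the biadditivity and
  balancing relations, with \<open>S\<close> acting on the first factor.\<close>

definition tensor_relations ::
  "('r \<Rightarrow> 's) \<Rightarrow> 'r ring \<Rightarrow> 's ring \<Rightarrow> ('r, 'n) module \<Rightarrow> ('s \<times> 'n \<Rightarrow>\<^sub>0 int) set" where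
  "tensor_relations \<phi> R S N =
     {frag_of (a \<oplus>\<^bsub>S\<^esub> b, n) - frag_of (a, n) - frag_of (b, n) |a b n.
        a \<in> carrier S \<and> b \<in> carrier S \<and> n \<in> carrier N} \<union>
     {frag_of (a, m \<oplus>\<^bsub>N\<^esub> n) - frag_of (a, m) - frag_of (a, n) |a m n.
        a \<in> carrier S \<and> m \<in> carrier N \<and> n \<in> carrier N} \<union>
     {frag_of (a \<otimes>\<^bsub>S\<^esub> \<phi> c, n) - frag_of (a, c \<odot>\<^bsub>N\<^esub> n) |a c n.
        a \<in> carrier S \<and> c \<in> carrier R \<and> n \<in> carrier N}"

definition extend_scalars ::
  "('r \<Rightarrow> 's) \<Rightarrow> 'r ring \<Rightarrow> 's ring \<Rightarrow> ('r, 'n) module \<Rightarrow> ('s, ('s \<times> 'n \<Rightarrow>\<^sub>0 int) set) module" where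
  "extend_scalars \<phi> R S N =
    (let F = free_Abelian_group (carrier S \<times> carrier N);
         B = generate F (tensor_relations \<phi> R S N)
     in \<lparr>carrier = carrier (F Mod B), monoid.mult = undefined, monoid.one = undefined,
         ring.zero = \<one>\<^bsub>F Mod B\<^esub>, ring.add = monoid.mult (F Mod B),
         module.smult = (\<lambda>c C. \<Union>z\<in>C. B #>\<^bsub>F\<^esub> frag_extend (\<lambda>(a, n). frag_of (c \<otimes>\<^bsub>S\<^esub> a, n)) z)\<rparr>)"

text \<open>\<^const>\<open>vectorspace.dim\<close> alone is unspecified for spaces that are not finite-dimensional.\<close>

definition has_dimension :: "('k::field, 'm) module \<Rightarrow> nat \<Rightarrow> bool" where
  "has_dimension V n \<longleftrightarrow>
     vectorspace class_ring V \<and> vectorspace.fin_dim class_ring V \<and> vectorspace.dim class_ring V = n"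


section \<open>Restricted Lie algebras\<close>

record ('k, 'a) rlie = "('k, 'a) module" +
  bracket :: "'a \<Rightarrow> 'a \<Rightarrow> 'a"
  p_map :: "'a \<Rightarrow> 'a"

text \<open>\<open>ad_coeff L x y n k\<close> is the coefficient of \<open>t\<^sup>k\<close> in \<open>ad (t x + y)\<^sup>n x\<close>, computed in \<open>L[t]\<close>.\<close>

fun ad_coeff :: "('k, 'a) rlie \<Rightarrow> 'a \<Rightarrow> 'a \<Rightarrow> nat \<Rightarrow> nat \<Rightarrow> 'a" where
  "ad_coeff L x y 0 k = (if k = 0 then x else \<zero>\<^bsub>L\<^esub>)"
| "ad_coeff L x y (Suc n) 0 = bracket L y (ad_coeff L x y n 0)"
| "ad_coeff L x y (Suc n) (Suc k) =
     bracket L x (ad_coeff L x y n k) \<oplus>\<^bsub>L\<^esub> bracket L y (ad_coeff L x y n (Suc k))"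

locale restricted_lie_algebra =
  vectorspace class_ring L for L :: "('k::field, 'a) rlie" (structure) +
  assumes bracket_closed: "\<lbrakk>x \<in> carrier L; y \<in> carrier L\<rbrakk> \<Longrightarrow> bracket L x y \<in> carrier L"
    and bracket_add_left: "\<lbrakk>x \<in> carrier L; y \<in> carrier L; z \<in> carrier L\<rbrakk> \<Longrightarrow>
      bracket L (x \<oplus>\<^bsub>L\<^esub> y) z = bracket L x z \<oplus>\<^bsub>L\<^esub> bracket L y z"
    and bracket_smult_left: "\<lbrakk>x \<in> carrier L; y \<in> carrier L\<rbrakk> \<Longrightarrow>
      bracket L (c \<odot>\<^bsub>L\<^esub> x) y = c \<odot>\<^bsub>L\<^esub> bracket L x y"
    and bracket_add_right: "\<lbrakk>x \<in> carrier L; y \<in> carrier L; z \<in> carrier L\<rbrakk> \<Longrightarrow>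
      bracket L x (y \<oplus>\<^bsub>L\<^esub> z) = bracket L x y \<oplus>\<^bsub>L\<^esub> bracket L x z"
    and bracket_smult_right: "\<lbrakk>x \<in> carrier L; y \<in> carrier L\<rbrakk> \<Longrightarrow>
      bracket L x (c \<odot>\<^bsub>L\<^esub> y) = c \<odot>\<^bsub>L\<^esub> bracket L x y"
    and bracket_self: "x \<in> carrier L \<Longrightarrow> bracket L x x = \<zero>\<^bsub>L\<^esub>"
    and jacobi: "\<lbrakk>x \<in> carrier L; y \<in> carrier L; z \<in> carrier L\<rbrakk> \<Longrightarrow>
      bracket L x (bracket L y z) \<oplus>\<^bsub>L\<^esub> bracket L y (bracket L z x) \<oplus>\<^bsub>L\<^esub>
        bracket L z (bracket L x y) = \<zero>\<^bsub>L\<^esub>"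
    and p_map_closed: "x \<in> carrier L \<Longrightarrow> p_map L x \<in> carrier L"
    and p_map_ad: "\<lbrakk>x \<in> carrier L; y \<in> carrier L\<rbrakk> \<Longrightarrow>
      bracket L (p_map L x) y = (bracket L x ^^ CHAR('k)) y"
    and p_map_smult: "x \<in> carrier L \<Longrightarrow>
      p_map L (c \<odot>\<^bsub>L\<^esub> x) = (c ^ CHAR('k)) \<odot>\<^bsub>L\<^esub> p_map L x"
    and p_map_add: "\<lbrakk>x \<in> carrier L; y \<in> carrier L\<rbrakk> \<Longrightarrow>
      p_map L (x \<oplus>\<^bsub>L\<^esub> y) = p_map L x \<oplus>\<^bsub>L\<^esub> p_map L y \<oplus>\<^bsub>L\<^esub>
        (\<Oplus>\<^bsub>L\<^esub>i\<in>{1..<CHAR('k)}. inverse (of_nat i) \<odot>\<^bsub>L\<^esub> ad_coeff L x y (CHAR('k) - 1) (i - 1))"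

definition linear_form :: "('k::field, 'a) rlie \<Rightarrow> ('a \<Rightarrow> 'k) \<Rightarrow> bool" where
  "linear_form L \<chi> \<longleftrightarrow>
     (\<forall>x\<in>carrier L. \<forall>y\<in>carrier L. \<chi> (x \<oplus>\<^bsub>L\<^esub> y) = \<chi> x + \<chi> y) \<and>
     (\<forall>c. \<forall>x\<in>carrier L. \<chi> (c \<odot>\<^bsub>L\<^esub> x) = c * \<chi> x)"


section \<open>Enveloping algebras\<close>

text \<open>Words under concatenation, so that \<open>'a free_word \<Rightarrow>\<^sub>0 'k\<close> with the convolution product is the
  free associative unital \<open>'k\<close>-algebra on the set \<open>'a\<close>.\<close>

datatype 'a free_word = Free_Word (letters: "'a list")

instantiation free_word :: (type) monoid_add
begin
definition zero_free_word :: "'a free_word" where "0 = Free_Word []"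
definition plus_free_word :: "'a free_word \<Rightarrow> 'a free_word \<Rightarrow> 'a free_word" where
  "u + v = Free_Word (letters u @ letters v)"
instance by standard (simp_all add: zero_free_word_def plus_free_word_def)
end

type_synonym ('k, 'a) free_alg = "'a free_word \<Rightarrow>\<^sub>0 'k"

definition gen :: "'a \<Rightarrow> ('k::field, 'a) free_alg" where
  "gen x = Poly_Mapping.single (Free_Word [x]) 1"

definition scal :: "'k \<Rightarrow> ('k::field, 'a) free_alg" where
  "scal c = Poly_Mapping.single 0 c"

definition free_algebra :: "('k::field, 'a) rlie \<Rightarrow> ('k, 'a) free_alg ring" where
  "free_algebra L =
     \<lparr>carrier = {f. \<forall>w \<in> Poly_Mapping.keys f. set (letters w) \<subseteq> carrier L},
      monoid.mult = (*), monoid.one = 1, ring.zero = 0, ring.add = (+)\<rparr>"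

text \<open>The first two families of relations turn the free algebra on the set \<open>carrier L\<close> into
  the tensor algebra of the vector space \<open>L\<close>.\<close>

definition env_ideal :: "('k::field, 'a) rlie \<Rightarrow> ('k, 'a) free_alg set" where
  "env_ideal L = Idl\<^bsub>free_algebra L\<^esub>
     ({gen (x \<oplus>\<^bsub>L\<^esub> y) - gen x - gen y |x y. x \<in> carrier L \<and> y \<in> carrier L} \<union>
      {gen (c \<odot>\<^bsub>L\<^esub> x) - scal c * gen x |c x. x \<in> carrier L} \<union>
      {gen x * gen y - gen y * gen x - gen (bracket L x y) |x y. x \<in> carrier L \<and> y \<in> carrier L})"

definition env :: "('k::field, 'a) rlie \<Rightarrow> ('k, 'a) free_alg set ring" where
  "env L = free_algebra L Quot env_ideal L"

definition env_class :: "('k::field, 'a) rlie \<Rightarrow> ('k, 'a) free_alg \<Rightarrow> ('k, 'a) free_alg set" where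
  "env_class L f = env_ideal L +>\<^bsub>free_algebra L\<^esub> f"

definition red_ideal :: "('k::field, 'a) rlie \<Rightarrow> ('a \<Rightarrow> 'k) \<Rightarrow> ('k, 'a) free_alg set set" where
  "red_ideal L \<chi> = Idl\<^bsub>env L\<^esub>
     {env_class L (gen x) [^]\<^bsub>env L\<^esub> CHAR('k) \<ominus>\<^bsub>env L\<^esub> env_class L (gen (p_map L x))
        \<ominus>\<^bsub>env L\<^esub> env_class L (scal (\<chi> x ^ CHAR('k))) |x. x \<in> carrier L}"

definition red_env :: "('k::field, 'a) rlie \<Rightarrow> ('a \<Rightarrow> 'k) \<Rightarrow> ('k, 'a) free_alg set set ring" where
  "red_env L \<chi> = env L Quot red_ideal L \<chi>"

definition red_class ::
  "('k::field, 'a) rlie \<Rightarrow> ('a \<Rightarrow> 'k) \<Rightarrow> ('k, 'a) free_alg \<Rightarrow> ('k, 'a) free_alg set set" where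
  "red_class L \<chi> f = red_ideal L \<chi> +>\<^bsub>env L\<^esub> env_class L f"

text \<open>The map between quotients of rings induced by \<open>f\<close>, with \<open>J\<close> an ideal of the target \<open>S\<close>.\<close>

definition quot_map :: "'s ring \<Rightarrow> 's set \<Rightarrow> ('r \<Rightarrow> 's) \<Rightarrow> 'r set \<Rightarrow> 's set" where
  "quot_map S J f C = (\<Union>a\<in>C. J +>\<^bsub>S\<^esub> f a)"

text \<open>For a restricted subalgebra \<open>L'\<close> of \<open>L\<close>, the canonical homomorphism
  from \<open>red_env L' \<chi>\<close> to \<open>red_env L \<chi>\<close> (it does not mention \<open>L'\<close>, being induced by the
  inclusion of \<open>free_algebra L'\<close> into \<open>free_algebra L\<close>).\<close>

definition red_env_map ::
  "('k::field, 'a) rlie \<Rightarrow> ('a \<Rightarrow> 'k) \<Rightarrow> ('k, 'a) free_alg set set \<Rightarrow> ('k, 'a) free_alg set set" where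
  "red_env_map L \<chi> =
     quot_map (env L) (red_ideal L \<chi>) (quot_map (free_algebra L) (env_ideal L) (\<lambda>f. f))"

text \<open>The one-dimensional module \<open>\<bbbk>\<^sub>\<chi>\<close>: the algebra homomorphism from the free algebra with
  \<open>gen x \<mapsto> \<chi> x\<close> is constant on the classes that make up an element of \<open>red_env L' \<chi>\<close>
  (when \<open>\<chi>\<close> vanishes on all brackets and all \<open>p\<close>-th powers of \<open>L'\<close>).\<close>

definition free_eval :: "('a \<Rightarrow> 'k) \<Rightarrow> ('k::field, 'a) free_alg \<Rightarrow> 'k" where
  "free_eval \<chi> f =
     (\<Sum>w\<in>Poly_Mapping.keys f. Poly_Mapping.lookup f w * prod_list (map \<chi> (letters w)))"

definition red_env_eval :: "('a \<Rightarrow> 'k) \<Rightarrow> ('k::field, 'a) free_alg set set \<Rightarrow> 'k" where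
  "red_env_eval \<chi> C = the_elem ((\<lambda>D. the_elem (free_eval \<chi> ` D)) ` C)"

definition one_dim_module :: "('a \<Rightarrow> 'k) \<Rightarrow> (('k::field, 'a) free_alg set set, 'k) module" where
  "one_dim_module \<chi> =
     \<lparr>carrier = UNIV, monoid.mult = undefined, monoid.one = undefined, ring.zero = 0, ring.add = (+),
      module.smult = (\<lambda>u c. red_env_eval \<chi> u * c)\<rparr>"

definition underlying_space ::
  "('k::field, 'a) rlie \<Rightarrow> ('a \<Rightarrow> 'k) \<Rightarrow> (('k, 'a) free_alg set set, 'm) module \<Rightarrow> ('k, 'm) module" where
  "underlying_space L \<chi> M = restrict_scalars (\<lambda>c. red_class L \<chi> (scal c)) M"

definition induced_module ::
  "('k::field, 'a) rlie \<Rightarrow> 'a set \<Rightarrow> ('a \<Rightarrow> 'k) \<Rightarrow>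
     (('k, 'a) free_alg set set, (('k, 'a) free_alg set set \<times> 'k \<Rightarrow>\<^sub>0 int) set) module" where
  "induced_module L H \<chi> =
     extend_scalars (red_env_map L \<chi>) (red_env (L\<lparr>carrier := H\<rparr>) \<chi>) (red_env L \<chi>) (one_dim_module \<chi>)"


section \<open>The truncated current algebra of the Witt algebra\<close>

text \<open>An element of \<open>W\<^sub>\<ell>\<close> is the family of its coordinates with respect to the basis
  \<open>e\<^sub>i t\<^sup>k\<close>, extended by \<open>0\<close> to all pairs \<open>(i, k)\<close>.\<close>

definition witt_index :: "nat \<Rightarrow> nat \<Rightarrow> (int \<times> nat) set" where
  "witt_index p l = {-1..int p - 2} \<times> {0..l}"

definition witt_basis :: "nat \<Rightarrow> nat \<Rightarrow> int \<Rightarrow> nat \<Rightarrow> int \<times> nat \<Rightarrow> 'k::field" where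
  "witt_basis p l i k = (\<lambda>q. if (i, k) \<in> witt_index p l \<and> q = (i, k) then 1 else 0)"

definition witt_bracket ::
  "nat \<Rightarrow> nat \<Rightarrow> (int \<times> nat \<Rightarrow> 'k) \<Rightarrow> (int \<times> nat \<Rightarrow> 'k) \<Rightarrow> int \<times> nat \<Rightarrow> 'k::field" where
  "witt_bracket p l x y = (\<lambda>q. \<Sum>(i, k)\<in>witt_index p l. \<Sum>(j, m)\<in>witt_index p l.
     x (i, k) * y (j, m) * (of_int (j - i) * witt_basis p l (i + j) (k + m) q))"

text \<open>\<open>W\<^sub>\<ell>\<close> acts on \<open>A = \<bbbk>[X,t]/(X\<^sup>p, t\<^sup>\<ell>\<^sup>+\<^sup>1)\<close> by derivations \<open>f \<partial>\<close>, with \<open>e\<^sub>i t\<^sup>k\<close>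
  acting as \<open>X\<^sup>i\<^sup>+\<^sup>1 t\<^sup>k \<partial>\<close>.  Identifying \<open>g \<in> A\<close> with \<open>g \<partial> \<in> W\<^sub>\<ell>\<close>, this action becomes the
  following product, \<open>e\<^sub>i t\<^sup>k \<cdot> e\<^sub>j t\<^sup>m = (j + 1) e\<^sub>i\<^sub>+\<^sub>j t\<^sup>k\<^sup>+\<^sup>m\<close>, and \<open>X\<close> becomes \<open>e\<^sub>0\<close>.\<close>

definition witt_act ::
  "nat \<Rightarrow> nat \<Rightarrow> (int \<times> nat \<Rightarrow> 'k) \<Rightarrow> (int \<times> nat \<Rightarrow> 'k) \<Rightarrow> int \<times> nat \<Rightarrow> 'k::field" where
  "witt_act p l x y = (\<lambda>q. \<Sum>(i, k)\<in>witt_index p l. \<Sum>(j, m)\<in>witt_index p l.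
     x (i, k) * y (j, m) * (of_int (j + 1) * witt_basis p l (i + j) (k + m) q))"

text \<open>The \<open>p\<close>-map sends a derivation \<open>D = f \<partial>\<close> to \<open>D\<^sup>p\<close>, that is, to \<open>D\<^sup>p(X) \<partial>\<close>.  The lemmas
  \<open>witt_current_restricted\<close> and \<open>witt_current_p_map_basis\<close> at the end show that it makes
  \<open>W\<^sub>\<ell>\<close> a restricted Lie algebra and that \<open>(e\<^sub>i t\<^sup>k)\<^sup>[\<^sup>p\<^sup>] = \<delta>\<^sub>i\<^sub>,\<^sub>0 e\<^sub>i t\<^sup>k\<^sup>p\<close>; these two properties
  determine it, because a \<open>p\<close>-map is determined by its values on a basis.\<close>

definition witt_p_map ::
  "nat \<Rightarrow> nat \<Rightarrow> (int \<times> nat \<Rightarrow> 'k) \<Rightarrow> int \<times> nat \<Rightarrow> 'k::field" where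
  "witt_p_map p l x = (witt_act p l x ^^ p) (witt_basis p l 0 0)"

definition witt_current :: "nat \<Rightarrow> nat \<Rightarrow> ('k::field, int \<times> nat \<Rightarrow> 'k) rlie" where
  "witt_current p l =
     \<lparr>carrier = {x. \<forall>q. q \<notin> witt_index p l \<longrightarrow> x q = 0},
      monoid.mult = undefined, monoid.one = undefined,
      ring.zero = (\<lambda>q. 0), ring.add = (\<lambda>x y q. x q + y q),
      module.smult = (\<lambda>c x q. c * x q),
      bracket = witt_bracket p l,
      p_map = witt_p_map p l\<rparr>"

definition witt_filtration :: "nat \<Rightarrow> nat \<Rightarrow> int \<Rightarrow> (int \<times> nat \<Rightarrow> 'k::field) set" where
  "witt_filtration p l i = {x \<in> carrier (witt_current p l). \<forall>j k. j < i \<longrightarrow> x (j, k) = 0}"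

definition witt_height :: "nat \<Rightarrow> nat \<Rightarrow> ((int \<times> nat \<Rightarrow> 'k::field) \<Rightarrow> 'k) \<Rightarrow> int" where
  "witt_height p l \<chi> = (LEAST i. -1 \<le> i \<and> (\<forall>x \<in> witt_filtration p l i. \<chi> x = 0))"


section \<open>Jacobson's formula in associative rings of characteristic p\<close>

lemma ad_pow:
  fixes a z :: "'r::ring_1"
  shows "((\<lambda>w. a * w - w * a) ^^ n) z =
    (\<Sum>i\<le>n. (-1) ^ i * of_nat (n choose i) * (a ^ (n - i) * z * a ^ i))"
proof (induction n)
  case 0
  show ?case by simp
next
  case (Suc n)
  let ?t = "\<lambda>c i j. c * (a ^ j * z * a ^ i)"
  let ?s = "\<lambda>i. (-1) ^ i :: 'r"
  let ?b = "\<lambda>n i. of_nat (n choose i) :: 'r"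
  have comm: "w * (?s i * ?b n i) = (?s i * ?b n i) * w" for w :: 'r and n i
    by (simp add: minus_one_power_iff mult_of_nat_commute)
  have A: "a * (\<Sum>i\<le>n. ?t (?s i * ?b n i) i (n - i)) = (\<Sum>i\<le>n. ?t (?s i * ?b n i) i (Suc n - i))"
    unfolding sum_distrib_left
  proof (rule sum.cong)
    fix i assume "i \<in> {..n}"
    then have "Suc n - i = Suc (n - i)" by auto
    moreover have "a * ((?s i * ?b n i) * w) = (?s i * ?b n i) * (a * w)" for w
      by (metis comm mult.assoc)
    ultimately show "a * ?t (?s i * ?b n i) i (n - i) = ?t (?s i * ?b n i) i (Suc n - i)"
      by (simp add: mult.assoc)
  qed simp
  have B: "(\<Sum>i\<le>n. ?t (?s i * ?b n i) i (n - i)) * a = (\<Sum>i\<le>n. ?t (?s i * ?b n i) (Suc i) (Suc n - Suc i))"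
    unfolding sum_distrib_right
    by (rule sum.cong) (simp_all add: mult.assoc power_commutes)
  have C: "(\<Sum>i\<le>n. ?t (?s i * ?b n i) i (Suc n - i)) = (\<Sum>i\<le>Suc n. ?t (?s i * ?b n i) i (Suc n - i))"
    by (simp add: binomial_eq_0)
  have D: "(\<Sum>i\<le>Suc n. ?t (?s i * ?b (Suc n) i) i (Suc n - i)) =
     (\<Sum>i\<le>Suc n. ?t (?s i * ?b n i) i (Suc n - i)) - (\<Sum>i\<le>n. ?t (?s i * ?b n i) (Suc i) (Suc n - Suc i))"
    unfolding sum.atMost_Suc_shift
    by (simp add: algebra_simps sum.distrib sum_negf sum_subtractf)
  show ?case
    by (simp only: funpow.simps o_apply Suc.IH A B) (simp only: C D)
qed

lemma choose_prime_pred: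
  assumes p: "prime p" "of_nat p = (0::'r::ring_1)" and i: "i < p"
  shows "of_nat ((p - 1) choose i) = ((-1) ^ i :: 'r)"
  using i
proof (induction i)
  case 0
  show ?case by simp
next
  case (Suc i)
  have "p dvd (p choose Suc i)"
    using Suc.prems p(1) by (intro dvd_choose_prime) auto
  then have "of_nat (p choose Suc i) = (0::'r)"
    using p(2) by (auto elim!: dvdE)
  moreover have "p choose Suc i = (p - 1 choose i) + (p - 1 choose Suc i)"
    using Suc.prems by (cases p) auto
  ultimately have "of_nat (p - 1 choose i) + of_nat (p - 1 choose Suc i) = (0::'r)"
    by simp
  then show ?case using Suc by (simp add: add_eq_0_iff)
qed

lemma ad_pow_pred_prime:
  fixes a z :: "'r::ring_1"
  assumes p: "prime p" "of_nat p = (0::'r)"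
  shows "((\<lambda>w. a * w - w * a) ^^ (p - 1)) z = (\<Sum>i<p. a ^ (p - 1 - i) * z * a ^ i)"
proof -
  have "{..p - 1} = {..<p}" using prime_gt_0_nat[OF p(1)] by auto
  moreover have "(-1) ^ i * (-1) ^ i = (1::'r)" for i
    by (simp add: minus_one_power_iff)
  moreover have "((\<lambda>w. a * w - w * a) ^^ (p - 1)) z =
      (\<Sum>i<p. (-1) ^ i * of_nat ((p - 1) choose i) * (a ^ (p - 1 - i) * z * a ^ i))"
    by (simp only: ad_pow) (simp only: calculation)
  moreover have "\<dots> = (\<Sum>i<p. (-1) ^ i * (-1) ^ i * (a ^ (p - 1 - i) * z * a ^ i))"
    by (rule sum.cong) (simp_all only: choose_prime_pred[OF p] lessThan_iff)
  ultimately show ?thesis by simp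
qed

lemma ad_pow_prime:
  fixes a z :: "'r::ring_1"
  assumes p: "prime p" "of_nat p = (0::'r)"
  shows "((\<lambda>w. a * w - w * a) ^^ p) z = a ^ p * z - z * a ^ p"
proof -
  have p1: "p = Suc (p - 1)" using prime_gt_0_nat[OF p(1)] by simp
  have 1: "a * (\<Sum>i<p. a ^ (p - 1 - i) * z * a ^ i) = (\<Sum>i<p. a ^ (p - i) * z * a ^ i)"
    unfolding sum_distrib_left
  proof (rule sum.cong)
    fix i assume "i \<in> {..<p}"
    then have "p - i = Suc (p - 1 - i)" by auto
    then show "a * (a ^ (p - 1 - i) * z * a ^ i) = a ^ (p - i) * z * a ^ i"
      by (simp add: mult.assoc)
  qed simp
  have 2: "(\<Sum>i<p. a ^ (p - 1 - i) * z * a ^ i) * a = (\<Sum>i<p. a ^ (p - Suc i) * z * a ^ Suc i)"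
    unfolding sum_distrib_right
    by (rule sum.cong) (simp_all add: mult.assoc power_commutes)
  have "((\<lambda>w. a * w - w * a) ^^ p) z =
     (\<Sum>i<p. a ^ (p - i) * z * a ^ i) - (\<Sum>i<p. a ^ (p - Suc i) * z * a ^ Suc i)"
    by (subst p1) (simp only: funpow.simps o_apply ad_pow_pred_prime[OF p] 1 2)
  also have "\<dots> = a ^ p * z - z * a ^ p"
    unfolding sum_subtractf[symmetric]
    using sum_lessThan_telescope'[of "\<lambda>i. a ^ (p - i) * z * a ^ i" p] by simp
  finally show ?thesis .
qed

fun ring_ad_coeff :: "'r::ring_1 \<Rightarrow> 'r \<Rightarrow> nat \<Rightarrow> nat \<Rightarrow> 'r" where
  "ring_ad_coeff x y 0 k = (if k = 0 then x else 0)"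
| "ring_ad_coeff x y (Suc n) 0 = y * ring_ad_coeff x y n 0 - ring_ad_coeff x y n 0 * y"
| "ring_ad_coeff x y (Suc n) (Suc k) =
     (x * ring_ad_coeff x y n k - ring_ad_coeff x y n k * x) +
     (y * ring_ad_coeff x y n (Suc k) - ring_ad_coeff x y n (Suc k) * y)"

lemma jacobson:
  fixes x y :: "'r::ring_1"
  assumes p: "prime p" "of_nat p = (0::'r)"
  obtains s where "(x + y) ^ p = x ^ p + y ^ p + (\<Sum>i\<in>{1..<p}. s i)"
    and "\<And>i. i \<in> {1..<p} \<Longrightarrow> of_nat i * s i = ring_ad_coeff x y (p - 1) (i - 1)"
proof -
  define A where "A = fps_X * fps_const x + fps_const y"
  have A0: "fps_nth (A * B) (0) = y * fps_nth B (0)" for B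
    by (simp add: A_def distrib_right mult.assoc)
  have AS: "fps_nth (A * B) (Suc k) = x * fps_nth B (k) + y * fps_nth B (Suc k)" for B k
    by (simp add: A_def distrib_right mult.assoc)
  have BA0: "fps_nth (B * A) (0) = fps_nth B (0) * y" for B
    by (simp add: A_def distrib_left)
  have Xc: "B * fps_X = fps_X * B" for B :: "'r fps"
    by (rule fps_mult_fps_X_commute[symmetric])
  have BAS: "fps_nth (B * A) (Suc k) = fps_nth B (k) * x + fps_nth B (Suc k) * y" for B k
    by (simp add: A_def distrib_left mult.assoc[symmetric] Xc)
  have A00: "fps_nth A 0 = y"
    by (simp add: A_def)
  have gt: "fps_nth (A ^ n) (k) = 0" if "n < k" for n k
    using that
  proof (induction n arbitrary: k)
    case (Suc n)
    then show ?case by (cases k) (simp_all add: AS)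
  qed simp
  have top: "fps_nth (A ^ n) (n) = x ^ n" for n
    by (induction n) (simp_all add: AS gt)
  have bot: "fps_nth (A ^ n) (0) = y ^ n" for n
    by (induction n) (simp_all add: A0 A00)
  have sum: "(\<Sum>k\<le>n. fps_nth (A ^ n) (k)) = (x + y) ^ n" for n
  proof (induction n)
    case (Suc n)
    have "(\<Sum>k\<le>Suc n. (A ^ Suc n) $ k) =
        y * fps_nth (A ^ n) (0) + ((\<Sum>k\<le>n. x * fps_nth (A ^ n) (k)) + (\<Sum>k\<le>n. y * fps_nth (A ^ n) (Suc k)))"
      by (simp add: sum.atMost_Suc_shift A0 A00 AS sum.distrib del: sum.atMost_Suc)
    also have "y * fps_nth (A ^ n) (0) + ((\<Sum>k\<le>n. x * fps_nth (A ^ n) (k)) + (\<Sum>k\<le>n. y * fps_nth (A ^ n) (Suc k))) =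
        (\<Sum>k\<le>n. x * fps_nth (A ^ n) (k)) + (\<Sum>k\<le>Suc n. y * fps_nth (A ^ n) (k))"
      by (simp only: sum.atMost_Suc_shift add_ac)
    also have "\<dots> = (x + y) * (\<Sum>k\<le>n. fps_nth (A ^ n) (k))"
      by (simp add: gt sum_distrib_left distrib_right)
    finally show ?case using Suc by simp
  qed simp
  have dA: "fps_deriv A = fps_const x"
    by (simp add: A_def fps_deriv_mult)
  have deriv: "fps_deriv (A ^ n) = (\<Sum>i<n. A ^ (n - 1 - i) * fps_const x * A ^ i)" for n
  proof (induction n)
    case (Suc n)
    have eq: "(\<Sum>i<n. A ^ (n - 1 - i) * fps_const x * A ^ i) * A =
        (\<Sum>i<n. A ^ (n - Suc i) * fps_const x * A ^ Suc i)"
      unfolding sum_distrib_right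
      by (rule sum.cong) (simp_all add: mult.assoc power_commutes)
    have "fps_deriv (A ^ Suc n) = fps_deriv (A ^ n * A)"
      by (simp add: power_commutes)
    also have "\<dots> = A ^ n * fps_const x + (\<Sum>i<n. A ^ (n - Suc i) * fps_const x * A ^ Suc i)"
      unfolding fps_deriv_mult dA Suc eq ..
    also have "\<dots> = (\<Sum>i<Suc n. A ^ (Suc n - 1 - i) * fps_const x * A ^ i)"
      by (simp add: sum.lessThan_Suc_shift del: sum.lessThan_Suc power_Suc)
    finally show ?case .
  qed simp
  have ad: "fps_nth (((\<lambda>w. A * w - w * A) ^^ n) (fps_const x)) k = ring_ad_coeff x y n k" for n k
  proof (induction n arbitrary: k)
    case (Suc n)
    then show ?case by (cases k) (simp_all add: A0 A00 AS BA0 BAS algebra_simps)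
  qed simp
  have p': "of_nat p = (0 :: 'r fps)"
    using p(2) by (simp add: fps_of_nat[symmetric])
  have main: "fps_deriv (A ^ p) = ((\<lambda>w. A * w - w * A) ^^ (p - 1)) (fps_const x)"
    unfolding deriv ad_pow_pred_prime[OF p(1) p'] ..
  show thesis
  proof (rule that)
    have p0: "p > 0" using prime_gt_0_nat[OF p(1)] .
    have "{..p} = insert 0 (insert p {1..<p})" using p0 by auto
    then show "(x + y) ^ p = x ^ p + y ^ p + (\<Sum>i\<in>{1..<p}. fps_nth (A ^ p) (i))"
      using p0 by (simp add: sum[symmetric] top bot add_ac)
  next
    fix i assume i: "i \<in> {1..<p}"
    have "of_nat i * fps_nth (A ^ p) (i) = fps_nth (fps_deriv (A ^ p)) (i - 1)"
      using i by (cases i) simp_all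
    also have "\<dots> = ring_ad_coeff x y (p - 1) (i - 1)"
      by (simp only: main ad)
    finally show "of_nat i * fps_nth (A ^ p) (i) = ring_ad_coeff x y (p - 1) (i - 1)" .
  qed
qed


section \<open>The truncated current algebra is a restricted Lie algebra\<close>

lemma finite_witt_index [simp]: "finite (witt_index p l)"
  by (simp add: witt_index_def)

text \<open>Multiplication of \<open>A\<close>, transported to coordinates on \<open>W\<^sub>\<ell>\<close>.\<close>

definition witt_mult ::
  "nat \<Rightarrow> nat \<Rightarrow> (int \<times> nat \<Rightarrow> 'k) \<Rightarrow> (int \<times> nat \<Rightarrow> 'k) \<Rightarrow> int \<times> nat \<Rightarrow> 'k::field" where
  "witt_mult p l x y = (\<lambda>q. \<Sum>(i, k)\<in>witt_index p l. \<Sum>(j, m)\<in>witt_index p l.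
     x (i, k) * y (j, m) * witt_basis p l (i + j + 1) (k + m) q)"

definition linear_op :: "(('a \<Rightarrow> 'k::field) \<Rightarrow> ('a \<Rightarrow> 'k)) \<Rightarrow> bool" where
  "linear_op T \<longleftrightarrow> (\<forall>x y. T (\<lambda>q. x q + y q) = (\<lambda>q. T x q + T y q)) \<and>
     (\<forall>c x. T (\<lambda>q. c * x q) = (\<lambda>q. c * T x q))"

lemma linear_op_intros:
  "linear_op (\<lambda>x. x)"
  "linear_op S \<Longrightarrow> linear_op T \<Longrightarrow> linear_op (\<lambda>x. S (T x))"
  "linear_op S \<Longrightarrow> linear_op T \<Longrightarrow> linear_op (\<lambda>x q. S x q + T x q)"
  "linear_op S \<Longrightarrow> linear_op T \<Longrightarrow> linear_op (\<lambda>x q. S x q - T x q)"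
  by (simp_all add: linear_op_def algebra_simps)

lemma linear_op_add: "linear_op T \<Longrightarrow> T (\<lambda>q. x q + y q) = (\<lambda>q. T x q + T y q)"
  and linear_op_scale: "linear_op T \<Longrightarrow> T (\<lambda>q. c * x q) = (\<lambda>q. c * T x q)"
  by (simp_all add: linear_op_def)

lemma linear_op_zero: "linear_op T \<Longrightarrow> T (\<lambda>q. 0) = (\<lambda>q. 0)"
  using linear_op_scale[of T 0 "\<lambda>q. 0"] by simp

lemma linear_op_diff: "linear_op T \<Longrightarrow> T (\<lambda>q. x q - y q) = (\<lambda>q. T x q - T y q)"
  using linear_op_add[of T x "\<lambda>q. -1 * y q"] linear_op_scale[of T "-1" y] by simp

lemma linear_op_sum:
  assumes "linear_op T" "finite A"
  shows "T (\<lambda>q. \<Sum>a\<in>A. f a q) = (\<lambda>q. \<Sum>a\<in>A. T (f a) q)"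
  using assms(2)
proof (induction A rule: finite_induct)
  case (insert a A)
  then show ?case
    using linear_op_add[OF assms(1), of "f a" "\<lambda>q. \<Sum>a\<in>A. f a q"] by simp
qed (simp add: linear_op_zero assms(1))

lemma linear_op_witt:
  "linear_op (witt_act p l x)" "linear_op (\<lambda>x. witt_act p l x y)"
  "linear_op (witt_mult p l x)" "linear_op (\<lambda>x. witt_mult p l x y)"
  by (simp_all add: linear_op_def witt_act_def witt_mult_def fun_eq_iff split_def
      algebra_simps sum.distrib sum_distrib_left)

definition witt_space :: "nat \<Rightarrow> nat \<Rightarrow> (int \<times> nat \<Rightarrow> 'k::field) set" where
  "witt_space p l = {x. \<forall>q. q \<notin> witt_index p l \<longrightarrow> x q = 0}"

lemma mem_witt_space: "x \<in> witt_space p l \<longleftrightarrow> (\<forall>q. q \<notin> witt_index p l \<longrightarrow> x q = 0)"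
  by (simp add: witt_space_def)

lemma witt_act_in_space: "witt_act p l x y \<in> witt_space p l"
  and witt_mult_in_space: "witt_mult p l x y \<in> witt_space p l"
  and witt_bracket_in_space: "witt_bracket p l x y \<in> witt_space p l"
  and witt_basis_in_space: "witt_basis p l i k \<in> witt_space p l"
  by (auto simp: mem_witt_space witt_act_def witt_mult_def witt_bracket_def witt_basis_def split_def
      intro!: sum.neutral)

lemma witt_basis_apply:
  assumes "q \<in> witt_index p l"
  shows "witt_basis p l (fst r) (snd r) q = (if q = r then 1 else 0)"
  using assms by (auto simp: witt_basis_def)

lemma witt_basis_outside: "(i, k) \<notin> witt_index p l \<Longrightarrow> witt_basis p l i k = (\<lambda>q. 0)"
  by (auto simp: witt_basis_def)

lemma witt_expand:
  assumes "x \<in> witt_space p l"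
  shows "x = (\<lambda>q. \<Sum>r\<in>witt_index p l. x r * witt_basis p l (fst r) (snd r) q)"
proof
  fix q
  have "(\<Sum>r\<in>witt_index p l. x r * witt_basis p l (fst r) (snd r) q) =
      (\<Sum>r\<in>witt_index p l. if r = q then x r else 0)"
    by (rule sum.cong) (auto simp: witt_basis_def)
  also have "\<dots> = x q" using assms by (cases q) (simp add: mem_witt_space)
  finally show "x q = (\<Sum>r\<in>witt_index p l. x r * witt_basis p l (fst r) (snd r) q)" ..
qed

lemma linear_op_eqI:
  assumes "linear_op S" "linear_op T"
    and "\<And>i k. (i, k) \<in> witt_index p l \<Longrightarrow> S (witt_basis p l i k) = T (witt_basis p l i k)"
    and x: "x \<in> witt_space p l"
  shows "S x = T x"
proof -
  have eq: "U x = (\<lambda>q. \<Sum>r\<in>witt_index p l. x r * U (witt_basis p l (fst r) (snd r)) q)"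
    if "linear_op U" for U :: "(int \<times> nat \<Rightarrow> 'a) \<Rightarrow> _"
    by (subst witt_expand[OF x])
      (simp add: linear_op_sum[OF that] linear_op_scale[OF that])
  show ?thesis
    unfolding eq[OF assms(1)] eq[OF assms(2)]
    by (intro ext sum.cong) (auto simp: assms(3))
qed

lemma witt_sum_basis:
  assumes "(i, k) \<in> witt_index p l" "(j, m) \<in> witt_index p l"
  shows "(\<Sum>a\<in>witt_index p l. \<Sum>b\<in>witt_index p l.
    witt_basis p l i k a * witt_basis p l j m b * g a b) = g (i, k) (j, m)"
proof -
  have "(\<Sum>a\<in>witt_index p l. \<Sum>b\<in>witt_index p l.
      witt_basis p l i k a * witt_basis p l j m b * g a b) =
    (\<Sum>a\<in>witt_index p l. \<Sum>b\<in>witt_index p l.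
      if b = (j, m) then (if a = (i, k) then g a b else 0) else 0)"
    using assms by (intro sum.cong) (auto simp: witt_basis_def)
  also have "\<dots> = g (i, k) (j, m)"
    using assms by simp
  finally show ?thesis .
qed

locale witt_setting =
  fixes p l :: nat and ty :: "'k::field itself"
  assumes char: "CHAR('k) = p" and p0: "p > 0"
begin

abbreviation "E \<equiv> (witt_basis p l :: int \<Rightarrow> nat \<Rightarrow> int \<times> nat \<Rightarrow> 'k)"
abbreviation "V \<equiv> (witt_space p l :: (int \<times> nat \<Rightarrow> 'k) set)"
abbreviation "act \<equiv> (witt_act p l :: (int \<times> nat \<Rightarrow> 'k) \<Rightarrow> _)"
abbreviation "mul \<equiv> (witt_mult p l :: (int \<times> nat \<Rightarrow> 'k) \<Rightarrow> _)"
abbreviation "brk \<equiv> (witt_bracket p l :: (int \<times> nat \<Rightarrow> 'k) \<Rightarrow> _)"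

lemma prime_p: "prime p"
  using prime_CHAR_semidom[where ?'a = 'k] char p0 by simp

lemma of_nat_p: "of_nat p = (0 :: 'k)"
  using of_nat_CHAR[where ?'a = 'k] char by simp

lemma of_int_p: "of_int (int p) = (0 :: 'k)"
  by (simp add: of_nat_p)

lemma act_basis:
  assumes "i \<ge> -1" "j \<ge> -1"
  shows "act (E i k) (E j m) = (\<lambda>q. of_int (j + 1) * E (i + j) (k + m) q)"
proof (cases "(i, k) \<in> witt_index p l \<and> (j, m) \<in> witt_index p l")
  case True
  then show ?thesis
    by (auto simp: witt_act_def split_def witt_sum_basis)
next
  case False
  then have "E i k = (\<lambda>q. 0) \<or> E j m = (\<lambda>q. 0)"
    by (auto simp: witt_basis_outside)
  then have 1: "act (E i k) (E j m) = (\<lambda>q. 0)"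
    by (auto simp: witt_act_def)
  have "(i + j, k + m) \<notin> witt_index p l \<or> j = -1 \<or> j + 1 = int p"
    using False assms by (auto simp: witt_index_def)
  then have "(i + j, k + m) \<notin> witt_index p l \<or> of_int (j + 1) = (0 :: 'k)"
    using of_int_p by fastforce
  then show ?thesis
    unfolding 1 by (auto simp: witt_basis_outside simp del: of_int_add)
qed

lemma mul_basis:
  assumes "i \<ge> -1" "j \<ge> -1"
  shows "mul (E i k) (E j m) = E (i + j + 1) (k + m)"
proof (cases "(i, k) \<in> witt_index p l \<and> (j, m) \<in> witt_index p l")
  case True
  then show ?thesis
    by (auto simp: witt_mult_def split_def witt_sum_basis)
next
  case False
  then have "E i k = (\<lambda>q. 0) \<or> E j m = (\<lambda>q. 0)"
    by (auto simp: witt_basis_outside)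
  then have 1: "mul (E i k) (E j m) = (\<lambda>q. 0)"
    by (auto simp: witt_mult_def)
  have "(i + j + 1, k + m) \<notin> witt_index p l"
    using False assms by (auto simp: witt_index_def)
  then show ?thesis
    by (auto simp: 1 witt_basis_outside)
qed

lemma index_ge: "(i, k) \<in> witt_index p l \<Longrightarrow> -1 \<le> i"
  by (simp add: witt_index_def)

lemma bracket_act: "brk x y = (\<lambda>q. act x y q - act y x q)"
proof
  fix q
  have "act y x q = (\<Sum>(i, k)\<in>witt_index p l. \<Sum>(j, m)\<in>witt_index p l.
     x (i, k) * y (j, m) * (of_int (i + 1) * E (i + j) (k + m) q))"
    unfolding witt_act_def split_def
    by (subst sum.swap) (simp add: add.commute mult.commute mult.left_commute)
  then show "brk x y q = act x y q - act y x q"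
    by (simp add: witt_bracket_def witt_act_def split_def sum_subtractf[symmetric] algebra_simps)
qed

lemma act_derivation:
  assumes "x \<in> V" "a \<in> V" "b \<in> V"
  shows "act x (mul a b) = (\<lambda>q. mul (act x a) b q + mul a (act x b) q)"
proof -
  have 1: "act (E i k) (mul (E j m) (E h n)) =
      (\<lambda>q. mul (act (E i k) (E j m)) (E h n) q + mul (E j m) (act (E i k) (E h n)) q)"
    if "i \<ge> -1" "j \<ge> -1" "h \<ge> -1" for i j h k m n
  proof -
    have A: "mul (\<lambda>q. c * E u v q) y = (\<lambda>q. c * mul (E u v) y q)" for c u v y
      using linear_op_scale[OF linear_op_witt(4)] .
    have B: "mul y (\<lambda>q. c * E u v q) = (\<lambda>q. c * mul y (E u v) q)" for c u v y
      using linear_op_scale[OF linear_op_witt(3)] .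
    have C: "(\<lambda>q. of_int (j + 1) * mul (E (i + j) (k + m)) (E h n) q) =
        (\<lambda>q. of_int (j + 1) * E (i + j + h + 1) (k + m + n) q)"
      using that by (cases "j = -1") (simp_all add: mul_basis)
    have D: "(\<lambda>q. of_int (h + 1) * mul (E j m) (E (i + h) (k + n)) q) =
        (\<lambda>q. of_int (h + 1) * E (i + j + h + 1) (k + m + n) q)"
      using that by (cases "h = -1") (simp_all add: mul_basis add_ac)
    have "act (E i k) (mul (E j m) (E h n)) =
        (\<lambda>q. of_int (j + h + 2) * E (i + j + h + 1) (k + m + n) q)"
      using that by (simp add: mul_basis act_basis add_ac)
    moreover have "(\<lambda>q. mul (act (E i k) (E j m)) (E h n) q + mul (E j m) (act (E i k) (E h n)) q)
       = (\<lambda>q. of_int (j + h + 2) * E (i + j + h + 1) (k + m + n) q)"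
      unfolding act_basis[OF that(1,2)] act_basis[OF that(1,3)] A B
      using fun_cong[OF C] fun_cong[OF D] by (simp add: fun_eq_iff algebra_simps)
    ultimately show ?thesis by simp
  qed
  have 2: "act x (mul (E j m) (E h n)) =
      (\<lambda>q. mul (act x (E j m)) (E h n) q + mul (E j m) (act x (E h n)) q)"
    if "j \<ge> -1" "h \<ge> -1" for j h m n
    by (rule linear_op_eqI[where S = "\<lambda>x. act x (mul (E j m) (E h n))", OF _ _ _ assms(1)])
      (intro linear_op_intros(3) linear_op_intros(2)[OF linear_op_witt(4)]
        linear_op_intros(2)[OF linear_op_witt(3)] linear_op_witt 1 index_ge that; assumption)+
  have 3: "act x (mul a (E h n)) =
      (\<lambda>q. mul (act x a) (E h n) q + mul a (act x (E h n)) q)" if "h \<ge> -1" for h n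
    by (rule linear_op_eqI[where S = "\<lambda>a. act x (mul a (E h n))", OF _ _ _ assms(2)])
      (intro linear_op_intros(3) linear_op_intros(2)[OF linear_op_witt(1)]
        linear_op_intros(2)[OF linear_op_witt(4) linear_op_witt(1)] linear_op_witt 2 index_ge that; assumption)+
  show ?thesis
    by (rule linear_op_eqI[where S = "\<lambda>b. act x (mul a b)", OF _ _ _ assms(3)])
      (intro linear_op_intros(3) linear_op_intros(2)[OF linear_op_witt(1) linear_op_witt(3)]
        linear_op_intros(2)[OF linear_op_witt(3) linear_op_witt(1)] linear_op_witt 3 index_ge; assumption)+
qed

lemma act_left_symmetric:
  assumes "x \<in> V" "y \<in> V" "z \<in> V"
  shows "act (brk x y) z = (\<lambda>q. act x (act y z) q - act y (act x z) q)"
proof -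
  have 1: "act (brk (E i k) (E j m)) (E h n) =
      (\<lambda>q. act (E i k) (act (E j m) (E h n)) q - act (E j m) (act (E i k) (E h n)) q)"
    if "i \<ge> -1" "j \<ge> -1" "h \<ge> -1" for i j h k m n
  proof -
    have A: "act (\<lambda>q. c * E u v q) y = (\<lambda>q. c * act (E u v) y q)" for c u v y
      using linear_op_scale[OF linear_op_witt(2)] .
    have B: "act y (\<lambda>q. c * E u v q) = (\<lambda>q. c * act y (E u v) q)" for c u v y
      using linear_op_scale[OF linear_op_witt(1)] .
    have C: "(\<lambda>q. of_int (h + 1) * act (E i k) (E (j + h) (m + n)) q) =
        (\<lambda>q. of_int (h + 1) * (of_int (j + h + 1) * E (i + j + h) (k + m + n) q))"
      if "i \<ge> -1" "j \<ge> -1" for i j k m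
      using that \<open>h \<ge> -1\<close> by (cases "h = -1") (simp_all add: act_basis add_ac)
    have D: "brk (E i k) (E j m) = (\<lambda>q. of_int (j - i) * E (i + j) (k + m) q)"
      using that by (simp add: bracket_act act_basis add_ac algebra_simps)
    have F: "(\<lambda>q. of_int (j - i) * act (E (i + j) (k + m)) (E h n) q) =
        (\<lambda>q. of_int (j - i) * (of_int (h + 1) * E (i + j + h) (k + m + n) q))"
    proof (cases "i = -1 \<and> j = -1")
      case False
      then have "i + j \<ge> -1" using that by auto
      then show ?thesis using that by (simp add: act_basis add_ac)
    qed simp
    have G: "of_int (h + 1) * (of_int (j + h + 1) * e) - of_int (h + 1) * (of_int (i + h + 1) * e) =
        of_int (j - i) * (of_int (h + 1) * (e :: 'k))" for e
      by (simp add: algebra_simps)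
    show ?thesis
      unfolding act_basis[OF that(1,3)] act_basis[OF that(2,3)] A B D F C[OF that(1,2)] C[OF that(2,1)]
      using G by (simp add: add_ac)
  qed
  have lin_brk: "linear_op (brk x)" "linear_op (\<lambda>x. brk x y)" for x y
    unfolding bracket_act by (intro linear_op_intros(4) linear_op_witt)+
  have 2: "act (brk x (E j m)) (E h n) =
      (\<lambda>q. act x (act (E j m) (E h n)) q - act (E j m) (act x (E h n)) q)"
    if "j \<ge> -1" "h \<ge> -1" for j h m n
    by (rule linear_op_eqI[where S = "\<lambda>x. act (brk x (E j m)) (E h n)", OF _ _ _ assms(1)])
      (intro linear_op_intros(4) linear_op_intros(2)[OF linear_op_witt(2) lin_brk(2)]
        linear_op_intros(2)[OF linear_op_witt(1) linear_op_witt(2)] linear_op_witt 1 index_ge that; assumption)+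
  have 3: "act (brk x y) (E h n) = (\<lambda>q. act x (act y (E h n)) q - act y (act x (E h n)) q)"
    if "h \<ge> -1" for h n
    by (rule linear_op_eqI[where S = "\<lambda>y. act (brk x y) (E h n)", OF _ _ _ assms(2)])
      (intro linear_op_intros(4) linear_op_intros(2)[OF linear_op_witt(2) lin_brk(1)]
        linear_op_intros(2)[OF linear_op_witt(1) linear_op_witt(2)] linear_op_witt 2 index_ge that; assumption)+
  show ?thesis
    by (rule linear_op_eqI[where S = "\<lambda>z. act (brk x y) z", OF _ _ _ assms(3)])
      (intro linear_op_intros(4) linear_op_intros(2)[OF linear_op_witt(1) linear_op_witt(1)]
        linear_op_witt 3 index_ge; assumption)+
qed

lemma act_e0: "x \<in> V \<Longrightarrow> act x (E 0 0) = x"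
  by (rule linear_op_eqI[where S = "\<lambda>x. act x (E 0 0)" and T = "\<lambda>x. x"])
    (auto intro: linear_op_witt linear_op_intros simp: act_basis index_ge)

end

typedef (overloaded) ('a, 'k::field) additive_endo =
  "{f :: ('a \<Rightarrow> 'k) \<Rightarrow> 'a \<Rightarrow> 'k. \<forall>x y. f (\<lambda>q. x q + y q) = (\<lambda>q. f x q + f y q)}"
  morphisms endo_app Abs_additive_endo
  by (rule exI[of _ id]) simp

setup_lifting type_definition_additive_endo

instantiation additive_endo :: (type, field) ring_1
begin
lift_definition zero_additive_endo :: "('a, 'b) additive_endo" is "\<lambda>x q. 0" by simp
lift_definition one_additive_endo :: "('a, 'b) additive_endo" is "\<lambda>x. x" by simp
lift_definition plus_additive_endo :: "('a, 'b) additive_endo \<Rightarrow> ('a, 'b) additive_endo \<Rightarrow> ('a, 'b) additive_endo"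
  is "\<lambda>f g x q. f x q + g x q" by (simp add: algebra_simps)
lift_definition minus_additive_endo :: "('a, 'b) additive_endo \<Rightarrow> ('a, 'b) additive_endo \<Rightarrow> ('a, 'b) additive_endo"
  is "\<lambda>f g x q. f x q - g x q" by (simp add: algebra_simps)
lift_definition uminus_additive_endo :: "('a, 'b) additive_endo \<Rightarrow> ('a, 'b) additive_endo"
  is "\<lambda>f x q. - f x q" by (simp add: algebra_simps)
lift_definition times_additive_endo :: "('a, 'b) additive_endo \<Rightarrow> ('a, 'b) additive_endo \<Rightarrow> ('a, 'b) additive_endo"
  is "\<lambda>f g x. f (g x)" by simp
instance
proof
  show "(0 :: ('a, 'b) additive_endo) \<noteq> 1"
    by transfer (auto simp: fun_eq_iff intro!: exI[of _ "\<lambda>q. 1"])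
qed (transfer; simp add: algebra_simps)+
end

lemmas endo_app_simps =
  zero_additive_endo.rep_eq one_additive_endo.rep_eq plus_additive_endo.rep_eq
  minus_additive_endo.rep_eq uminus_additive_endo.rep_eq times_additive_endo.rep_eq

lemma endo_app_power: "endo_app (a ^ n) x = (endo_app a ^^ n) x"
  by (induction n) (simp_all add: endo_app_simps)

lemma endo_app_of_nat: "endo_app (of_nat n) x = (\<lambda>q. of_nat n * x q)"
  by (induction n) (simp_all add: endo_app_simps algebra_simps)

lemma endo_app_sum: "endo_app (\<Sum>i\<in>A. f i) x q = (\<Sum>i\<in>A. endo_app (f i) x q)"
  by (induction A rule: infinite_finite_induct) (simp_all add: endo_app_simps)

lift_definition act_endo :: "nat \<Rightarrow> nat \<Rightarrow> (int \<times> nat \<Rightarrow> 'k::field) \<Rightarrow> (int \<times> nat, 'k) additive_endo"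
  is witt_act
  using linear_op_add[OF linear_op_witt(1)] by blast

lift_definition mult_endo :: "nat \<Rightarrow> nat \<Rightarrow> (int \<times> nat \<Rightarrow> 'k::field) \<Rightarrow> (int \<times> nat, 'k) additive_endo"
  is witt_mult
  using linear_op_add[OF linear_op_witt(3)] by blast

definition witt_restrict where
  "witt_restrict p l x = (\<lambda>q. if q \<in> witt_index p l then x q else 0)"

lemma witt_restrict: "witt_restrict p l x \<in> witt_space p l"
  by (simp add: mem_witt_space witt_restrict_def)

lemma witt_act_restrict: "witt_act p l x (witt_restrict p l y) = witt_act p l x y"
  and witt_mult_restrict: "witt_mult p l x (witt_restrict p l y) = witt_mult p l x y"
  unfolding witt_act_def witt_mult_def witt_restrict_def by (auto intro!: ext sum.cong)

lemma endo_eqI: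
  assumes "\<And>x. x \<in> witt_space p l \<Longrightarrow> endo_app a x = endo_app b x"
    and "\<And>x. endo_app a (witt_restrict p l x) = endo_app a x"
    and "\<And>x. endo_app b (witt_restrict p l x) = endo_app b x"
  shows "a = b"
proof -
  have "endo_app a x = endo_app b x" for x
    using assms(1)[OF witt_restrict, of x] by (simp only: assms(2,3))
  then show ?thesis by (simp add: endo_app_inject[symmetric] fun_eq_iff)
qed

lemma witt_act_zero_left: "witt_act p l (\<lambda>q. 0) = (\<lambda>x q. 0)"
  and witt_mult_zero_left: "witt_mult p l (\<lambda>q. 0) = (\<lambda>x q. 0)"
  by (simp_all add: witt_act_def witt_mult_def fun_eq_iff)

context witt_setting
begin

abbreviation "pmap \<equiv> (witt_p_map p l :: (int \<times> nat \<Rightarrow> 'k) \<Rightarrow> _)"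
abbreviation "L \<equiv> (act_endo p l :: (int \<times> nat \<Rightarrow> 'k) \<Rightarrow> _)"
abbreviation "M \<equiv> (mult_endo p l :: (int \<times> nat \<Rightarrow> 'k) \<Rightarrow> _)"

lemma of_nat_p_endo: "of_nat p = (0 :: (int \<times> nat, 'k) additive_endo)"
  by (simp add: endo_app_inject[symmetric] fun_eq_iff endo_app_of_nat endo_app_simps of_nat_p)

lemma L_M: "x \<in> V \<Longrightarrow> a \<in> V \<Longrightarrow> L x * M a - M a * L x = M (act x a)"
  by (rule endo_eqI[of p l])
    (simp_all add: endo_app_simps act_endo.rep_eq mult_endo.rep_eq act_derivation
      witt_act_restrict witt_mult_restrict witt_act_in_space)

lemma L_bracket: "x \<in> V \<Longrightarrow> y \<in> V \<Longrightarrow> L (brk x y) = L x * L y - L y * L x"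
  by (rule endo_eqI[of p l])
    (simp_all add: endo_app_simps act_endo.rep_eq act_left_symmetric witt_act_restrict)

lemma funpow_act_in_space: "a \<in> V \<Longrightarrow> (act x ^^ n) a \<in> V"
  by (induction n) (simp_all add: witt_act_in_space)

lemma pmap_in_space: "pmap x \<in> V"
  unfolding witt_p_map_def by (rule funpow_act_in_space[OF witt_basis_in_space])

lemma L_funpow_M:
  assumes "x \<in> V" "a \<in> V"
  shows "((\<lambda>w. L x * w - w * L x) ^^ n) (M a) = M ((act x ^^ n) a)"
  by (induction n) (simp_all add: L_M assms funpow_act_in_space)

lemma L_power_M:
  assumes "x \<in> V" "a \<in> V"
  shows "L x ^ p * M a - M a * L x ^ p = M ((act x ^^ p) a)"
  by (simp only: ad_pow_prime[OF prime_p of_nat_p_endo, symmetric] L_funpow_M[OF assms])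

lemma act_const: "act x (E (-1) k) = (\<lambda>q. 0)" if "x \<in> V"
  by (rule linear_op_eqI[where S = "\<lambda>x. act x (E (-1) k)" and T = "\<lambda>x q. 0", OF _ _ _ that])
    (auto simp: act_basis index_ge linear_op_witt linear_op_def)

lemma L_pmap:
  assumes x: "x \<in> V"
  shows "L (pmap x) = L x ^ p"
proof -
  have p1: "p = Suc (p - 1)" using p0 by simp
  define D where "D = L x ^ p - L (pmap x)"
  note [simp] = endo_app_simps act_endo.rep_eq mult_endo.rep_eq
  have app: "endo_app D y = (\<lambda>q. (act x ^^ p) y q - act (pmap x) y q)" for y
    by (simp add: D_def endo_app_power)
  have const: "endo_app D (E (-1) k) = (\<lambda>q. 0)" for k
  proof -
    have "(act x ^^ p) (E (-1) k) = (act x ^^ (p - 1)) (act x (E (-1) k))"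
      by (subst p1) (simp only: funpow_Suc_right o_apply)
    also have "\<dots> = (\<lambda>q. 0)"
    proof -
      have "(act x ^^ n) (\<lambda>q. 0) = (\<lambda>q. 0)" for n
        by (induction n) (simp_all add: linear_op_zero[OF linear_op_witt(1)])
      then show ?thesis by (simp add: act_const[OF x])
    qed
    finally show ?thesis by (simp add: app act_const pmap_in_space)
  qed
  have "D * M (E 0 0) - M (E 0 0) * D = 
      (L x ^ p * M (E 0 0) - M (E 0 0) * L x ^ p) - (L (pmap x) * M (E 0 0) - M (E 0 0) * L (pmap x))"
    by (simp add: D_def algebra_simps)
  also have "\<dots> = M (pmap x) - M (act (pmap x) (E 0 0))"
    by (simp only: L_power_M[OF x witt_basis_in_space] L_M[OF pmap_in_space witt_basis_in_space]
        witt_p_map_def[symmetric])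
  also have "\<dots> = 0" by (simp add: act_e0[OF pmap_in_space])
  finally have "D * M (E 0 0) = M (E 0 0) * D" by simp
  then have "endo_app (D * M (E 0 0)) y = endo_app (M (E 0 0) * D) y" for y
    by (simp only:)
  then have comm: "endo_app D (mul (E 0 0) y) = mul (E 0 0) (endo_app D y)" for y
    by (simp only: times_additive_endo.rep_eq mult_endo.rep_eq)
  have D0: "endo_app D (E (int n - 1) k) = (\<lambda>q. 0)" for n k
  proof (induction n)
    case 0
    show ?case by (simp add: const)
  next
    case (Suc n)
    have "E (int (Suc n) - 1) k = mul (E 0 0) (E (int n - 1) k)"
      by (simp add: mul_basis)
    then show ?case
      by (simp add: comm Suc linear_op_zero[OF linear_op_witt(3)])
  qed
  have lin_pow: "linear_op (act x ^^ n)" for n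
    by (induction n) (simp_all add: linear_op_def linear_op_add[OF linear_op_witt(1)]
        linear_op_scale[OF linear_op_witt(1)])
  have lin: "linear_op (endo_app D)"
    unfolding app[abs_def] by (intro linear_op_intros(4) lin_pow linear_op_witt)
  have "(act x ^^ p) (witt_restrict p l y) = (act x ^^ p) y" for y
    by (subst (1 2) p1) (simp only: funpow_Suc_right o_apply witt_act_restrict)
  moreover have "endo_app D y = (\<lambda>q. 0)" if "y \<in> V" for y
  proof (rule linear_op_eqI[OF lin _ _ that, of "\<lambda>x q. 0"])
    fix i k assume "(i, k) \<in> witt_index p l"
    then have "int (nat (i + 1)) - 1 = i" using index_ge by fastforce
    then show "endo_app D (E i k) = (\<lambda>q. 0)" using D0[of "nat (i + 1)" k] by (simp only:)
  qed (simp add: linear_op_def)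
  ultimately have "D = 0"
    by (intro endo_eqI[of p l]) (simp_all add: app witt_act_restrict)
  then show ?thesis by (simp add: D_def)
qed

lemma L_inject:
  assumes "x \<in> V" "y \<in> V" "L x = L y"
  shows "x = y"
proof -
  have "endo_app (L x) (E 0 0) = endo_app (L y) (E 0 0)" by (simp only: assms(3))
  then show ?thesis by (simp only: act_endo.rep_eq act_e0[OF assms(1)] act_e0[OF assms(2)])
qed

lemma L_add: "L (\<lambda>q. x q + y q) = L x + L y"
  by (simp add: endo_app_inject[symmetric] fun_eq_iff endo_app_simps act_endo.rep_eq
      linear_op_add[OF linear_op_witt(2)])

lemma witt_restricted_axioms:
  fixes x y :: "int \<times> nat \<Rightarrow> 'k"
  assumes x: "x \<in> V" and y: "y \<in> V"
  shows "brk (pmap x) y = (brk x ^^ p) y"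
    and "pmap (\<lambda>q. c * x q) = (\<lambda>q. c ^ p * pmap x q)"
    and "z \<in> V \<Longrightarrow> (\<lambda>q. brk x (brk y z) q + brk y (brk z x) q + brk z (brk x y) q) = (\<lambda>q. 0)"
proof -
  have brk: "brk u v \<in> V" for u v by (rule witt_bracket_in_space)
  have fb: "(brk x ^^ n) y \<in> V" for n
    by (induction n) (simp_all add: y brk)
  have ad: "((\<lambda>w. L x * w - w * L x) ^^ n) (L y) = L ((brk x ^^ n) y)" for n
    by (induction n) (simp_all add: L_bracket x fb)
  have "L (brk (pmap x) y) = L ((brk x ^^ p) y)"
    by (simp add: L_bracket pmap_in_space y L_pmap x ad[symmetric]
        ad_pow_prime[OF prime_p of_nat_p_endo])
  then show "brk (pmap x) y = (brk x ^^ p) y"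
    by (rule L_inject[OF brk fb])
  have "(act (\<lambda>q. c * x q) ^^ n) v = (\<lambda>q. c ^ n * (act x ^^ n) v q)" for n v
    by (induction n)
      (simp_all add: linear_op_scale[OF linear_op_witt(2)] linear_op_scale[OF linear_op_witt(1)] mult.assoc)
  then show "pmap (\<lambda>q. c * x q) = (\<lambda>q. c ^ p * pmap x q)"
    by (simp add: witt_p_map_def)
  assume z: "z \<in> V"
  have "L (\<lambda>q. brk x (brk y z) q + brk y (brk z x) q + brk z (brk x y) q) = L (\<lambda>q. 0)"
    unfolding L_add
    by (simp add: L_bracket x y z brk algebra_simps)
      (simp add: endo_app_inject[symmetric] fun_eq_iff endo_app_simps act_endo.rep_eq witt_act_zero_left)
  moreover have "(\<lambda>q. brk x (brk y z) q + brk y (brk z x) q + brk z (brk x y) q) \<in> V"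
    using brk by (simp add: mem_witt_space)
  ultimately show "(\<lambda>q. brk x (brk y z) q + brk y (brk z x) q + brk z (brk x y) q) = (\<lambda>q. 0)"
    by (intro L_inject) (simp_all add: mem_witt_space)
qed

abbreviation "W \<equiv> (witt_current p l :: ('k, int \<times> nat \<Rightarrow> 'k) rlie)"

lemma witt_sel:
  "carrier W = V" "bracket W = brk" "p_map W = pmap"
  "x \<oplus>\<^bsub>W\<^esub> y = (\<lambda>q. x q + y q)" "c \<odot>\<^bsub>W\<^esub> x = (\<lambda>q. c * x q)" "\<zero>\<^bsub>W\<^esub> = (\<lambda>q. 0)"
  by (simp_all add: witt_current_def witt_space_def)

lemma vectorspace_witt: "vectorspace class_ring W"
proof -
  have "abelian_group W"
  proof (rule abelian_groupI)
    fix x assume "x \<in> carrier W"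
    then show "\<exists>y\<in>carrier W. y \<oplus>\<^bsub>W\<^esub> x = \<zero>\<^bsub>W\<^esub>"
      by (intro bexI[of _ "\<lambda>q. - x q"]) (auto simp: witt_current_def)
  qed (auto simp: witt_current_def algebra_simps)
  then have "module class_ring W"
    by (intro moduleI class_cring.cring_axioms)
      (auto simp: witt_current_def algebra_simps)
  then show ?thesis
    by (intro vectorspace.intro class_field.field_axioms)
qed

lemma witt_space_add:
  assumes "x \<in> V" "y \<in> V" shows "(\<lambda>q. x q + y q) \<in> V"
  unfolding mem_witt_space
proof (intro allI impI)
  fix q assume "q \<notin> witt_index p l"
  then have "x q = 0" "y q = 0" using assms unfolding mem_witt_space by blast+
  then show "x q + y q = 0" by simp
qed

lemma witt_space_scale:
  assumes "x \<in> V" shows "(\<lambda>q. c * x q) \<in> V"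
  unfolding mem_witt_space
proof (intro allI impI)
  fix q assume "q \<notin> witt_index p l"
  then have "x q = 0" using assms unfolding mem_witt_space by blast
  then show "c * x q = 0" by simp
qed

lemma ad_coeff_in_space:
  assumes "x \<in> V"
  shows "ad_coeff W x y n k \<in> V"
  using assms
proof (induction n arbitrary: k)
  case (Suc n)
  then show ?case
    by (cases k) (simp_all only: ad_coeff.simps witt_sel witt_space_add witt_bracket_in_space)
qed (simp add: witt_sel mem_witt_space)

lemma L_ad_coeff:
  assumes x: "x \<in> V" and y: "y \<in> V"
  shows "L (ad_coeff W x y n k) = ring_ad_coeff (L x) (L y) n k"
proof (induction n arbitrary: k)
  case 0
  show ?case
    by (simp add: witt_current_def)
      (simp add: endo_app_inject[symmetric] fun_eq_iff endo_app_simps act_endo.rep_eq witt_act_zero_left)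
next
  case (Suc n)
  have br: "bracket W = brk" and ad: "add W = (\<lambda>x y q. x q + y q)" by (simp_all add: witt_current_def)
  show ?case
    by (cases k) (simp_all add: br ad L_add L_bracket x y ad_coeff_in_space Suc)
qed

lemma finsum_witt:
  assumes "\<And>i. i \<in> A \<Longrightarrow> f i \<in> V" "finite A"
  shows "finsum W f A = (\<lambda>q. \<Sum>i\<in>A. f i q)"
proof -
  interpret vectorspace class_ring W by (rule vectorspace_witt)
  show ?thesis
    using assms(2,1)
  proof (induction A rule: finite_induct)
    case empty
    show ?case by (simp add: M.finsum_empty witt_sel)
  next
    case (insert a A)
    then have "finsum W f (insert a A) = f a \<oplus>\<^bsub>W\<^esub> finsum W f A"
      by (intro M.finsum_insert) (auto simp: witt_sel)
    then show ?case using insert by (simp add: witt_sel)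
  qed
qed

lemma witt_p_map_add:
  assumes x: "x \<in> V" and y: "y \<in> V"
  shows "pmap (\<lambda>q. x q + y q) =
    (\<lambda>q. pmap x q + pmap y q +
      (\<Sum>i\<in>{1..<p}. inverse (of_nat i) * ad_coeff W x y (p - 1) (i - 1) q))"
proof -
  obtain s where s: "(L x + L y) ^ p = L x ^ p + L y ^ p + (\<Sum>i\<in>{1..<p}. s i)"
    "\<And>i. i \<in> {1..<p} \<Longrightarrow> of_nat i * s i = ring_ad_coeff (L x) (L y) (p - 1) (i - 1)"
    using jacobson[OF prime_p of_nat_p_endo] by metis
  have pm: "pmap u = endo_app (L u ^ p) (E 0 0)" for u
    by (simp add: witt_p_map_def endo_app_power act_endo.rep_eq)
  have si: "endo_app (s i) (E 0 0) q = inverse (of_nat i) * ad_coeff W x y (p - 1) (i - 1) q"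
    if i: "i \<in> {1..<p}" for i q
  proof -
    have "endo_app (of_nat i * s i) (E 0 0) = ad_coeff W x y (p - 1) (i - 1)"
      by (simp add: s(2)[OF i] L_ad_coeff[OF x y, symmetric] act_endo.rep_eq act_e0 ad_coeff_in_space x)
    then have "of_nat i * endo_app (s i) (E 0 0) q = ad_coeff W x y (p - 1) (i - 1) q"
      unfolding times_additive_endo.rep_eq endo_app_of_nat by (rule fun_cong)
    moreover have "of_nat i \<noteq> (0 :: 'k)"
      using i of_nat_eq_0_iff_char_dvd[where ?'a = 'k, of i] char by (auto dest: dvd_imp_le)
    ultimately show ?thesis by (auto simp: field_simps)
  qed
  show ?thesis
    unfolding pm L_add s(1) by (simp add: endo_app_simps endo_app_sum si)
qed

lemma restricted_lie_algebra_witt: "restricted_lie_algebra W"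
proof -
  interpret vectorspace class_ring W by (rule vectorspace_witt)
  note sel = witt_sel
  have lin_brk: "linear_op (brk x)" "linear_op (\<lambda>x. brk x y)" for x y
    unfolding bracket_act by (intro linear_op_intros(4) linear_op_witt)+
  show ?thesis
  proof (unfold_locales, goal_cases)
    case 1 then show ?case unfolding sel using witt_bracket_in_space by blast
  next
    case 2 show ?case unfolding sel by (rule linear_op_add[OF lin_brk(2)])
  next
    case 3 show ?case unfolding sel by (rule linear_op_scale[OF lin_brk(2)])
  next
    case 4 show ?case unfolding sel by (rule linear_op_add[OF lin_brk(1)])
  next
    case 5 show ?case unfolding sel by (rule linear_op_scale[OF lin_brk(1)])
  next
    case 6 then show ?case unfolding sel by (simp add: bracket_act)
  next
    case 7 then show ?case unfolding sel by (intro witt_restricted_axioms(3)) auto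
  next
    case 8 then show ?case unfolding sel using pmap_in_space by blast
  next
    case 9 then show ?case unfolding sel char by (intro witt_restricted_axioms(1)) auto
  next
    case 10 then show ?case unfolding sel char by (intro witt_restricted_axioms(2)) auto
  next
    case (11 x y)
    have "(\<Oplus>\<^bsub>W\<^esub>i\<in>{1..<p}. inverse (of_nat i) \<odot>\<^bsub>W\<^esub> ad_coeff W x y (p - 1) (i - 1)) =
       (\<lambda>q. \<Sum>i\<in>{1..<p}. (inverse (of_nat i) \<odot>\<^bsub>W\<^esub> ad_coeff W x y (p - 1) (i - 1)) q)"
      using 11 unfolding sel by (intro finsum_witt witt_space_scale ad_coeff_in_space) simp_all
    then show ?case
      using witt_p_map_add[of x y] 11 by (simp add: sel char)
  qed
qed

lemma witt_bracket_basis: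
  assumes "(i, k) \<in> witt_index p l" "(j, m) \<in> witt_index p l"
  shows "brk (E i k) (E j m) = (\<lambda>q. of_int (j - i) * E (i + j) (k + m) q)"
  using assms[THEN index_ge] by (simp add: bracket_act act_basis add_ac algebra_simps)

lemma witt_p_map_basis:
  assumes ik: "(i, k) \<in> witt_index p l"
  shows "pmap (E i k) = (if i = 0 then E 0 (k * p) else (\<lambda>q. 0))"
proof -
  have step: "pmap (E i k) = (act (E i k) ^^ (p - 2)) (act (E i k) (act (E i k) (E 0 0)))"
  proof -
    have "p = Suc (Suc (p - 2))" using prime_ge_2_nat[OF prime_p] by simp
    then show ?thesis unfolding witt_p_map_def by (metis funpow_Suc_right o_apply)
  qed
  show ?thesis
  proof (cases "i = -1")
    case True
    have "(act (E i k) ^^ n) (\<lambda>q. 0) = (\<lambda>q. 0)" for n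
      by (induction n) (simp_all add: linear_op_zero[OF linear_op_witt(1)])
    then show ?thesis
      unfolding step using True by (simp add: act_basis)
  next
    case False
    then have i: "i \<ge> 0" using index_ge[OF ik] by simp
    have pow: "(act (E i k) ^^ n) (E 0 0) =
        (\<lambda>q. (\<Prod>j<n. of_int (int j * i + 1)) * E (int n * i) (n * k) q)" for n
    proof (induction n)
      case (Suc n)
      have "0 \<le> int n * i" using i by simp
      have i1: "-1 \<le> i" using i by simp
      have i2: "-1 \<le> int n * i" using \<open>0 \<le> int n * i\<close> by (rule order_trans[rotated]) simp
      then show ?case
        by (simp only: funpow.simps o_apply Suc linear_op_scale[OF linear_op_witt(1)]
            act_basis[OF i1 i2]) (simp add: algebra_simps)
    qed simp
    show ?thesis
    proof (cases "i = 0")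
      case False
      then have "int p \<le> int p * i" using i p0 by simp
      then have "(int p * i, p * k) \<notin> witt_index p l"
        by (auto simp: witt_index_def)
      then show ?thesis
        using False by (simp add: witt_p_map_def pow witt_basis_outside)
    next
      case True
      then show ?thesis
        using pow[of p] by (simp add: witt_p_map_def mult.commute)
    qed
  qed
qed

end

lemma witt_current_restricted:
  assumes "CHAR('k::field) = p" "p > 0"
  shows "restricted_lie_algebra (witt_current p l :: ('k, int \<times> nat \<Rightarrow> 'k) rlie)"
  by (rule witt_setting.restricted_lie_algebra_witt[OF witt_setting.intro[OF assms]])

lemma witt_current_bracket_basis:
  assumes "CHAR('k::field) = p" "p > 0" "(i, k) \<in> witt_index p l" "(j, m) \<in> witt_index p l"
  shows "bracket (witt_current p l) (witt_basis p l i k) (witt_basis p l j m :: int \<times> nat \<Rightarrow> 'k) =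
    (\<lambda>q. of_int (j - i) * witt_basis p l (i + j) (k + m) q)"
  using witt_setting.witt_bracket_basis[OF witt_setting.intro[OF assms(1,2)] assms(3,4)]
  by (simp add: witt_current_def)

lemma witt_current_p_map_basis:
  assumes "CHAR('k::field) = p" "p > 0" "(i, k) \<in> witt_index p l"
  shows "p_map (witt_current p l) (witt_basis p l i k :: int \<times> nat \<Rightarrow> 'k) =
    (if i = 0 then witt_basis p l i (k * p) else (\<lambda>q. 0))"
  using witt_setting.witt_p_map_basis[OF witt_setting.intro[OF assms(1,2)] assms(3)]
  by (simp add: witt_current_def)

end

theory Submission
  imports Defs
begin

text \<open>The induced module is cyclic, as is any simple module, so both are determined by the
  annihilator \<open>K\<close>, in the free algebra, of a generator on which \<open>H = W\<^sub>\<ell>\<^sub>,\<^sub>(\<^sub>s\<^sub>)\<close> acts through \<open>\<chi>\<close>; by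
  Engel's argument every nonzero module contains such a vector.  For \<open>x = e\<^sub>i t\<^sup>k\<close> with \<open>i < s\<close>
  put \<open>y = e\<^sub>r\<^sub>-\<^sub>1\<^sub>-\<^sub>i t\<^sup>\<ell>\<^sup>-\<^sup>k \<in> H\<close>.  Then \<open>[y, x]\<close> is a nonzero multiple of \<open>e\<^sub>r\<^sub>-\<^sub>1 t\<^sup>\<ell>\<close>, which acts
  invertibly because its \<open>p\<close>-th power is the scalar \<open>\<chi>(e\<^sub>r\<^sub>-\<^sub>1 t\<^sup>\<ell>)\<^sup>p \<noteq> 0\<close>.  If the elements \<open>x\<close> are
  adjoined to \<open>H\<close> one at a time, then \<open>y - \<chi>(y)\<close> acts as differentiation with respect to \<open>x\<close>, up to
  an invertible factor and terms of lower order.  Hence the monomials in the \<open>x\<close> with exponents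
  below \<open>p\<close> are linearly independent modulo \<open>K\<close>, and every nonzero vector can be brought back to
  the generator.  So \<open>K\<close> is a maximal left ideal, and it is unique since the intersection
  of two such left ideals is again one.

  That the reduced enveloping algebra is nonzero is shown without the
  Poincare-Birkhoff-Witt theorem, by a module on which it acts: \<open>x \<in> W\<^sub>\<ell>\<close> acts on the polynomial
  functions on \<open>W\<^sub>\<ell>\<close> by the vector field \<open>v \<mapsto> - x \<cdot> v\<close> of the left-symmetric product, plus the
  derivative along it of the linear function \<open>-\<chi>\<close>.  The \<open>p\<close>-character of this action is a function
  whose value at the right unit \<open>e\<^sub>0\<close> is \<open>\<chi>(x)\<^sup>p\<close>.\<close>

section \<open>The free algebra\<close>

text \<open>The choice s = floor(r/2) is a polarization. Two elements of degree at least s bracket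
  into degree at least 2s + 1 \<ge> r, because the coefficient j - i kills equal degrees, so \<chi>
  is a character of H; and for i < s the partner degree r - 1 - i is at least s, so y lies in H. The
  coefficient of [y, x] is 2i - r + 1; it lies between -(r + 1) and -1, hence is nonzero modulo p
  because r < p - 1. The obstacle is that y must remain a scalar after some x have been adjoined.
  This dictates the order, by decreasing i and then decreasing k: y brackets every earlier generator
  into degree at least r or past the last power of t, where \<chi> or the bracket itself vanishes.
  As [y, x] is invertible but need not be central, the comparison with differentiation is made on
  leading terms only. Modules are replaced by left ideals of one free algebra because the simple
  modules to be compared have different carrier types, and because such ideals can be intersected.
  The action of y yields the linear independence, which leaves 1 \<notin> J as the only statement
  that calls for an explicit module.\<close>

definition free_on :: "'a set \<Rightarrow> ('k::field, 'a) free_alg set" where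
  "free_on C = {f. \<forall>w \<in> Poly_Mapping.keys f. set (letters w) \<subseteq> C}"

lemma free_algebra_simps [simp]:
  "carrier (free_algebra L) = free_on (carrier L)"
  "x \<otimes>\<^bsub>free_algebra L\<^esub> y = x * y" "\<one>\<^bsub>free_algebra L\<^esub> = 1"
  "x \<oplus>\<^bsub>free_algebra L\<^esub> y = x + y" "\<zero>\<^bsub>free_algebra L\<^esub> = 0"
  by (simp_all add: free_algebra_def free_on_def)

lemma letters_simps [simp]: "letters 0 = []" "letters (u + v) = letters u @ letters v"
  by (simp_all add: zero_free_word_def plus_free_word_def)

lemma poly_mapping_sum_single:
  "f = (\<Sum>w\<in>Poly_Mapping.keys f. Poly_Mapping.single w (Poly_Mapping.lookup f w))"
proof (rule poly_mapping_eqI)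
  fix u
  have "Poly_Mapping.lookup (\<Sum>w\<in>Poly_Mapping.keys f. Poly_Mapping.single w (Poly_Mapping.lookup f w)) u =
      (\<Sum>w\<in>Poly_Mapping.keys f. if w = u then Poly_Mapping.lookup f w else 0)"
    by (simp add: lookup_sum lookup_single when_def)
  also have "\<dots> = Poly_Mapping.lookup f u" by (simp add: in_keys_iff)
  finally show "Poly_Mapping.lookup f u =
    Poly_Mapping.lookup (\<Sum>w\<in>Poly_Mapping.keys f. Poly_Mapping.single w (Poly_Mapping.lookup f w)) u" ..
qed

lemma scal_mult: "scal (a * b) = scal a * scal b"
  by (simp add: scal_def mult_single)

lemma scal_simps [simp]:
  "scal 0 = 0" "scal 1 = 1" "scal (a + b) = scal a + scal b" "scal (a - b) = scal a - scal b"
  "scal (- a) = - scal a" "scal (a * b) = scal a * scal b" "scal (a ^ n) = scal a ^ n"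
  "scal (of_nat n) = of_nat n"
proof -
  show one: "scal 1 = 1" by (simp add: scal_def)
  show "scal (a ^ n) = scal a ^ n" by (induction n) (simp_all only: power_0 power_Suc one scal_mult)
qed (simp_all add: scal_def single_add single_diff single_uminus mult_single)

lemma scal_commute: "scal c * f = f * scal c"
  by (subst (1 2) poly_mapping_sum_single[of f])
    (simp add: sum_distrib_left sum_distrib_right scal_def mult_single mult.commute)

lemma scal_assoc_commute: "f * (scal c * g) = scal c * (f * g)"
  by (metis scal_commute mult.assoc)

lemma free_on_intros [intro, simp]:
  "0 \<in> free_on C" "1 \<in> free_on C" "scal c \<in> free_on C"
  "x \<in> C \<Longrightarrow> gen x \<in> free_on C"
  by (auto simp: free_on_def scal_def gen_def
      simp flip: single_one split: if_splits)

lemma free_on_add [intro, simp]: "f \<in> free_on C \<Longrightarrow> g \<in> free_on C \<Longrightarrow> f + g \<in> free_on C"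
  by (auto simp: free_on_def dest!: subsetD[OF keys_add])

lemma free_on_uminus [intro, simp]: "f \<in> free_on C \<Longrightarrow> - f \<in> free_on C"
  by (auto simp: free_on_def)

lemma free_on_diff [intro, simp]: "f \<in> free_on C \<Longrightarrow> g \<in> free_on C \<Longrightarrow> f - g \<in> free_on C"
  using free_on_add[of f C "- g"] by simp

lemma free_on_mult [intro, simp]: "f \<in> free_on C \<Longrightarrow> g \<in> free_on C \<Longrightarrow> f * g \<in> free_on C"
  by (fastforce simp: free_on_def dest!: subsetD[OF keys_mult])

lemma free_on_power [intro, simp]: "f \<in> free_on C \<Longrightarrow> f ^ n \<in> free_on C"
  by (induction n) auto

lemma free_on_sum [intro]: "(\<And>i. i \<in> I \<Longrightarrow> f i \<in> free_on C) \<Longrightarrow> sum f I \<in> free_on C"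
  by (induction I rule: infinite_finite_induct) auto

lemma free_on_mono: "C \<subseteq> D \<Longrightarrow> free_on C \<subseteq> free_on D"
  by (auto simp: free_on_def)

text \<open>Words grow by one letter on the left, the form suited to left ideals and left modules:
  what is known about the effect of f on a vector is passed on to \<open>gen x * f\<close>.\<close>

lemma free_on_induct [consumes 1, case_names add scale one gen]:
  fixes f :: "('k::field, 'a) free_alg"
  assumes f: "f \<in> free_on C"
    and add: "\<And>f g. \<lbrakk>f \<in> free_on C; g \<in> free_on C; P f; P g\<rbrakk> \<Longrightarrow> P (f + g)"
    and scale: "\<And>c f. \<lbrakk>f \<in> free_on C; P f\<rbrakk> \<Longrightarrow> P (scal c * f)"
    and one: "P 1"
    and gen: "\<And>x f. \<lbrakk>x \<in> C; f \<in> free_on C; P f\<rbrakk> \<Longrightarrow> P (gen x * f)"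
  shows "P f"
proof -
  have word: "Poly_Mapping.single (Free_Word u) (1 :: 'k) \<in> free_on C \<and> P (Poly_Mapping.single (Free_Word u) 1)"
    if "set u \<subseteq> C" for u
    using that
  proof (induction u)
    case Nil
    then show ?case using one by (auto simp flip: zero_free_word_def)
  next
    case (Cons x u)
    have "Poly_Mapping.single (Free_Word (x # u)) (1 :: 'k) = gen x * Poly_Mapping.single (Free_Word u) 1"
      by (simp add: gen_def mult_single plus_free_word_def)
    then show ?case using Cons by (auto intro: gen)
  qed
  have zero: "P 0" using scale[OF _ one, of 0] by (simp del: scal_simps(2-))
  have single: "Poly_Mapping.single w c \<in> free_on C \<and> P (Poly_Mapping.single w c)"
    if "set (letters w) \<subseteq> C" for w c
  proof -
    have "Poly_Mapping.single w c = scal c * Poly_Mapping.single (Free_Word (letters w)) 1"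
      by (simp add: scal_def mult_single)
    then show ?thesis
      using word[OF that] scale[of "Poly_Mapping.single (Free_Word (letters w)) 1" c]
      by (metis free_on_intros(3) free_on_mult)
  qed
  have sum: "(\<Sum>w\<in>I. Poly_Mapping.single w (Poly_Mapping.lookup f w)) \<in> free_on C \<and>
      P (\<Sum>w\<in>I. Poly_Mapping.single w (Poly_Mapping.lookup f w))"
    if "\<And>w. w \<in> I \<Longrightarrow> set (letters w) \<subseteq> C" for I
    using that
  proof (induction I rule: infinite_finite_induct)
    case (insert w I)
    have i: "set (letters w) \<subseteq> C" "\<And>v. v \<in> I \<Longrightarrow> set (letters v) \<subseteq> C"
      using insert.prems by auto
    show ?case
      unfolding sum.insert[OF insert.hyps]
      using insert.IH[OF i(2)] single[OF i(1), of "Poly_Mapping.lookup f w"]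
      by (metis add free_on_add)
  qed (auto simp: zero)
  have "set (letters w) \<subseteq> C" if "w \<in> Poly_Mapping.keys f" for w
    using f that by (simp add: free_on_def)
  from sum[of "Poly_Mapping.keys f", OF this] show ?thesis
    by (simp only: poly_mapping_sum_single[symmetric])
qed

definition free_ext :: "('k::field \<Rightarrow> 'r::ring_1) \<Rightarrow> ('a \<Rightarrow> 'r) \<Rightarrow> ('k, 'a) free_alg \<Rightarrow> 'r" where
  "free_ext s T f =
     (\<Sum>w\<in>Poly_Mapping.keys f. s (Poly_Mapping.lookup f w) * prod_list (map T (letters w)))"

text \<open>The scalars have a map \<open>s\<close> of their own: it is the identity for the
  character, and it sends c to multiplication by the constant c for the differential operators. That
  \<open>s\<close> commutes with the images of the generators is what makes the extension
  multiplicative.\<close>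

locale free_hom =
  fixes s :: "'k::field \<Rightarrow> 'r::ring_1" and T :: "'a \<Rightarrow> 'r"
  assumes s_add: "s (a + b) = s a + s b" and s_mult: "s (a * b) = s a * s b" and s_one: "s 1 = 1"
    and s_commute: "s c * T x = T x * s c"
begin

abbreviation "ext \<equiv> free_ext s T"

lemma s_zero: "s 0 = 0"
  using s_add[of 0 0] by simp

lemma ext_superset:
  assumes "finite I" "Poly_Mapping.keys f \<subseteq> I"
  shows "ext f = (\<Sum>w\<in>I. s (Poly_Mapping.lookup f w) * prod_list (map T (letters w)))"
  unfolding free_ext_def using assms
  by (intro sum.mono_neutral_left) (auto simp: in_keys_iff s_zero)

lemma ext_add: "ext (f + g) = ext f + ext g"
proof -
  let ?I = "Poly_Mapping.keys f \<union> Poly_Mapping.keys g"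
  have "Poly_Mapping.keys (f + g) \<subseteq> ?I" by (rule keys_add)
  then show ?thesis
    by (simp add: ext_superset[of ?I] lookup_add s_add distrib_right sum.distrib)
qed

lemma ext_single: "ext (Poly_Mapping.single w c) = s c * prod_list (map T (letters w))"
  by (simp add: ext_superset[of "{w}"])

lemma ext_zero: "ext 0 = 0"
  by (simp add: free_ext_def)

lemma ext_scal: "ext (scal c) = s c"
  by (simp add: scal_def ext_single)

lemma ext_gen: "ext (gen x) = T x"
  by (simp add: gen_def ext_single s_one)

lemma ext_one: "ext 1 = 1"
  using ext_scal[of 1] by (simp only: s_one scal_simps)

lemma ext_diff: "ext (f - g) = ext f - ext g"
  using ext_add[of "f - g" g] by simp

lemma ext_uminus: "ext (- f) = - ext f"
  using ext_diff[of 0 f] by (simp add: ext_zero)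

lemma ext_sum: "ext (\<Sum>i\<in>I. f i) = (\<Sum>i\<in>I. ext (f i))"
  by (induction I rule: infinite_finite_induct) (simp_all add: ext_zero ext_add)

lemma ext_mult: "ext (f * g) = ext f * ext g"
proof -
  have comm: "s c * prod_list (map T u) = prod_list (map T u) * s c" for c u
    by (induction u) (simp_all add: s_commute mult.assoc[symmetric], simp add: mult.assoc)
  have single: "ext (Poly_Mapping.single v a * Poly_Mapping.single w b) =
      ext (Poly_Mapping.single v a) * ext (Poly_Mapping.single w b)" for v w a b
  proof -
    have "s b * (prod_list (map T (letters v)) * prod_list (map T (letters w))) =
        prod_list (map T (letters v)) * (s b * prod_list (map T (letters w)))"
      by (simp only: comm[of b "letters v"] mult.assoc[symmetric])
    then show ?thesis
      by (simp add: mult_single ext_single s_mult mult.assoc)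
  qed
  show ?thesis
    by (subst (1 2) poly_mapping_sum_single[of f], subst (1 2) poly_mapping_sum_single[of g])
      (simp only: sum_product ext_sum single)
qed

lemma ext_power: "ext (f ^ n) = ext f ^ n"
  by (induction n) (simp_all add: ext_one ext_mult)

lemmas ext_simps = ext_zero ext_one ext_add ext_diff ext_uminus ext_mult ext_power ext_scal ext_gen

end

lemma free_eval_conv_ext: "free_eval \<chi> = free_ext (\<lambda>c. c) \<chi>"
  by (simp add: free_eval_def free_ext_def fun_eq_iff)

lemma free_hom_id: "free_hom (\<lambda>c. c) (\<chi> :: 'a \<Rightarrow> 'k::field)"
  by unfold_locales (simp_all add: mult.commute)

lemmas free_eval_simps = free_hom.ext_simps[OF free_hom_id, folded free_eval_conv_ext]

section \<open>Enveloping algebras as quotients of the free algebra\<close>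

lemma ring_free_algebra: "ring (free_algebra L)"
proof (rule ringI)
  show "abelian_group (free_algebra L)"
  proof (rule abelian_groupI)
    fix f assume "f \<in> carrier (free_algebra L)"
    then show "\<exists>g\<in>carrier (free_algebra L). g \<oplus>\<^bsub>free_algebra L\<^esub> f = \<zero>\<^bsub>free_algebra L\<^esub>"
      by (intro bexI[of _ "- f"]) auto
  qed (auto simp: add_ac)
  show "Group.monoid (free_algebra L)"
    by unfold_locales (auto simp: mult.assoc)
qed (auto simp: algebra_simps)

lemma free_algebra_uminus [simp]:
  "f \<in> free_on (carrier L) \<Longrightarrow> \<ominus>\<^bsub>free_algebra L\<^esub> f = - f"
proof -
  interpret ring "free_algebra L" by (rule ring_free_algebra)
  show "f \<in> free_on (carrier L) \<Longrightarrow> \<ominus>\<^bsub>free_algebra L\<^esub> f = - f"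
    by (rule minus_equality) auto
qed

lemma free_algebra_minus [simp]:
  "g \<in> free_on (carrier L) \<Longrightarrow> f \<ominus>\<^bsub>free_algebra L\<^esub> g = f - g"
  by (simp add: a_minus_def)

lemma free_algebra_power [simp]: "f [^]\<^bsub>free_algebra L\<^esub> (n::nat) = f ^ n"
  by (induction n) (simp_all add: nat_pow_def power_commutes)

text \<open>Negatives come from multiplication by \<open>scal (- 1)\<close>, so closure under sums
  and under products from both sides already gives an ideal.\<close>

definition alg_ideal :: "'a set \<Rightarrow> ('k::field, 'a) free_alg set \<Rightarrow> bool" where
  "alg_ideal C Q \<longleftrightarrow> Q \<subseteq> free_on C \<and> 0 \<in> Q \<and> (\<forall>f\<in>Q. \<forall>g\<in>Q. f + g \<in> Q) \<and>
     (\<forall>f\<in>free_on C. \<forall>g\<in>Q. f * g \<in> Q \<and> g * f \<in> Q)"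

lemma alg_ideal_iff: "ideal Q (free_algebra L) \<longleftrightarrow> alg_ideal (carrier L) Q"
proof
  assume "ideal Q (free_algebra L)"
  then interpret ideal Q "free_algebra L" .
  show "alg_ideal (carrier L) Q"
    unfolding alg_ideal_def
    using a_subset I_l_closed I_r_closed additive_subgroup.zero_closed[OF is_additive_subgroup]
      additive_subgroup.a_closed[OF is_additive_subgroup]
    by auto
next
  assume Q: "alg_ideal (carrier L) Q"
  have neg: "- f \<in> Q" if "f \<in> Q" for f
  proof -
    have "scal (- 1) * f \<in> Q" using Q that free_on_intros(3) unfolding alg_ideal_def by blast
    then show ?thesis by (simp only: scal_simps) simp
  qed
  interpret ring "free_algebra L" by (rule ring_free_algebra)
  have sub: "subgroup Q (add_monoid (free_algebra L))"
    by (rule add.subgroupI) (use Q neg in \<open>auto simp: alg_ideal_def subset_iff simp flip: a_inv_def\<close>)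
  show "ideal Q (free_algebra L)"
    by (rule idealI[OF ring_free_algebra sub]) (use Q in \<open>auto simp: alg_ideal_def\<close>)
qed

text \<open>The preimage in the free algebra of the ideal of the second quotient. It makes the
  two-step quotient a single one, and it turns out to be the least two-sided ideal that satisfies
  \<open>red_relations\<close>.\<close>

definition red_kernel :: "('k::field, 'a) rlie \<Rightarrow> ('a \<Rightarrow> 'k) \<Rightarrow> ('k, 'a) free_alg set" where
  "red_kernel L \<chi> = {f \<in> free_on (carrier L). env_class L f \<in> red_ideal L \<chi>}"

definition red_relations :: "('k::field, 'a) rlie \<Rightarrow> ('a \<Rightarrow> 'k) \<Rightarrow> ('k, 'a) free_alg set \<Rightarrow> bool" where
  "red_relations L \<chi> Q \<longleftrightarrow>
     (\<forall>x\<in>carrier L. \<forall>y\<in>carrier L. gen (x \<oplus>\<^bsub>L\<^esub> y) - gen x - gen y \<in> Q) \<and>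
     (\<forall>c. \<forall>x\<in>carrier L. gen (c \<odot>\<^bsub>L\<^esub> x) - scal c * gen x \<in> Q) \<and>
     (\<forall>x\<in>carrier L. \<forall>y\<in>carrier L. gen x * gen y - gen y * gen x - gen (bracket L x y) \<in> Q) \<and>
     (\<forall>x\<in>carrier L. gen x ^ CHAR('k) - gen (p_map L x) - scal (\<chi> x ^ CHAR('k)) \<in> Q)"

text \<open>Closure places the defining relations in the free algebra. The locale is used both for
  \<open>W\<close> and for the record whose carrier is cut down to \<open>H\<close>.\<close>

locale lie_carrier =
  fixes L :: "('k::field, 'a) rlie" and \<chi> :: "'a \<Rightarrow> 'k"
  assumes closed: "\<lbrakk>x \<in> carrier L; y \<in> carrier L\<rbrakk> \<Longrightarrow> x \<oplus>\<^bsub>L\<^esub> y \<in> carrier L"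
    "x \<in> carrier L \<Longrightarrow> c \<odot>\<^bsub>L\<^esub> x \<in> carrier L"
    "\<lbrakk>x \<in> carrier L; y \<in> carrier L\<rbrakk> \<Longrightarrow> bracket L x y \<in> carrier L"
    "x \<in> carrier L \<Longrightarrow> p_map L x \<in> carrier L"
begin

abbreviation "F \<equiv> (free_on (carrier L) :: ('k, 'a) free_alg set)"
abbreviation "J \<equiv> red_kernel L \<chi>"

sublocale FA: ring "free_algebra L"
  by (rule ring_free_algebra)

sublocale EI: ideal "env_ideal L" "free_algebra L"
  unfolding env_ideal_def by (rule FA.genideal_ideal) (auto intro: closed)

sublocale E: ring "env L"
  unfolding env_def by (rule EI.quotient_is_ring)

lemma env_class_hom: "env_class L \<in> Ring.ring_hom (free_algebra L) (env L)"
  unfolding env_class_def env_def by (rule EI.rcos_ring_hom)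

lemma env_carrier: "carrier (env L) = env_class L ` F"
  by (auto simp: env_def env_class_def FactRing_def A_RCOSETS_defs a_r_coset_def)

sublocale EH: ring_hom_ring "free_algebra L" "env L" "env_class L"
  by (rule ring_hom_ringI2[OF FA.ring_axioms E.ring_axioms env_class_hom])

lemma env_class_simps:
  assumes "f \<in> F" "g \<in> F"
  shows "env_class L (f + g) = env_class L f \<oplus>\<^bsub>env L\<^esub> env_class L g"
    "env_class L (f - g) = env_class L f \<ominus>\<^bsub>env L\<^esub> env_class L g"
    "env_class L (f * g) = env_class L f \<otimes>\<^bsub>env L\<^esub> env_class L g"
proof -
  show "env_class L (f - g) = env_class L f \<ominus>\<^bsub>env L\<^esub> env_class L g"
    using assms EH.hom_add[of f "- g"] EH.hom_a_inv[of g] by (simp add: a_minus_def)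
qed (use assms EH.hom_add[of f g] EH.hom_mult[of f g] in simp_all)

lemma env_class_power: "f \<in> F \<Longrightarrow> env_class L (f ^ n) = env_class L f [^]\<^bsub>env L\<^esub> n"
  using EH.hom_nat_pow[of f n] by simp

lemma red_generator:
  assumes "x \<in> carrier L"
  shows "env_class L (gen x) [^]\<^bsub>env L\<^esub> CHAR('k) \<ominus>\<^bsub>env L\<^esub> env_class L (gen (p_map L x))
        \<ominus>\<^bsub>env L\<^esub> env_class L (scal (\<chi> x ^ CHAR('k))) =
     env_class L (gen x ^ CHAR('k) - gen (p_map L x) - scal (\<chi> x ^ CHAR('k)))"
  using assms closed(4)
  by (simp add: env_class_simps env_class_power del: scal_simps)

sublocale RI: ideal "red_ideal L \<chi>" "env L"
  unfolding red_ideal_def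
proof (rule E.genideal_ideal, clarify)
  fix x assume "x \<in> carrier L"
  then show "env_class L (gen x) [^]\<^bsub>env L\<^esub> CHAR('k) \<ominus>\<^bsub>env L\<^esub> env_class L (gen (p_map L x))
        \<ominus>\<^bsub>env L\<^esub> env_class L (scal (\<chi> x ^ CHAR('k))) \<in> carrier (env L)"
    using closed(4) by (simp add: red_generator env_carrier del: scal_simps)
qed

sublocale R: ring "red_env L \<chi>"
  unfolding red_env_def by (rule RI.quotient_is_ring)

lemma red_class_hom: "red_class L \<chi> \<in> Ring.ring_hom (free_algebra L) (red_env L \<chi>)"
proof -
  have "red_class L \<chi> = (+>\<^bsub>env L\<^esub>) (red_ideal L \<chi>) \<circ> env_class L"
    by (simp add: fun_eq_iff red_class_def)
  then show ?thesis
    unfolding red_env_def using ring_hom_trans[OF env_class_hom RI.rcos_ring_hom] by simp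
qed

sublocale RH: ring_hom_ring "free_algebra L" "red_env L \<chi>" "red_class L \<chi>"
  by (rule ring_hom_ringI2[OF FA.ring_axioms R.ring_axioms red_class_hom])

lemma red_carrier: "carrier (red_env L \<chi>) = red_class L \<chi> ` F"
proof -
  have "carrier (red_env L \<chi>) = (+>\<^bsub>env L\<^esub>) (red_ideal L \<chi>) ` carrier (env L)"
    by (auto simp: red_env_def FactRing_def A_RCOSETS_defs a_r_coset_def)
  then show ?thesis
    unfolding env_carrier by (auto simp: red_class_def)
qed

lemma red_class_simps:
  assumes "f \<in> F" "g \<in> F"
  shows "red_class L \<chi> (f + g) = red_class L \<chi> f \<oplus>\<^bsub>red_env L \<chi>\<^esub> red_class L \<chi> g"
    "red_class L \<chi> (f * g) = red_class L \<chi> f \<otimes>\<^bsub>red_env L \<chi>\<^esub> red_class L \<chi> g"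
  using assms RH.hom_add[of f g] RH.hom_mult[of f g] by simp_all

lemma red_class_one: "red_class L \<chi> 1 = \<one>\<^bsub>red_env L \<chi>\<^esub>"
  using RH.hom_one by simp

lemma env_class_eq_iff:
  assumes "f \<in> F" "g \<in> F"
  shows "env_class L f = env_class L g \<longleftrightarrow> f - g \<in> env_ideal L"
  unfolding env_class_def using FA.quotient_eq_iff_same_a_r_cos[OF EI.ideal_axioms] assms by simp

lemma red_class_eq_iff:
  assumes "f \<in> F" "g \<in> F"
  shows "red_class L \<chi> f = red_class L \<chi> g \<longleftrightarrow> f - g \<in> J"
proof -
  have "env_class L f \<in> carrier (env L)" "env_class L g \<in> carrier (env L)"
    using assms by (auto simp: env_carrier)
  then show ?thesis
    unfolding red_class_def
    using E.quotient_eq_iff_same_a_r_cos[OF RI.ideal_axioms] env_class_simps(2)[OF assms] assms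
    by (simp add: red_kernel_def)
qed

lemma env_ideal_subset: "env_ideal L \<subseteq> J"
proof
  fix f assume f: "f \<in> env_ideal L"
  then have F: "f \<in> F" using EI.a_subset by auto
  then have "env_class L f = env_class L 0"
    using env_class_eq_iff[of f 0] f by simp
  then have "env_class L f = \<zero>\<^bsub>env L\<^esub>" using EH.hom_zero by simp
  then show "f \<in> J" using F RI.zero_closed by (simp add: red_kernel_def)
qed

lemma env_relations:
  "\<lbrakk>x \<in> carrier L; y \<in> carrier L\<rbrakk> \<Longrightarrow> gen (x \<oplus>\<^bsub>L\<^esub> y) - gen x - gen y \<in> env_ideal L"
  "x \<in> carrier L \<Longrightarrow> gen (c \<odot>\<^bsub>L\<^esub> x) - scal c * gen x \<in> env_ideal L"
  "\<lbrakk>x \<in> carrier L; y \<in> carrier L\<rbrakk> \<Longrightarrow> gen x * gen y - gen y * gen x - gen (bracket L x y) \<in> env_ideal L"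
proof -
  let ?gens = "{gen (x \<oplus>\<^bsub>L\<^esub> y) - gen x - gen y |x y. x \<in> carrier L \<and> y \<in> carrier L} \<union>
      {gen (c \<odot>\<^bsub>L\<^esub> x) - scal c * gen x |c x. x \<in> carrier L} \<union>
      {gen x * gen y - gen y * gen x - gen (bracket L x y) |x y. x \<in> carrier L \<and> y \<in> carrier L}"
  have gens: "?gens \<subseteq> env_ideal L"
    unfolding env_ideal_def by (rule FA.genideal_self) (auto intro: closed)
  show "\<lbrakk>x \<in> carrier L; y \<in> carrier L\<rbrakk> \<Longrightarrow> gen (x \<oplus>\<^bsub>L\<^esub> y) - gen x - gen y \<in> env_ideal L"
    by (rule subsetD[OF gens], rule UnI1, rule UnI1) auto
  show "x \<in> carrier L \<Longrightarrow> gen (c \<odot>\<^bsub>L\<^esub> x) - scal c * gen x \<in> env_ideal L"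
    by (rule subsetD[OF gens], rule UnI1, rule UnI2) auto
  show "\<lbrakk>x \<in> carrier L; y \<in> carrier L\<rbrakk> \<Longrightarrow> gen x * gen y - gen y * gen x - gen (bracket L x y) \<in> env_ideal L"
    by (rule subsetD[OF gens], rule UnI2) auto
qed

lemma red_relations_J: "red_relations L \<chi> J"
proof -
  have "env_class L (gen x ^ CHAR('k) - gen (p_map L x) - scal (\<chi> x ^ CHAR('k))) \<in> red_ideal L \<chi>"
    if "x \<in> carrier L" for x
    unfolding red_generator[OF that, symmetric] red_ideal_def
  proof (rule E.genideal_self[THEN subsetD])
    show "{env_class L (gen x) [^]\<^bsub>env L\<^esub> CHAR('k) \<ominus>\<^bsub>env L\<^esub> env_class L (gen (p_map L x))
        \<ominus>\<^bsub>env L\<^esub> env_class L (scal (\<chi> x ^ CHAR('k))) |x. x \<in> carrier L} \<subseteq> carrier (env L)"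
      using closed(4) by (auto simp: red_generator env_carrier simp del: scal_simps)
  qed (use that in blast)
  then have "gen x ^ CHAR('k) - gen (p_map L x) - scal (\<chi> x ^ CHAR('k)) \<in> J"
    if "x \<in> carrier L" for x
    using that closed(4) by (simp add: red_kernel_def del: scal_simps)
  then show ?thesis
    unfolding red_relations_def
    by (intro conjI ballI allI env_relations[THEN subsetD[OF env_ideal_subset]])
qed

lemma alg_ideal_J: "alg_ideal (carrier L) J"
proof -
  have mem: "f \<in> J \<longleftrightarrow> f \<in> F \<and> red_class L \<chi> f = \<zero>\<^bsub>red_env L \<chi>\<^esub>" for f
    using red_class_eq_iff[of f 0] RH.hom_zero by (auto simp: red_kernel_def)
  show ?thesis
    unfolding alg_ideal_def
  proof (intro conjI ballI)
    show "J \<subseteq> F" by (auto simp: red_kernel_def)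
    show "0 \<in> J" using RH.hom_zero by (simp add: mem)
    fix f g assume fg: "f \<in> J" "g \<in> J"
    then show "f + g \<in> J" by (simp add: mem red_class_simps)
  next
    fix f g assume fg: "f \<in> F" "g \<in> J"
    then show "f * g \<in> J" "g * f \<in> J"
      using RH.hom_closed[of f] by (simp_all add: mem red_class_simps)
  qed
qed

text \<open>The image of \<open>Q\<close> in the enveloping algebra is an ideal containing the
  generators of \<open>red_ideal L \<chi>\<close>. So an element of \<open>J\<close> has the class
  of some g in \<open>Q\<close>, and it differs from g by an element of \<open>env_ideal L\<close>,
  which lies in \<open>Q\<close> too.\<close>

lemma red_kernel_minimal:
  assumes Q: "alg_ideal (carrier L) Q" "red_relations L \<chi> Q"
  shows "J \<subseteq> Q"
proof
  interpret Q: ideal Q "free_algebra L" using Q(1) by (simp add: alg_ideal_iff)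
  have env: "env_ideal L \<subseteq> Q"
    unfolding env_ideal_def
    by (rule FA.genideal_minimal[OF Q.ideal_axioms]) (use Q(2) in \<open>auto simp: red_relations_def\<close>)
  have id: "ideal (env_class L ` Q) (env L)"
    using FA.ring_ideal_imp_quot_ideal[OF EI.ideal_axioms Q.ideal_axioms]
    unfolding env_def by (simp add: env_class_def[abs_def])
  have red: "red_ideal L \<chi> \<subseteq> env_class L ` Q"
    unfolding red_ideal_def
    by (rule E.genideal_minimal[OF id])
      (use Q(2) in \<open>auto simp: red_generator red_relations_def simp del: scal_simps\<close>)
  fix f assume f: "f \<in> J"
  then obtain g where g: "g \<in> Q" "env_class L f = env_class L g"
    using red by (auto simp: red_kernel_def)
  have F: "f \<in> F" "g \<in> F" using f g(1) Q.a_subset by (auto simp: red_kernel_def)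
  have "f - g \<in> Q" using env g(2) env_class_eq_iff[OF F] by blast
  then show "f \<in> Q" using Q.a_closed[OF _ g(1), of "f - g"] by simp
qed

end

context lie_carrier
begin

lemma J_subset: "J \<subseteq> F"
  by (auto simp: red_kernel_def)

lemma J_closed:
  "0 \<in> J" "\<lbrakk>f \<in> J; g \<in> J\<rbrakk> \<Longrightarrow> f + g \<in> J" "\<lbrakk>f \<in> F; g \<in> J\<rbrakk> \<Longrightarrow> f * g \<in> J" "\<lbrakk>f \<in> F; g \<in> J\<rbrakk> \<Longrightarrow> g * f \<in> J"
  using alg_ideal_J by (auto simp: alg_ideal_def)

lemma mem_env_class:
  assumes "g \<in> F"
  shows "f \<in> env_class L g \<longleftrightarrow> f - g \<in> env_ideal L"
proof
  assume "f \<in> env_class L g"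
  then show "f - g \<in> env_ideal L" by (auto simp: env_class_def a_r_coset_def' )
next
  assume "f - g \<in> env_ideal L"
  then show "f \<in> env_class L g"
    unfolding env_class_def a_r_coset_def' by (auto intro!: bexI[of _ "f - g"])
qed

text \<open>Explicit representatives on both levels of the quotient, because
  \<open>red_env_map\<close> and \<open>red_env_eval\<close> are unions and images over all
  representatives.\<close>

lemma mem_red_class:
  assumes g: "g \<in> F"
  shows "a \<in> red_class L \<chi> g \<longleftrightarrow> (\<exists>f\<in>F. a = env_class L f \<and> f - g \<in> J)"
proof
  assume "a \<in> red_class L \<chi> g"
  then obtain b where b: "b \<in> red_ideal L \<chi>" "a = b \<oplus>\<^bsub>env L\<^esub> env_class L g"
    by (auto simp: red_class_def a_r_coset_def')
  then obtain h where h: "h \<in> F" "b = env_class L h"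
    using RI.a_subset by (auto simp: env_carrier)
  with b have "h \<in> J" "a = env_class L (h + g)"
    using g by (auto simp: red_kernel_def env_class_simps)
  then show "\<exists>f\<in>F. a = env_class L f \<and> f - g \<in> J"
    using h g by (intro bexI[of _ "h + g"]) auto
next
  assume "\<exists>f\<in>F. a = env_class L f \<and> f - g \<in> J"
  then obtain f where f: "f \<in> F" "a = env_class L f" "f - g \<in> J" by blast
  then have "a = env_class L (f - g) \<oplus>\<^bsub>env L\<^esub> env_class L g"
    using g env_class_simps(1)[of "f - g" g] by simp
  then show "a \<in> red_class L \<chi> g"
    using f by (auto simp: red_class_def a_r_coset_def' red_kernel_def)
qed

end

section \<open>Passage to a subalgebra\<close>

locale lie_subalgebra = lie_carrier L \<chi> + sub: lie_carrier "L\<lparr>carrier := H\<rparr>" \<chi>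
  for L :: "('k::field, 'a) rlie" and \<chi> :: "'a \<Rightarrow> 'k" and H :: "'a set" +
  assumes H_subset: "H \<subseteq> carrier L"
begin

abbreviation "L' \<equiv> L\<lparr>carrier := H\<rparr>"

lemma sub_F: "free_on H \<subseteq> F"
  by (rule free_on_mono[OF H_subset])

text \<open>Cutting the larger ideal down to the smaller free algebra gives an ideal there which
  contains the relations of \<open>H\<close>, hence the ideal that they generate.\<close>

lemma sub_env_ideal: "env_ideal L' \<subseteq> env_ideal L"
proof -
  have "alg_ideal H (env_ideal L \<inter> free_on H)"
    using EI.ideal_axioms sub_F unfolding alg_ideal_iff alg_ideal_def by auto
  then have id: "ideal (env_ideal L \<inter> free_on H) (free_algebra L')"
    by (simp add: alg_ideal_iff)
  have "{gen (x \<oplus>\<^bsub>L\<^esub> y) - gen x - gen y |x y. x \<in> H \<and> y \<in> H} \<union>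
      {gen (c \<odot>\<^bsub>L\<^esub> x) - scal c * gen x |c x. x \<in> H} \<union>
      {gen x * gen y - gen y * gen x - gen (bracket L x y) |x y. x \<in> H \<and> y \<in> H}
      \<subseteq> env_ideal L \<inter> free_on H"
    using sub.closed(1-3) H_subset
    by (intro Un_least subsetI; elim CollectE exE conjE; hypsubst)
      (simp_all add: env_relations subsetD[OF H_subset])
  then show ?thesis
    unfolding env_ideal_def[of L']
    using sub.FA.genideal_minimal[OF id] by simp
qed

lemma sub_J: "red_kernel L' \<chi> \<subseteq> J"
proof -
  have "alg_ideal H (J \<inter> free_on H)"
    using alg_ideal_J sub_F unfolding alg_ideal_def by auto
  moreover have "red_relations L' \<chi> (J \<inter> free_on H)"
    using red_relations_J H_subset sub.closed unfolding red_relations_def by (auto simp: subset_iff simp del: scal_simps)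
  ultimately have "red_kernel L' \<chi> \<subseteq> J \<inter> free_on H"
    using sub.red_kernel_minimal[of "J \<inter> free_on H"] by (simp del: le_inf_iff)
  then show ?thesis by blast
qed

lemma red_env_map_class:
  assumes g: "g \<in> free_on H"
  shows "red_env_map L \<chi> (red_class L' \<chi> g) = red_class L \<chi> g"
proof -
  have inner: "quot_map (free_algebra L) (env_ideal L) (\<lambda>f. f) (env_class L' f) = env_class L f"
    if f: "f \<in> free_on H" for f
  proof -
    have mem: "b \<in> env_class L' f \<longleftrightarrow> b - f \<in> env_ideal L'" for b
      using sub.mem_env_class[of f] f by simp
    have "env_class L b = env_class L f" if "b \<in> env_class L' f" for b
    proof -
      have "b - f \<in> env_ideal L'" using that by (simp add: mem)
      moreover from this have "b \<in> F"
        using sub.EI.a_subset sub_F f free_on_add[of "b - f" "carrier L" f] by (auto simp: subset_iff)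
      ultimately show ?thesis using env_class_eq_iff[of b f] sub_env_ideal sub_F f by auto
    qed
    moreover have "f \<in> env_class L' f" using sub.EI.zero_closed by (simp add: mem)
    ultimately show ?thesis
      unfolding quot_map_def env_class_def[symmetric] by (intro UN_constant_eq ballI)
  qed
  have mem: "a \<in> red_class L' \<chi> g \<longleftrightarrow> (\<exists>f\<in>free_on H. a = env_class L' f \<and> f - g \<in> red_kernel L' \<chi>)" for a
    using sub.mem_red_class[of g] g by simp
  have "red_ideal L \<chi> +>\<^bsub>env L\<^esub> quot_map (free_algebra L) (env_ideal L) (\<lambda>f. f) a = red_class L \<chi> g"
    if a: "a \<in> red_class L' \<chi> g" for a
  proof -
    from a obtain f where f: "f \<in> free_on H" "a = env_class L' f" "f - g \<in> J"
      using sub_J unfolding mem by auto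
    then have "red_class L \<chi> f = red_class L \<chi> g"
      using red_class_eq_iff[of f g] sub_F g by auto
    then show ?thesis unfolding f(2) inner[OF f(1)] by (simp add: red_class_def)
  qed
  moreover have "env_class L' g \<in> red_class L' \<chi> g"
    unfolding mem using g sub.J_closed(1) by (intro bexI[of _ g]) auto
  ultimately show ?thesis
    unfolding red_env_map_def quot_map_def[of "env L"] by (intro UN_constant_eq ballI)
qed

end

section \<open>The character and its one-dimensional module\<close>

locale lie_character = lie_carrier L \<chi> for L :: "('k::field, 'a) rlie" and \<chi> +
  assumes linear: "linear_form L \<chi>"
    and bracket_zero: "\<lbrakk>x \<in> carrier L; y \<in> carrier L\<rbrakk> \<Longrightarrow> \<chi> (bracket L x y) = 0"
    and p_map_zero: "x \<in> carrier L \<Longrightarrow> \<chi> (p_map L x) = 0"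
begin

text \<open>The kernel of evaluation is an ideal that satisfies the relations: commutators vanish in
  a field, which leaves \<chi> of the bracket, and the two terms \<chi>(x)^p of the power relation
  cancel, which leaves \<chi> of the p-map of x.\<close>

lemma free_eval_J: "f \<in> J \<Longrightarrow> free_eval \<chi> f = 0"
proof -
  have "alg_ideal (carrier L) {f \<in> F. free_eval \<chi> f = 0}"
    by (auto simp: alg_ideal_def free_eval_simps)
  moreover have "red_relations L \<chi> {f \<in> F. free_eval \<chi> f = 0}"
    unfolding red_relations_def
    using linear closed bracket_zero p_map_zero
    by (auto simp: linear_form_def free_eval_simps mult.commute simp del: scal_simps)
  ultimately show "f \<in> J \<Longrightarrow> free_eval \<chi> f = 0"
    using red_kernel_minimal by blast
qed

lemma red_env_eval_class:
  assumes f: "f \<in> F"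
  shows "red_env_eval \<chi> (red_class L \<chi> f) = free_eval \<chi> f"
proof -
  have inner: "the_elem (free_eval \<chi> ` env_class L g) = free_eval \<chi> g" if g: "g \<in> F" for g
  proof -
    have "free_eval \<chi> h = free_eval \<chi> g" if "h \<in> env_class L g" for h
    proof -
      have "h - g \<in> J" using that env_ideal_subset by (auto simp: mem_env_class[OF g])
      then show ?thesis using free_eval_J[of "h - g"] by (simp add: free_eval_simps)
    qed
    moreover have "g \<in> env_class L g"
      using g EI.zero_closed by (simp add: mem_env_class)
    ultimately show ?thesis by (intro the_elem_image_unique) (blast+)
  qed
  have const: "the_elem (free_eval \<chi> ` D) = the_elem (free_eval \<chi> ` env_class L f)"
    if "D \<in> red_class L \<chi> f" for D
  proof -
    obtain g where g: "g \<in> F" "D = env_class L g" "g - f \<in> J"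
      using \<open>D \<in> _\<close> f by (auto simp: mem_red_class)
    then show ?thesis using free_eval_J[OF g(3)] f by (simp add: inner free_eval_simps)
  qed
  have "env_class L f \<in> red_class L \<chi> f"
    using f J_closed(1) by (auto simp: mem_red_class)
  then have "red_env_eval \<chi> (red_class L \<chi> f) = the_elem (free_eval \<chi> ` env_class L f)"
    unfolding red_env_eval_def by (intro the_elem_image_unique const) auto
  then show ?thesis by (simp only: inner[OF f])
qed

lemma one_dim_module_simps [simp]:
  "carrier (one_dim_module \<chi>) = UNIV" "\<zero>\<^bsub>one_dim_module \<chi>\<^esub> = 0"
  "x \<oplus>\<^bsub>one_dim_module \<chi>\<^esub> y = x + y" "a \<odot>\<^bsub>one_dim_module \<chi>\<^esub> x = red_env_eval \<chi> a * x"
  by (simp_all add: one_dim_module_def)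

lemma left_module_one_dim: "left_module (red_env L \<chi>) (one_dim_module \<chi>)"
proof -
  have ab: "abelian_group (one_dim_module \<chi>)"
  proof (rule abelian_groupI)
    fix x assume "x \<in> carrier (one_dim_module \<chi>)"
    show "\<exists>y\<in>carrier (one_dim_module \<chi>). y \<oplus>\<^bsub>one_dim_module \<chi>\<^esub> x = \<zero>\<^bsub>one_dim_module \<chi>\<^esub>"
      by (intro bexI[of _ "- x"]) auto
  qed (auto simp: add_ac)
  show ?thesis
  proof (intro left_module.intro ab R.ring_axioms left_module_axioms.intro)
    fix a b x y assume "a \<in> carrier (red_env L \<chi>)" "b \<in> carrier (red_env L \<chi>)"
    then obtain f g where "f \<in> F" "g \<in> F" "a = red_class L \<chi> f" "b = red_class L \<chi> g"
      by (auto simp: red_carrier)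
    then show "(a \<oplus>\<^bsub>red_env L \<chi>\<^esub> b) \<odot>\<^bsub>one_dim_module \<chi>\<^esub> x = a \<odot>\<^bsub>one_dim_module \<chi>\<^esub> x \<oplus>\<^bsub>one_dim_module \<chi>\<^esub> b \<odot>\<^bsub>one_dim_module \<chi>\<^esub> x"
      "(a \<otimes>\<^bsub>red_env L \<chi>\<^esub> b) \<odot>\<^bsub>one_dim_module \<chi>\<^esub> x = a \<odot>\<^bsub>one_dim_module \<chi>\<^esub> (b \<odot>\<^bsub>one_dim_module \<chi>\<^esub> x)"
      by (simp_all flip: red_class_simps
          add: red_env_eval_class free_eval_simps distrib_right)
  qed (auto simp: algebra_simps red_env_eval_class free_eval_simps simp flip: red_class_one)
qed

lemma simple_one_dim: "simple_left_module (red_env L \<chi>) (one_dim_module \<chi>)"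
  unfolding simple_left_module_def
proof (intro conjI allI impI left_module_one_dim)
  show "carrier (one_dim_module \<chi>) \<noteq> {\<zero>\<^bsub>one_dim_module \<chi>\<^esub>}"
  proof -
    have "(1 :: 'k) \<notin> {0}" by simp
    then show ?thesis by (metis UNIV_I one_dim_module_simps(1,2))
  qed
  fix N assume "Module.submodule N (red_env L \<chi>) (one_dim_module \<chi>)"
  then interpret N: Module.submodule N "red_env L \<chi>" "one_dim_module \<chi>" .
  show "N = {\<zero>\<^bsub>one_dim_module \<chi>\<^esub>} \<or> N = carrier (one_dim_module \<chi>)"
  proof (cases "N \<subseteq> {0}")
    case True
    then show ?thesis using N.one_closed by auto
  next
    case False
    then obtain x where x: "x \<in> N" "x \<noteq> 0" by auto
    have "y \<in> N" for y
      using N.smult_closed[of "red_class L \<chi> (scal (y / x))" x] x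
      by (simp add: red_carrier red_env_eval_class free_eval_simps)
    then show ?thesis by auto
  qed
qed

end

section \<open>Extension of scalars\<close>

locale scalar_extension = S: ring S for S :: "'s ring" (structure) +
  fixes \<phi> :: "'r \<Rightarrow> 's" and R :: "'r ring" and N :: "('r, 'n) module"
  assumes \<phi>_closed: "c \<in> carrier R \<Longrightarrow> \<phi> c \<in> carrier S"
    and N_add: "\<lbrakk>m \<in> carrier N; n \<in> carrier N\<rbrakk> \<Longrightarrow> m \<oplus>\<^bsub>N\<^esub> n \<in> carrier N"
    and N_smult: "\<lbrakk>c \<in> carrier R; n \<in> carrier N\<rbrakk> \<Longrightarrow> c \<odot>\<^bsub>N\<^esub> n \<in> carrier N"
begin

abbreviation "G \<equiv> free_Abelian_group (carrier S \<times> carrier N)"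
abbreviation "rels \<equiv> tensor_relations \<phi> R S N"

definition "B = generate G rels"
definition "tcl z = B #>\<^bsub>G\<^esub> z"
definition "tact c = frag_extend (\<lambda>(a, n). frag_of (c \<otimes> a, n))"
abbreviation "T \<equiv> extend_scalars \<phi> R S N"

sublocale G: comm_group G
  by (rule abelian_free_Abelian_group)

lemma rels_carrier: "rels \<subseteq> carrier G"
proof -
  have diff: "a - b \<in> carrier G" if "a \<in> carrier G" "b \<in> carrier G" for a b
    using that keys_diff[of a b] by auto
  have "frag_of (a, n) \<in> carrier G" if "a \<in> carrier S" "n \<in> carrier N" for a n
    using that by simp
  then show ?thesis
    unfolding tensor_relations_def
    by (intro Un_least subsetI; elim CollectE exE conjE; hypsubst)
      (intro diff; simp only: S.add.m_closed S.m_closed \<phi>_closed N_add N_smult)+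
qed

sublocale B: subgroup B G
  unfolding B_def by (rule G.generate_is_subgroup[OF rels_carrier])

sublocale N: normal B G
  by (rule G.subgroup_imp_normal[OF B.subgroup_axioms])

lemma rels_B: "rels \<subseteq> B"
  unfolding B_def by (auto intro: generate.incl)

lemma B_diff: "\<lbrakk>a \<in> B; b \<in> B\<rbrakk> \<Longrightarrow> a - b \<in> B"
  using B.m_closed[OF _ B.m_inv_closed, of a b] B.mem_carrier[of b] by simp

lemma B_add: "\<lbrakk>a \<in> B; b \<in> B\<rbrakk> \<Longrightarrow> a + b \<in> B"
  using B.m_closed[of a b] by simp

lemma G_add: "\<lbrakk>a \<in> carrier G; b \<in> carrier G\<rbrakk> \<Longrightarrow> a + b \<in> carrier G"
  using G.m_closed[of a b] by simp

lemma G_diff: "\<lbrakk>a \<in> carrier G; b \<in> carrier G\<rbrakk> \<Longrightarrow> a - b \<in> carrier G"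
  using keys_diff[of a b] by auto

lemma carrier_T: "carrier T = tcl ` carrier G"
  by (simp add: extend_scalars_def Let_def carrier_FactGroup tcl_def[abs_def] B_def)

lemma tcl_eq_iff:
  assumes "z \<in> carrier G" "w \<in> carrier G"
  shows "tcl z = tcl w \<longleftrightarrow> z - w \<in> B"
proof
  assume "tcl z = tcl w"
  then have "z \<in> tcl w"
    using G.rcos_self[OF assms(1) B.subgroup_axioms] by (simp add: tcl_def)
  then show "z - w \<in> B" by (auto simp: tcl_def r_coset_def)
next
  assume "z - w \<in> B"
  then have "z \<in> tcl w" by (auto simp: tcl_def r_coset_def intro!: bexI[of _ "z - w"])
  then show "tcl z = tcl w"
    unfolding tcl_def by (rule G.repr_independence[OF _ assms(2) B.subgroup_axioms, symmetric])
qed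

lemma add_T: "\<lbrakk>z \<in> carrier G; w \<in> carrier G\<rbrakk> \<Longrightarrow> tcl z \<oplus>\<^bsub>T\<^esub> tcl w = tcl (z + w)"
  using N.rcos_sum[of z w] by (simp add: extend_scalars_def Let_def tcl_def B_def)

lemma zero_T: "\<zero>\<^bsub>T\<^esub> = tcl 0"
  using G.coset_mult_one[OF B.subset] by (simp add: extend_scalars_def Let_def tcl_def B_def)

lemma tact_diff: "tact c (z - w) = tact c z - tact c w"
  by (simp add: tact_def frag_extend_diff)

lemma tact_add: "tact c (z + w) = tact c z + tact c w"
  by (simp add: tact_def frag_extend_add)

lemma tact_of: "tact c (frag_of (a, n)) = frag_of (c \<otimes> a, n)"
  by (simp add: tact_def)

lemma tact_zero: "tact c 0 = 0"
  by (simp add: tact_def)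

lemma G_induct [consumes 1, case_names zero diff of]:
  assumes "z \<in> carrier G" "P 0"
    "\<And>x y. \<lbrakk>x \<in> carrier G; y \<in> carrier G; P x; P y\<rbrakk> \<Longrightarrow> P (x - y)"
    "\<And>a n. \<lbrakk>a \<in> carrier S; n \<in> carrier N\<rbrakk> \<Longrightarrow> P (frag_of (a, n))"
  shows "P z"
  by (rule free_Abelian_group_induct[of z "carrier S \<times> carrier N"]) (use assms in auto)

lemma tact_closed: "\<lbrakk>c \<in> carrier S; z \<in> carrier G\<rbrakk> \<Longrightarrow> tact c z \<in> carrier G"
  by (rotate_tac, induction z rule: G_induct)
    (simp_all add: tact_zero tact_of tact_diff G_diff del: carrier_free_Abelian_group_iff, simp_all)

lemma relsI:
  "\<lbrakk>a \<in> carrier S; b \<in> carrier S; n \<in> carrier N\<rbrakk> \<Longrightarrow>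
    frag_of (a \<oplus> b, n) - frag_of (a, n) - frag_of (b, n) \<in> rels"
  "\<lbrakk>a \<in> carrier S; m \<in> carrier N; n \<in> carrier N\<rbrakk> \<Longrightarrow>
    frag_of (a, m \<oplus>\<^bsub>N\<^esub> n) - frag_of (a, m) - frag_of (a, n) \<in> rels"
  "\<lbrakk>a \<in> carrier S; d \<in> carrier R; n \<in> carrier N\<rbrakk> \<Longrightarrow>
    frag_of (a \<otimes> \<phi> d, n) - frag_of (a, d \<odot>\<^bsub>N\<^esub> n) \<in> rels"
  unfolding tensor_relations_def
  by ((rule UnI1, rule UnI1, blast), (rule UnI1, rule UnI2, blast), (rule UnI2, blast))

lemma relsE [consumes 1]:
  assumes "z \<in> rels"
  obtains
    (add_left) a b n where "a \<in> carrier S" "b \<in> carrier S" "n \<in> carrier N"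
      "z = frag_of (a \<oplus> b, n) - frag_of (a, n) - frag_of (b, n)"
  | (add_right) a m n where "a \<in> carrier S" "m \<in> carrier N" "n \<in> carrier N"
      "z = frag_of (a, m \<oplus>\<^bsub>N\<^esub> n) - frag_of (a, m) - frag_of (a, n)"
  | (balance) a d n where "a \<in> carrier S" "d \<in> carrier R" "n \<in> carrier N"
      "z = frag_of (a \<otimes> \<phi> d, n) - frag_of (a, d \<odot>\<^bsub>N\<^esub> n)"
  using assms unfolding tensor_relations_def by (elim UnE CollectE exE conjE) blast+

lemma tact_rels:
  assumes c: "c \<in> carrier S" and z: "z \<in> rels"
  shows "tact c z \<in> rels"
  using z
proof (cases rule: relsE)
  case (add_left a b n)
  then show ?thesis
    using c relsI(1)[of "c \<otimes> a" "c \<otimes> b" n] by (simp add: tact_diff tact_of S.r_distr)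
next
  case (add_right a m n)
  then show ?thesis
    using c relsI(2)[of "c \<otimes> a" m n] by (simp add: tact_diff tact_of)
next
  case (balance a d n)
  then show ?thesis
    using c relsI(3)[of "c \<otimes> a" d n] \<phi>_closed by (simp add: tact_diff tact_of S.m_assoc)
qed

lemma tact_B:
  assumes c: "c \<in> carrier S" and z: "z \<in> B"
  shows "tact c z \<in> B"
  using z unfolding B_def
proof (induction z rule: generate.induct)
  case one
  then show ?case using B.one_closed by (simp add: tact_zero B_def)
next
  case (incl h)
  then show ?case using tact_rels[OF c] rels_B by (auto simp: B_def)
next
  case (inv h)
  have h: "h \<in> carrier G" using inv rels_carrier by blast
  have "tact c (inv\<^bsub>G\<^esub> h) = 0 - tact c h"
    using h by (simp add: tact_diff[of c 0 h, simplified] tact_zero)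
  moreover have "tact c h \<in> B" using tact_rels[OF c inv] rels_B by blast
  ultimately show ?case using B_diff[OF B.one_closed[simplified], of "tact c h"] by (simp add: B_def)
next
  case (eng h1 h2)
  then show ?case using B_add by (simp add: tact_add B_def)
qed

lemma smult_T:
  assumes c: "c \<in> carrier S" and z: "z \<in> carrier G"
  shows "c \<odot>\<^bsub>T\<^esub> tcl z = tcl (tact c z)"
proof -
  have "c \<odot>\<^bsub>T\<^esub> tcl z = (\<Union>w\<in>tcl z. tcl (tact c w))"
    by (simp add: extend_scalars_def Let_def tcl_def B_def tact_def)
  \<comment> \<open>All representatives in the union contribute the same coset, since
    \<open>tact c\<close> preserves \<open>B\<close>.\<close>
  also have "\<dots> = tcl (tact c z)"
  proof (intro UN_constant_eq ballI)
    show "z \<in> tcl z"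
      unfolding tcl_def by (rule G.rcos_self[OF z B.subgroup_axioms])
    fix w assume w: "w \<in> tcl z"
    then have wz: "w - z \<in> B" by (auto simp: tcl_def r_coset_def)
    have "w \<in> carrier G" using G_add[OF B.mem_carrier[OF wz] z] by simp
    then show "tcl (tact c w) = tcl (tact c z)"
      using tact_B[OF c wz] by (simp only: tcl_eq_iff tact_closed c z tact_diff)
  qed
  finally show ?thesis .
qed

lemma left_module_T: "left_module S T"
proof -
  have ab: "abelian_group T"
  proof (rule abelian_groupI)
    fix x assume "x \<in> carrier T"
    then obtain z where z: "z \<in> carrier G" "x = tcl z" by (auto simp: carrier_T)
    have "- z \<in> carrier G" using z by simp
    then show "\<exists>y\<in>carrier T. y \<oplus>\<^bsub>T\<^esub> x = \<zero>\<^bsub>T\<^esub>"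
      using z by (intro bexI[of _ "tcl (- z)"]) (simp_all add: add_T zero_T carrier_T del: carrier_free_Abelian_group_iff)
    show "\<zero>\<^bsub>T\<^esub> \<oplus>\<^bsub>T\<^esub> x = x"
      using add_T[of 0 z] z by (simp add: zero_T)
  next
    show "\<zero>\<^bsub>T\<^esub> \<in> carrier T" by (simp add: zero_T carrier_T)
  qed (auto simp add: carrier_T add_T G_add add_ac simp del: carrier_free_Abelian_group_iff)
  show ?thesis
  proof (intro left_module.intro ab S.ring_axioms left_module_axioms.intro)
    fix a b x y assume a: "a \<in> carrier S" and b: "b \<in> carrier S"
    assume "x \<in> carrier T"
    then obtain z where z: "z \<in> carrier G" "x = tcl z" by (auto simp: carrier_T)
    have "tact (a \<oplus> b) z - tact a z - tact b z \<in> B"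
      using z(1)
    proof (induction z rule: G_induct)
      case zero
      then show ?case using B.one_closed by (simp add: tact_zero)
    next
      case (diff x y)
      then show ?case using B_diff[OF diff(3,4)] by (simp add: tact_diff algebra_simps)
    next
      case (of c n)
      then show ?case
        using rels_B relsI(1)[of "a \<otimes> c" "b \<otimes> c" n] a b by (auto simp: tact_of S.l_distr)
    qed
    then show "(a \<oplus> b) \<odot>\<^bsub>T\<^esub> x = a \<odot>\<^bsub>T\<^esub> x \<oplus>\<^bsub>T\<^esub> b \<odot>\<^bsub>T\<^esub> x"
      unfolding z(2) using z(1) a b
      by (simp add: smult_T add_T tact_closed tcl_eq_iff G_add diff_diff_eq del: carrier_free_Abelian_group_iff)
    have "tact (a \<otimes> b) z = tact a (tact b z)"
      using z(1) by (induction z rule: G_induct) (use a b in \<open>simp_all add: tact_zero tact_diff tact_of S.m_assoc\<close>)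
    then show "(a \<otimes> b) \<odot>\<^bsub>T\<^esub> x = a \<odot>\<^bsub>T\<^esub> (b \<odot>\<^bsub>T\<^esub> x)"
      unfolding z(2) using z(1) a b
      by (simp add: smult_T tact_closed del: carrier_free_Abelian_group_iff)
  next
    fix x assume "x \<in> carrier T"
    then obtain z where z: "z \<in> carrier G" "x = tcl z" by (auto simp: carrier_T)
    have "tact \<one> z = z"
      using z(1) by (induction z rule: G_induct) (simp_all add: tact_zero tact_diff tact_of)
    then show "\<one> \<odot>\<^bsub>T\<^esub> x = x"
      unfolding z(2) using z(1) by (simp add: smult_T del: carrier_free_Abelian_group_iff)
  qed (auto simp add: carrier_T add_T smult_T tact_closed tact_add G_add simp del: carrier_free_Abelian_group_iff)
qed

end

section \<open>Cyclic modules and left ideals\<close>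

definition alg_left_ideal :: "'a set \<Rightarrow> ('k::field, 'a) free_alg set \<Rightarrow> bool" where
  "alg_left_ideal C K \<longleftrightarrow> K \<subseteq> free_on C \<and> 0 \<in> K \<and> (\<forall>f\<in>K. \<forall>g\<in>K. f + g \<in> K) \<and>
     (\<forall>f\<in>free_on C. \<forall>g\<in>K. f * g \<in> K)"

text \<open>The left ideals that are annihilators of a nonzero vector on which \<open>H\<close> acts through \<open>\<chi>\<close>.\<close>

definition eigen_ideal :: "('k::field, 'a) rlie \<Rightarrow> 'a set \<Rightarrow> ('a \<Rightarrow> 'k) \<Rightarrow> ('k, 'a) free_alg set \<Rightarrow> bool" where
  "eigen_ideal L H \<chi> K \<longleftrightarrow> alg_left_ideal (carrier L) K \<and> red_kernel L \<chi> \<subseteq> K \<and> 1 \<notin> K \<and>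
     (\<forall>h\<in>H. gen h - scal (\<chi> h) \<in> K)"

lemma alg_left_ideal_uminus:
  assumes "alg_left_ideal C K" "f \<in> K" shows "- f \<in> K"
proof -
  have "scal (- 1) * f \<in> K" using assms free_on_intros(3) unfolding alg_left_ideal_def by blast
  then show ?thesis by (simp only: scal_simps) simp
qed

lemma alg_left_ideal_diff:
  assumes "alg_left_ideal C K" "f \<in> K" "g \<in> K" shows "f - g \<in> K"
  using assms alg_left_ideal_uminus[OF assms(1,3)] unfolding alg_left_ideal_def
  by (metis diff_conv_add_uminus)

text \<open>In \<open>gen x * f\<close> the inner factor becomes a scalar first; that scalar is
  central, so \<open>gen x\<close> then meets the generator of the cyclic module directly and
  becomes \<chi>(x). Only left multiples of elements of \<open>K\<close> occur.\<close>

lemma eigen_ideal_eval: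
  assumes K: "eigen_ideal L H \<chi> K" and H: "H \<subseteq> carrier L" and f: "f \<in> free_on H"
  shows "f - scal (free_eval \<chi> f) \<in> K"
  using f
proof (induction f rule: free_on_induct)
  have K: "alg_left_ideal (carrier L) K" "\<And>h. h \<in> H \<Longrightarrow> gen h - scal (\<chi> h) \<in> K"
    using K by (auto simp: eigen_ideal_def)
  then have mult: "\<And>f g. f \<in> free_on (carrier L) \<Longrightarrow> g \<in> K \<Longrightarrow> f * g \<in> K"
    and plus: "\<And>f g. f \<in> K \<Longrightarrow> g \<in> K \<Longrightarrow> f + g \<in> K" and "0 \<in> K"
    by (auto simp: alg_left_ideal_def)
  {
    case (add f g)
    then show ?case using plus[OF add(3,4)] by (simp add: free_eval_simps algebra_simps)
  next
    case (scale c f)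
    then show ?case using mult[OF _ scale(2), of "scal c"] by (simp add: free_eval_simps algebra_simps)
  next
    case one
    then show ?case using \<open>0 \<in> K\<close> by (simp add: free_eval_simps)
  next
    case (gen x f)
    have "gen x * (f - scal (free_eval \<chi> f)) + scal (free_eval \<chi> f) * (gen x - scal (\<chi> x)) =
        gen x * f - scal (free_eval \<chi> (gen x * f))"
      by (simp add: free_eval_simps right_diff_distrib scal_commute[of "free_eval \<chi> f"])
    then show ?case
      using plus[OF mult[OF _ gen(3), of "gen x"] mult[OF _ K(2)[OF gen(1)], of "scal (free_eval \<chi> f)"]]
        gen(1) H by auto
  }
qed

locale red_module = lie_carrier L \<chi> + M: left_module "red_env L \<chi>" M
  for L :: "('k::field, 'a) rlie" and \<chi> :: "'a \<Rightarrow> 'k" and M :: "(('k, 'a) free_alg set set, 'm) module"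
begin

abbreviation "R \<equiv> red_env L \<chi>"

definition act :: "('k, 'a) free_alg \<Rightarrow> 'm \<Rightarrow> 'm" where
  "act f v = red_class L \<chi> f \<odot>\<^bsub>M\<^esub> v"

definition ann :: "'m \<Rightarrow> ('k, 'a) free_alg set" where
  "ann v = {f \<in> F. act f v = \<zero>\<^bsub>M\<^esub>}"

lemma red_class_closed: "f \<in> F \<Longrightarrow> red_class L \<chi> f \<in> carrier R"
  by (simp add: red_carrier)

lemma act_closed [simp]: "\<lbrakk>f \<in> F; v \<in> carrier M\<rbrakk> \<Longrightarrow> act f v \<in> carrier M"
  by (simp add: act_def red_class_closed)

lemma act_simps:
  "\<lbrakk>f \<in> F; g \<in> F; v \<in> carrier M\<rbrakk> \<Longrightarrow> act (f + g) v = act f v \<oplus>\<^bsub>M\<^esub> act g v"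
  "\<lbrakk>f \<in> F; g \<in> F; v \<in> carrier M\<rbrakk> \<Longrightarrow> act (f * g) v = act f (act g v)"
  "v \<in> carrier M \<Longrightarrow> act 1 v = v"
  "\<lbrakk>f \<in> F; v \<in> carrier M; w \<in> carrier M\<rbrakk> \<Longrightarrow> act f (v \<oplus>\<^bsub>M\<^esub> w) = act f v \<oplus>\<^bsub>M\<^esub> act f w"
  by (simp_all add: act_def red_class_simps red_class_closed M.smult_l_distr M.smult_assoc
      red_class_one M.smult_r_distr)

lemma act_zero_right: "f \<in> F \<Longrightarrow> act f \<zero>\<^bsub>M\<^esub> = \<zero>\<^bsub>M\<^esub>"
  using act_simps(4)[of f "\<zero>\<^bsub>M\<^esub>" "\<zero>\<^bsub>M\<^esub>"] M.add.l_cancel_one'[of "act f \<zero>\<^bsub>M\<^esub>" "act f \<zero>\<^bsub>M\<^esub>"] by simp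

lemma act_zero: "v \<in> carrier M \<Longrightarrow> act 0 v = \<zero>\<^bsub>M\<^esub>"
  using act_simps(1)[of 0 0 v] M.add.l_cancel_one'[of "act 0 v" "act 0 v"] by simp

lemma act_diff:
  assumes "f \<in> F" "g \<in> F" "v \<in> carrier M"
  shows "act (f - g) v = act f v \<ominus>\<^bsub>M\<^esub> act g v"
proof -
  have "act (f - g) v \<oplus>\<^bsub>M\<^esub> act g v = act f v" using act_simps(1)[of "f - g" g v] assms by simp
  then show ?thesis
    using assms M.add.inv_solve_right[of "act (f - g) v" "act f v" "act g v"] by (simp add: a_minus_def)
qed

lemma act_eq_iff:
  assumes "f \<in> F" "g \<in> F" "v \<in> carrier M"
  shows "act f v = act g v \<longleftrightarrow> f - g \<in> ann v"
proof
  assume "act f v = act g v"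
  then show "f - g \<in> ann v"
    using assms by (simp add: ann_def act_diff a_minus_def M.r_neg)
next
  assume "f - g \<in> ann v"
  then show "act f v = act g v"
    using act_simps(1)[of "f - g" g v] assms by (simp add: ann_def)
qed

lemma ann_left_ideal: "v \<in> carrier M \<Longrightarrow> alg_left_ideal (carrier L) (ann v)"
  unfolding alg_left_ideal_def
  by (auto simp: ann_def act_simps act_zero act_zero_right)

lemma J_ann:
  assumes v: "v \<in> carrier M"
  shows "J \<subseteq> ann v"
proof
  fix f assume f: "f \<in> J"
  then have "f \<in> F" "red_class L \<chi> f = red_class L \<chi> 0"
    using J_subset red_class_eq_iff[of f 0] by auto
  then show "f \<in> ann v"
    using act_zero[OF v] by (simp add: ann_def act_def)
qed

lemma one_ann: "v \<in> carrier M \<Longrightarrow> 1 \<in> ann v \<longleftrightarrow> v = \<zero>\<^bsub>M\<^esub>"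
  by (simp add: ann_def act_simps)

lemma submodule_eq:
  assumes "carrier M = (\<lambda>f. act f v) ` F" "v \<in> N" "Module.submodule N R M"
  shows "N = carrier M"
proof -
  interpret N: Module.submodule N R M by fact
  have "act f v \<in> N" if "f \<in> F" for f
    using N.smult_closed[OF red_class_closed[OF that] assms(2)] by (simp add: act_def)
  then show ?thesis using N.subset assms(1) by auto
qed

lemma simple_if_maximal:
  assumes cyclic: "carrier M = (\<lambda>f. act f v) ` F" and v: "v \<in> carrier M" "v \<noteq> \<zero>\<^bsub>M\<^esub>"
    and max: "\<And>f. \<lbrakk>f \<in> F; f \<notin> ann v\<rbrakk> \<Longrightarrow> \<exists>g\<in>F. g * f - 1 \<in> ann v"
  shows "simple_left_module R M"
  unfolding simple_left_module_def
proof (intro conjI allI impI)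
  show "left_module R M" by (rule M.left_module_axioms)
  show "carrier M \<noteq> {\<zero>\<^bsub>M\<^esub>}" using v by blast
  fix N assume sub: "Module.submodule N R M"
  then interpret N: Module.submodule N R M .
  show "N = {\<zero>\<^bsub>M\<^esub>} \<or> N = carrier M"
  proof (rule disjCI)
    assume "N \<noteq> carrier M"
    then have vN: "v \<notin> N" using submodule_eq[OF cyclic _ sub] by blast
    have "N \<subseteq> {\<zero>\<^bsub>M\<^esub>}"
    proof (rule subsetI, rule ccontr)
      fix x assume x: "x \<in> N" and "x \<notin> {\<zero>\<^bsub>M\<^esub>}"
      then have "x \<noteq> \<zero>\<^bsub>M\<^esub>" by simp
      obtain f where f: "f \<in> F" "x = act f v" using x N.subset cyclic by auto
      then obtain g where g: "g \<in> F" "g * f - 1 \<in> ann v"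
        using max \<open>x \<noteq> _\<close> by (auto simp: ann_def)
      then have "act g x = v"
        using f v act_eq_iff[of "g * f" 1 v] by (simp add: act_simps)
      then show False
        using N.smult_closed[OF red_class_closed[OF g(1)] x] vN by (simp add: act_def)
    qed
    moreover have "\<zero>\<^bsub>M\<^esub> \<in> N" using N.one_closed by simp
    ultimately show "N = {\<zero>\<^bsub>M\<^esub>}" by (intro equalityI) simp_all
  qed
qed

lemma simple_cyclic:
  assumes simple: "simple_left_module R M" and v: "v \<in> carrier M" "v \<noteq> \<zero>\<^bsub>M\<^esub>"
  shows "carrier M = (\<lambda>f. act f v) ` F"
proof -
  let ?N = "(\<lambda>f. act f v) ` F"
  have sg: "subgroup ?N (add_monoid M)"
  proof (rule M.add.subgroupI)
    fix x assume "x \<in> ?N"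
    then obtain f where f: "f \<in> F" "x = act f v" by auto
    have "act (0 - f) v = \<ominus>\<^bsub>M\<^esub> x"
      using f v act_diff[of 0 f v] by (simp add: act_zero a_minus_def)
    then show "\<ominus>\<^bsub>M\<^esub> x \<in> ?N" using f by (metis diff_0 free_on_uminus image_eqI)
  next
    fix x y assume "x \<in> ?N" "y \<in> ?N"
    then show "x \<oplus>\<^bsub>M\<^esub> y \<in> ?N" using v by (auto simp flip: act_simps(1))
  qed (use v in auto)
  have sm: "a \<odot>\<^bsub>M\<^esub> x \<in> ?N" if "a \<in> carrier R" "x \<in> ?N" for a x
  proof -
    from that(2) obtain f where f: "x = act f v" "f \<in> F" by (rule imageE)
    from that(1) obtain g where g: "a = red_class L \<chi> g" "g \<in> F" unfolding red_carrier by (rule imageE)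
    have "a \<odot>\<^bsub>M\<^esub> x = act g (act f v)" by (simp add: f g act_def)
    then have "a \<odot>\<^bsub>M\<^esub> x = act (g * f) v" using f g v by (simp add: act_simps)
    then show ?thesis using f g by (intro image_eqI[of _ _ "g * f"]) auto
  qed
  have "Module.submodule ?N R M"
    by (intro Module.submodule.intro Module.submodule_axioms.intro sg sm)
  moreover have "v \<in> ?N" using v by (intro image_eqI[of _ _ 1]) (simp_all add: act_simps)
  ultimately show ?thesis
    using simple v unfolding simple_left_module_def by blast
qed

end

text \<open>The two carriers have unrelated types, but both annihilators live in the free algebra.
  The map chooses any f that produces a given vector from \<open>v\<close> and applies it to
  \<open>w\<close>; equality of the annihilators makes the choice irrelevant and the map
  injective.\<close>

lemma cyclic_isomorphic:
  assumes "red_module L \<chi> M" "red_module L \<chi> N"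
    and v: "v \<in> carrier M" "carrier M = (\<lambda>f. red_module.act L \<chi> M f v) ` free_on (carrier L)"
    and w: "w \<in> carrier N" "carrier N = (\<lambda>f. red_module.act L \<chi> N f w) ` free_on (carrier L)"
    and ann: "red_module.ann L \<chi> M v = red_module.ann L \<chi> N w"
  shows "left_module_isomorphic (red_env L \<chi>) M N"
proof -
  interpret M: red_module L \<chi> M by fact
  interpret N: red_module L \<chi> N by fact
  define h where "h x = N.act (SOME f. f \<in> M.F \<and> x = M.act f v) w" for x
  have h: "h (M.act f v) = N.act f w" if f: "f \<in> M.F" for f
  proof -
    define g where "g = (SOME g. g \<in> M.F \<and> M.act f v = M.act g v)"
    have "g \<in> M.F \<and> M.act f v = M.act g v"
      unfolding g_def by (rule someI[of _ f]) (use f in simp)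
    then have "g \<in> M.F" "g - f \<in> M.ann v" using M.act_eq_iff[of g f v] f v by auto
    then have "N.act g w = N.act f w" using N.act_eq_iff[of g f w] f w ann by auto
    then show ?thesis by (simp add: h_def g_def)
  qed
  have "h \<in> iso (add_monoid M) (add_monoid N)"
  proof (rule isoI)
    show "h \<in> hom (add_monoid M) (add_monoid N)"
    proof (rule homI)
      fix x y assume "x \<in> carrier (add_monoid M)" "y \<in> carrier (add_monoid M)"
      then obtain f g where fg: "f \<in> M.F" "g \<in> M.F" "x = M.act f v" "y = M.act g v"
        using v(2) by auto
      then have "h (x \<oplus>\<^bsub>M\<^esub> y) = h x \<oplus>\<^bsub>N\<^esub> h y"
        using h[of "f + g"] v(1) w(1) by (simp add: M.act_simps N.act_simps h)
      then show "h (x \<otimes>\<^bsub>add_monoid M\<^esub> y) = h x \<otimes>\<^bsub>add_monoid N\<^esub> h y" by simp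
    qed (use v w h in \<open>auto\<close>)
    show "bij_betw h (carrier (add_monoid M)) (carrier (add_monoid N))"
      unfolding bij_betw_def
    proof
      show "inj_on h (carrier (add_monoid M))"
      proof (rule inj_onI)
        fix x y assume "x \<in> carrier (add_monoid M)" "y \<in> carrier (add_monoid M)" and eq: "h x = h y"
        then obtain f g where fg: "f \<in> M.F" "g \<in> M.F" "x = M.act f v" "y = M.act g v"
          using v(2) by auto
        then have "f - g \<in> N.ann w" using eq N.act_eq_iff[of f g w] w by (simp add: h)
        then show "x = y" using fg M.act_eq_iff[of f g v] v ann by simp
      qed
      have "h ` carrier M = (\<lambda>f. h (M.act f v)) ` M.F"
        by (subst v(2)) (simp add: image_image)
      also have "\<dots> = carrier N"
        by (subst w(2)) (intro image_cong refl h)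
      finally show "h ` carrier (add_monoid M) = carrier (add_monoid N)" by simp
    qed
  qed
  moreover have "h (a \<odot>\<^bsub>M\<^esub> x) = a \<odot>\<^bsub>N\<^esub> h x" if a: "a \<in> carrier (red_env L \<chi>)" and x: "x \<in> carrier M" for a x
  proof -
    obtain f where f: "f \<in> M.F" "x = M.act f v" using x v(2) by auto
    obtain g where g: "g \<in> M.F" "a = red_class L \<chi> g" using a by (auto simp: M.red_carrier)
    have "h (M.act (g * f) v) = N.act (g * f) w" by (rule h) (use f g in auto)
    then show ?thesis
      using f g v(1) w(1) by (simp add: M.act_simps N.act_simps h) (simp add: M.act_def[of g] N.act_def[of g])
  qed
  ultimately show ?thesis unfolding left_module_isomorphic_def by blast
qed

section \<open>The induced module\<close>

locale lie_induced = lie_subalgebra L \<chi> H + chr: lie_character "L\<lparr>carrier := H\<rparr>" \<chi>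
  for L :: "('k::field, 'a) rlie" and \<chi> :: "'a \<Rightarrow> 'k" and H :: "'a set"
begin

lemma free_sub_carrier: "c \<in> carrier (red_env L' \<chi>) \<Longrightarrow> \<exists>g\<in>free_on H. c = red_class L' \<chi> g"
  by (auto simp: sub.red_carrier)

sublocale T: scalar_extension "red_env L \<chi>" "red_env_map L \<chi>" "red_env L' \<chi>" "one_dim_module \<chi>"
proof
  fix c assume "c \<in> carrier (red_env L' \<chi>)"
  then obtain g where "g \<in> free_on H" "c = red_class L' \<chi> g" using free_sub_carrier by blast
  then show "red_env_map L \<chi> c \<in> carrier (red_env L \<chi>)"
    using sub_F by (auto simp: red_env_map_class red_carrier)
qed (simp_all)

abbreviation "I \<equiv> induced_module L H \<chi>"

lemma induced_T: "I = T.T"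
  by (simp add: induced_module_def)

sublocale I: red_module L \<chi> I
  unfolding induced_T red_module_def
  by (intro conjI T.left_module_T lie_carrier_axioms)

lemmas carrier_I = T.carrier_T[folded induced_T]
  and add_I = T.add_T[folded induced_T]
  and zero_I = T.zero_T[folded induced_T]
  and smult_I = T.smult_T[folded induced_T]

definition vac where "vac = T.tcl (frag_of (\<one>\<^bsub>red_env L \<chi>\<^esub>, 1))"

lemma one_G: "frag_of (\<one>\<^bsub>red_env L \<chi>\<^esub>, n) \<in> carrier T.G"
  by simp

lemma act_tcl:
  assumes "f \<in> F" "z \<in> carrier T.G"
  shows "I.act f (T.tcl z) = T.tcl (T.tact (red_class L \<chi> f) z)"
  using smult_I[OF I.red_class_closed[OF assms(1)] assms(2)] by (simp add: I.act_def)

lemma act_vac: "f \<in> F \<Longrightarrow> I.act f vac = T.tcl (frag_of (red_class L \<chi> f, 1))"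
  unfolding vac_def using act_tcl[OF _ one_G] I.red_class_closed[of f] by (simp add: T.tact_of)

lemma vac_closed: "vac \<in> carrier I"
  unfolding vac_def carrier_I using one_G by (rule imageI)

lemma tcl_balance:
  assumes f: "f \<in> F" and g: "g \<in> free_on H"
  shows "T.tcl (frag_of (red_class L \<chi> (f * g), n)) = T.tcl (frag_of (red_class L \<chi> f, free_eval \<chi> g * n))"
proof -
  have g': "g \<in> F" using g sub_F by blast
  have d: "red_class L' \<chi> g \<in> carrier (red_env L' \<chi>)" using g by (simp add: sub.red_carrier)
  have "frag_of (red_class L \<chi> (f * g), n) - frag_of (red_class L \<chi> f, free_eval \<chi> g * n) \<in> T.B"
    using T.relsI(3)[OF I.red_class_closed[OF f] d, of n] T.rels_B f g g'
    by (auto simp: red_env_map_class red_class_simps chr.red_env_eval_class)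
  then show ?thesis
    using I.red_class_closed[OF f] I.red_class_closed[of "f * g"] f g' by (simp add: T.tcl_eq_iff)
qed

lemma vac_eigen:
  assumes h: "h \<in> H"
  shows "gen h - scal (\<chi> h) \<in> I.ann vac"
proof -
  have h': "gen h \<in> free_on H" "gen h \<in> F" using h H_subset by auto
  have "I.act (gen h) vac = T.tcl (frag_of (red_class L \<chi> 1, \<chi> h * 1))"
    using tcl_balance[of 1 "gen h" 1] h' by (simp add: act_vac free_eval_simps)
  also have "\<dots> = I.act (scal (\<chi> h)) vac"
    using tcl_balance[of 1 "scal (\<chi> h)" 1] by (simp add: act_vac free_eval_simps)
  finally show ?thesis
    using I.act_eq_iff[OF h'(2) _ vac_closed] by simp
qed

lemma induced_cyclic: "carrier I = (\<lambda>f. I.act f vac) ` F"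
proof
  show "(\<lambda>f. I.act f vac) ` F \<subseteq> carrier I"
    using vac_closed by auto
  have "\<exists>f\<in>F. T.tcl z = I.act f vac" if "z \<in> carrier T.G" for z
    using that
  proof (induction z rule: T.G_induct)
    case zero
    then show ?case
      using I.act_zero[OF vac_closed] by (intro bexI[of _ 0]) (simp_all add: zero_I)
  next
    case (diff x y)
    then obtain f g where fg: "f \<in> F" "g \<in> F" "T.tcl x = I.act f vac" "T.tcl y = I.act g vac" by blast
    have xy: "x - y \<in> carrier T.G" by (rule T.G_diff[OF diff(1,2)])
    have "I.act f vac = T.tcl (x - y) \<oplus>\<^bsub>I\<^esub> I.act g vac"
      using add_I[OF xy diff(2)] by (simp flip: fg(3,4))
    moreover have "T.tcl (x - y) \<in> carrier I"
      using xy unfolding carrier_I by (rule imageI)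
    ultimately have "T.tcl (x - y) = I.act (f - g) vac"
      using I.act_simps(1)[of "f - g" g vac] fg(1,2) vac_closed
        I.M.add.right_cancel[of "I.act g vac" "T.tcl (x - y)" "I.act (f - g) vac"]
      by simp
    then show ?case using fg by (intro bexI[of _ "f - g"]) auto
  next
    case (of a n)
    then obtain f where f: "f \<in> F" "a = red_class L \<chi> f" by (auto simp: red_carrier)
    \<comment> \<open>The tensor of a and n equals that of a n and 1, so \<open>f * scal n\<close>
      is the preimage.\<close>
    then show ?case
      using tcl_balance[of f "scal n" 1] f
      by (intro bexI[of _ "f * scal n"]) (simp_all add: act_vac free_eval_simps)
  qed
  then show "carrier I \<subseteq> (\<lambda>f. I.act f vac) ` F"
    unfolding carrier_I by (auto simp del: carrier_free_Abelian_group_iff)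
qed

text \<open>By the universal property: sending the tensor of a and n to n a modulo \<open>K\<close>
  is balanced because \<open>K\<close> contains \<open>gen h - scal (\<chi> h)\<close> for all h in
  \<open>H\<close>. The image of \<open>vac\<close> is then the class of 1, which is
  nonzero.\<close>

lemma vac_nonzero:
  assumes K: "eigen_ideal L H \<chi> K"
  shows "vac \<noteq> \<zero>\<^bsub>I\<^esub>"
proof
  assume vac0: "vac = \<zero>\<^bsub>I\<^esub>"
  have left: "alg_left_ideal (carrier L) K" and JK: "J \<subseteq> K" and "1 \<notin> K"
    using K by (auto simp: eigen_ideal_def)
  have add: "f + g \<in> K" if "f \<in> K" "g \<in> K" for f g
    using left that by (auto simp: alg_left_ideal_def)
  have mult: "f * g \<in> K" if "f \<in> F" "g \<in> K" for f g
    using left that by (auto simp: alg_left_ideal_def)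
  have zero: "0 \<in> K" using left by (auto simp: alg_left_ideal_def)
  define rep where "rep a = (SOME f. f \<in> F \<and> red_class L \<chi> f = a)" for a
  have rep: "rep a \<in> F" "red_class L \<chi> (rep a) = a" if "a \<in> carrier (red_env L \<chi>)" for a
  proof -
    have "\<exists>f. f \<in> F \<and> red_class L \<chi> f = a" using that by (auto simp: red_carrier)
    then have "rep a \<in> F \<and> red_class L \<chi> (rep a) = a" unfolding rep_def by (rule someI_ex)
    then show "rep a \<in> F" "red_class L \<chi> (rep a) = a" by auto
  qed
  have repJ: "rep a - f \<in> J" if "f \<in> F" "a = red_class L \<chi> f" for a f
    using that red_class_eq_iff[of "rep a" f] rep[of a] I.red_class_closed by auto
  let ?A = "\<lparr>carrier = UNIV, monoid.mult = (+), one = 0\<rparr> :: ('k, 'a) free_alg monoid"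
  interpret A: comm_group ?A
  proof (rule comm_groupI)
    fix x :: "('k, 'a) free_alg"
    show "\<exists>y\<in>carrier ?A. y \<otimes>\<^bsub>?A\<^esub> x = \<one>\<^bsub>?A\<^esub>" by (intro bexI[of _ "- x"]) auto
  qed (simp_all add: add_ac)
  \<comment> \<open>With chosen representatives this is biadditive only modulo \<open>J\<close>.
    Hence the relations are shown to land in \<open>K\<close>, not to vanish.\<close>
  define q where "q = (\<lambda>(a, n). rep a * scal n)"
  have "q ` (carrier (red_env L \<chi>) \<times> UNIV) \<subseteq> carrier ?A" by simp
  then obtain h where h: "h \<in> hom (free_Abelian_group (carrier (red_env L \<chi>) \<times> UNIV)) ?A"
    "\<And>x. x \<in> carrier (red_env L \<chi>) \<times> UNIV \<Longrightarrow> h (frag_of x) = q x"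
    using A.free_Abelian_group_universal by blast
  have hq: "h (frag_of (a, n)) = rep a * scal n" if "a \<in> carrier (red_env L \<chi>)" for a n
    using h(2) that by (simp add: q_def)
  have h_add: "h (x + y) = h x + h y" if "x \<in> carrier T.G" "y \<in> carrier T.G" for x y
    using hom_mult[OF h(1)] that by simp
  have h_diff: "h (x - y) = h x - h y" if "x \<in> carrier T.G" "y \<in> carrier T.G" for x y
    using h_add[OF T.G_diff[OF that] that(2)] by (simp add: algebra_simps)
  have fG: "frag_of (a, n) \<in> carrier T.G" if "a \<in> carrier (red_env L \<chi>)" for a n
    using that by simp
  have rels: "h z \<in> K" if "z \<in> T.rels" for z
    using that
  proof (cases rule: T.relsE)
    case (add_left a b n)
    have "rep (a \<oplus>\<^bsub>red_env L \<chi>\<^esub> b) - (rep a + rep b) \<in> J"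
      using repJ[of "rep a + rep b"] rep add_left(1,2) by (simp add: red_class_simps)
    then have "scal n * (rep (a \<oplus>\<^bsub>red_env L \<chi>\<^esub> b) - (rep a + rep b)) \<in> K"
      using JK by (intro mult) auto
    moreover have "h z = rep (a \<oplus>\<^bsub>red_env L \<chi>\<^esub> b) * scal n - rep a * scal n - rep b * scal n"
      by (simp only: add_left h_diff fG T.G_diff hq R.add.m_closed)
    ultimately show ?thesis by (simp add: scal_commute[of n] left_diff_distrib distrib_right diff_diff_eq)
  next
    case (add_right a m n)
    have "h z = rep a * scal (m + n) - rep a * scal m - rep a * scal n"
      unfolding add_right(4) using add_right(1-3)
      by (simp only: h_diff fG T.G_diff hq) (simp only: chr.one_dim_module_simps hq)
    then show ?thesis using zero by (simp add: distrib_left)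
  next
    case (balance a d n)
    obtain g where g: "g \<in> free_on H" "d = red_class L' \<chi> g" using free_sub_carrier balance(2) by blast
    have gF: "g \<in> F" using g sub_F by blast
    define b where "b = a \<otimes>\<^bsub>red_env L \<chi>\<^esub> red_class L \<chi> g"
    have b: "b \<in> carrier (red_env L \<chi>)"
      using balance(1) I.red_class_closed[OF gF] by (simp add: b_def)
    have J1: "rep b - rep a * g \<in> J"
      using repJ[of "rep a * g"] rep balance(1) gF by (simp add: red_class_simps b_def)
    have K1: "rep a * (g - scal (free_eval \<chi> g)) \<in> K"
      using eigen_ideal_eval[OF K H_subset g(1)] rep(1)[OF balance(1)] by (intro mult)
    have "scal n * ((rep b - rep a * g) + rep a * (g - scal (free_eval \<chi> g))) \<in> K"
      using add[OF subsetD[OF JK J1] K1] by (intro mult) auto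
    moreover have "h z = rep b * scal n - rep a * scal (free_eval \<chi> g * n)"
      using balance(1) b
      by (simp add: balance g red_env_map_class chr.red_env_eval_class b_def[symmetric] h_diff fG hq
          del: carrier_free_Abelian_group_iff scal_simps)
    moreover have "rep b * scal n - rep a * scal (free_eval \<chi> g * n) =
        scal n * ((rep b - rep a * g) + rep a * (g - scal (free_eval \<chi> g)))"
      by (simp add: scal_commute[of n] right_diff_distrib left_diff_distrib mult.assoc)
    ultimately show ?thesis by simp
  qed
  have "h z \<in> K" if "z \<in> T.B" for z
    using that unfolding T.B_def
  proof (induction z rule: generate.induct)
    case one
    then show ?case using h_add[of 0 0] zero by simp
  next
    case (incl x)
    then show ?case by (rule rels)
  next
    case (inv x)
    have "x \<in> carrier T.G" using inv T.rels_carrier by blast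
    moreover from this have "h (- x) = - h x"
      using h_diff[of 0 x] h_add[of 0 0] by simp
    ultimately show ?case
      using alg_left_ideal_uminus[OF left rels[OF inv]] by simp
  next
    case (eng x y)
    have "x \<in> carrier T.G" "y \<in> carrier T.G"
      using subsetD[OF T.B.subset, unfolded T.B_def, OF eng(1)]
        subsetD[OF T.B.subset, unfolded T.B_def, OF eng(2)] .
    then show ?case using eng add by (simp add: h_add del: carrier_free_Abelian_group_iff)
  qed
  moreover have "frag_of (\<one>\<^bsub>red_env L \<chi>\<^esub>, 1) \<in> T.B"
    using vac0 T.tcl_eq_iff[OF one_G, of 0 1] by (simp add: vac_def zero_I)
  ultimately have "rep \<one>\<^bsub>red_env L \<chi>\<^esub> * scal 1 \<in> K"
    using hq[OF R.one_closed, of 1] by metis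
  moreover have "rep \<one>\<^bsub>red_env L \<chi>\<^esub> - 1 \<in> K"
    using repJ[of 1] JK by (auto simp: red_class_one)
  ultimately have "1 \<in> K"
    using alg_left_ideal_diff[OF left, of "rep \<one>\<^bsub>red_env L \<chi>\<^esub>" "rep \<one>\<^bsub>red_env L \<chi>\<^esub> - 1"] by simp
  then show False using \<open>1 \<notin> K\<close> by blast
qed

lemma vac_eigen_ideal:
  assumes "eigen_ideal L H \<chi> K"
  shows "eigen_ideal L H \<chi> (I.ann vac)"
  unfolding eigen_ideal_def
  using I.ann_left_ideal[OF vac_closed] I.J_ann[OF vac_closed] I.one_ann[OF vac_closed]
    vac_nonzero[OF assms] vac_eigen by auto

end

section \<open>Polynomial functions and their derivations\<close>

text \<open>Over a finite field the product of all X - a, plus 1, would be nonconstant without a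
  root.\<close>

lemma infinite_alg_closed_field: "infinite (UNIV :: 'k::alg_closed_field set)"
proof
  assume fin: "finite (UNIV :: 'k set)"
  define P :: "'k poly" where "P = (\<Prod>a\<in>UNIV. [:- a, 1:])"
  have "degree P = card (UNIV :: 'k set)"
    unfolding P_def by (subst degree_prod_sum_eq) auto
  then have "degree P > 0" using fin by (simp add: card_gt_0_iff)
  then have "degree (P + 1) > 0" by (simp add: degree_add_eq_left)
  then obtain x where "poly (P + 1) x = 0" using alg_closed_imp_poly_has_root by blast
  moreover have "poly P x = 0"
    unfolding P_def poly_prod using fin by (intro prod_zero) auto
  ultimately show False by simp
qed

text \<open>Functions, not formal polynomials, so that identities can be checked at points and
  evaluation at \<open>E 0 0\<close> is application. Infinitude of the field keeps derivatives well
  defined.\<close>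

inductive_set poly_functions :: "(('i \<Rightarrow> 'k::field) \<Rightarrow> 'k) set" where
  const: "(\<lambda>v. c) \<in> poly_functions"
| coord: "(\<lambda>v. v q) \<in> poly_functions"
| add: "\<lbrakk>f \<in> poly_functions; g \<in> poly_functions\<rbrakk> \<Longrightarrow> (\<lambda>v. f v + g v) \<in> poly_functions"
| mult: "\<lbrakk>f \<in> poly_functions; g \<in> poly_functions\<rbrakk> \<Longrightarrow> (\<lambda>v. f v * g v) \<in> poly_functions"

typedef (overloaded) ('i, 'k::field) polyfun = "poly_functions :: (('i \<Rightarrow> 'k) \<Rightarrow> 'k) set"
  morphisms pf_app Abs_polyfun
  using poly_functions.const by blast

setup_lifting type_definition_polyfun

instantiation polyfun :: (type, field) comm_ring_1
begin
lift_definition zero_polyfun :: "('a, 'b) polyfun" is "\<lambda>v. 0" by (rule poly_functions.const)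
lift_definition one_polyfun :: "('a, 'b) polyfun" is "\<lambda>v. 1" by (rule poly_functions.const)
lift_definition plus_polyfun :: "('a, 'b) polyfun \<Rightarrow> ('a, 'b) polyfun \<Rightarrow> ('a, 'b) polyfun"
  is "\<lambda>f g v. f v + g v" by (rule poly_functions.add)
lift_definition times_polyfun :: "('a, 'b) polyfun \<Rightarrow> ('a, 'b) polyfun \<Rightarrow> ('a, 'b) polyfun"
  is "\<lambda>f g v. f v * g v" by (rule poly_functions.mult)
lift_definition uminus_polyfun :: "('a, 'b) polyfun \<Rightarrow> ('a, 'b) polyfun" is "\<lambda>f v. - f v"
  using poly_functions.mult[OF poly_functions.const[of "- 1"]] by fastforce
lift_definition minus_polyfun :: "('a, 'b) polyfun \<Rightarrow> ('a, 'b) polyfun \<Rightarrow> ('a, 'b) polyfun"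
  is "\<lambda>f g v. f v - g v"
  using poly_functions.add[OF _ poly_functions.mult[OF poly_functions.const[of "- 1"]]] by fastforce
instance
proof
  show "(0 :: ('a, 'b) polyfun) \<noteq> 1" by transfer (simp add: fun_eq_iff)
qed (transfer; simp add: algebra_simps)+
end

lift_definition pf_const :: "'k::field \<Rightarrow> ('i, 'k) polyfun" is "\<lambda>c v. c"
  by (rule poly_functions.const)

lift_definition pf_coord :: "'i \<Rightarrow> ('i, 'k::field) polyfun" is "\<lambda>q v. v q"
  by (rule poly_functions.coord)

lemmas pf_app_simps [simp] = zero_polyfun.rep_eq one_polyfun.rep_eq plus_polyfun.rep_eq
  times_polyfun.rep_eq uminus_polyfun.rep_eq minus_polyfun.rep_eq pf_const.rep_eq pf_coord.rep_eq

lemma pf_eqI: "(\<And>v. pf_app f v = pf_app g v) \<Longrightarrow> f = g"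
  by (metis ext pf_app_inject)

lemma pf_app_power [simp]: "pf_app (f ^ n) v = pf_app f v ^ n"
  by (induction n) simp_all

lemma pf_app_sum [simp]: "pf_app (\<Sum>i\<in>I. f i) v = (\<Sum>i\<in>I. pf_app (f i) v)"
  by (induction I rule: infinite_finite_induct) simp_all

lemma pf_app_of_nat [simp]: "pf_app (of_nat n) v = of_nat n"
  by (induction n) simp_all

lemma pf_const_simps [simp]:
  "pf_const 0 = 0" "pf_const 1 = 1" "pf_const (a + b) = pf_const a + pf_const b"
  "pf_const (a * b) = pf_const a * pf_const b" "pf_const (- a) = - pf_const a"
  "pf_const (of_nat n) = of_nat n" "pf_const (a ^ n) = pf_const a ^ n"
  by (rule pf_eqI; simp)+

lemma polyfun_induct [case_names const coord add mult]:
  assumes "\<And>c. P (pf_const c)" "\<And>q. P (pf_coord q)"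
    "\<And>f g. P f \<Longrightarrow> P g \<Longrightarrow> P (f + g)" "\<And>f g. P f \<Longrightarrow> P g \<Longrightarrow> P (f * g)"
  shows "P f"
proof (cases f)
  case (Abs_polyfun h)
  have "\<exists>g. pf_app g = h \<and> P g"
    using Abs_polyfun(2)
  proof (induction h rule: poly_functions.induct)
    case (const c)
    then show ?case using assms(1) by (intro exI[of _ "pf_const c"]) (simp add: pf_const.rep_eq)
  next
    case (coord q)
    then show ?case using assms(2) by (intro exI[of _ "pf_coord q"]) (simp add: pf_coord.rep_eq)
  next
    case (add f g)
    then obtain f' g' where "pf_app f' = f" "P f'" "pf_app g' = g" "P g'" by blast
    then show ?case using assms(3) by (intro exI[of _ "f' + g'"]) (simp add: fun_eq_iff)
  next
    case (mult f g)
    then obtain f' g' where "pf_app f' = f" "P f'" "pf_app g' = g" "P g'" by blast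
    then show ?case using assms(4) by (intro exI[of _ "f' * g'"]) (simp add: fun_eq_iff)
  qed
  then show ?thesis using Abs_polyfun(1) by (metis pf_app_inverse)
qed

text \<open>The directional derivative at \<open>v\<close> along \<open>w\<close>, read off the polynomial \<open>t \<mapsto> f (v + t w)\<close>,
  which is unique because the field is infinite.\<close>

definition line_poly :: "(('i \<Rightarrow> 'k::field) \<Rightarrow> 'k) \<Rightarrow> ('i \<Rightarrow> 'k) \<Rightarrow> ('i \<Rightarrow> 'k) \<Rightarrow> 'k poly" where
  "line_poly f v w = (THE P. \<forall>t. f (\<lambda>q. v q + t * w q) = poly P t)"

lemma line_poly_eqI:
  fixes f :: "('i \<Rightarrow> 'k::alg_closed_field) \<Rightarrow> 'k"
  assumes "\<And>t. f (\<lambda>q. v q + t * w q) = poly P t"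
  shows "line_poly f v w = P"
  unfolding line_poly_def
proof (rule the_equality)
  fix Q assume "\<forall>t. f (\<lambda>q. v q + t * w q) = poly Q t"
  then have "{t. poly (Q - P) t = 0} = UNIV" using assms by simp
  then have "Q - P = 0" using poly_roots_finite[of "Q - P"] infinite_alg_closed_field by metis
  then show "Q = P" by simp
qed (use assms in blast)

lemma line_poly:
  fixes f :: "('i, 'k::alg_closed_field) polyfun"
  shows "pf_app f (\<lambda>q. v q + t * w q) = poly (line_poly (pf_app f) v w) t"
proof -
  have "\<exists>P. \<forall>t. pf_app f (\<lambda>q. v q + t * w q) = poly P t"
  proof (induction f rule: polyfun_induct)
    case (const c)
    then show ?case by (intro exI[of _ "[:c:]"]) simp
  next
    case (coord q)
    then show ?case by (intro exI[of _ "[:v q, w q:]"]) simp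
  next
    case (add f g)
    then obtain P Q where "\<forall>t. pf_app f (\<lambda>q. v q + t * w q) = poly P t"
      "\<forall>t. pf_app g (\<lambda>q. v q + t * w q) = poly Q t" by blast
    then show ?case by (intro exI[of _ "P + Q"]) simp
  next
    case (mult f g)
    then obtain P Q where "\<forall>t. pf_app f (\<lambda>q. v q + t * w q) = poly P t"
      "\<forall>t. pf_app g (\<lambda>q. v q + t * w q) = poly Q t" by blast
    then show ?case by (intro exI[of _ "P * Q"]) simp
  qed
  then show ?thesis using line_poly_eqI[of "pf_app f" v w] by metis
qed

definition dirderiv :: "(('i \<Rightarrow> 'k::field) \<Rightarrow> 'k) \<Rightarrow> ('i \<Rightarrow> 'k) \<Rightarrow> ('i \<Rightarrow> 'k) \<Rightarrow> 'k" where
  "dirderiv f v w = coeff (line_poly f v w) 1"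

lemma dirderiv_simps:
  fixes f g :: "('i, 'k::alg_closed_field) polyfun"
  shows "dirderiv (pf_app (pf_const c)) v w = (0 :: 'k)"
    "dirderiv (pf_app (pf_coord q)) v w = w q"
    "dirderiv (pf_app (f + g)) v w = dirderiv (pf_app f) v w + dirderiv (pf_app g) v w"
    "dirderiv (pf_app (f * g)) v w = pf_app f v * dirderiv (pf_app g) v w + dirderiv (pf_app f) v w * pf_app g v"
proof -
  show "dirderiv (pf_app (pf_const c)) v w = (0 :: 'k)"
    unfolding dirderiv_def by (subst line_poly_eqI[where P = "[:c:]"]) simp_all
  show "dirderiv (pf_app (pf_coord q)) v w = w q"
    unfolding dirderiv_def by (subst line_poly_eqI[where P = "[:v q, w q:]"]) simp_all
  show "dirderiv (pf_app (f + g)) v w = dirderiv (pf_app f) v w + dirderiv (pf_app g) v w"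
    unfolding dirderiv_def
    by (subst line_poly_eqI[where P = "line_poly (pf_app f) v w + line_poly (pf_app g) v w"])
      (simp_all add: line_poly)
  have "coeff (line_poly (pf_app f) v w) 0 = pf_app f v" for f :: "('i, 'k) polyfun"
    using line_poly[of f v 0 w] by (simp add: poly_0_coeff_0)
  then show "dirderiv (pf_app (f * g)) v w = pf_app f v * dirderiv (pf_app g) v w + dirderiv (pf_app f) v w * pf_app g v"
    unfolding dirderiv_def
    by (subst line_poly_eqI[where P = "line_poly (pf_app f) v w * line_poly (pf_app g) v w"])
      (simp_all add: line_poly coeff_mult atMost_Suc)
qed

lift_definition vector_field :: "('i \<Rightarrow> ('i, 'k::alg_closed_field) polyfun) \<Rightarrow> ('i, 'k) polyfun \<Rightarrow> ('i, 'k) polyfun"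
  is "\<lambda>a f v. dirderiv f v (\<lambda>q. a q v)"
proof -
  fix a :: "'i \<Rightarrow> ('i \<Rightarrow> 'k) \<Rightarrow> 'k" and f :: "('i \<Rightarrow> 'k) \<Rightarrow> 'k"
  assume a: "\<And>q. a q \<in> poly_functions" and f: "f \<in> poly_functions"
  have "(\<lambda>v. dirderiv (pf_app g) v (\<lambda>q. a q v)) \<in> poly_functions" for g
  proof (induction g rule: polyfun_induct)
    case (mult f g)
    then show ?case
      using poly_functions.add[OF poly_functions.mult[OF pf_app mult(2)] poly_functions.mult[OF mult(1) pf_app], of f g]
      by (simp add: dirderiv_simps del: pf_app_simps)
  qed (simp_all add: dirderiv_simps poly_functions.const poly_functions.add a del: pf_app_simps)
  from this[of "Abs_polyfun f"] show "(\<lambda>v. dirderiv f v (\<lambda>q. a q v)) \<in> poly_functions"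
    by (simp add: Abs_polyfun_inverse f)
qed

lemma vector_field_simps:
  "vector_field a (pf_const c) = 0" "vector_field a (pf_coord q) = a q"
  "vector_field a (f + g) = vector_field a f + vector_field a g"
  "vector_field a (f * g) = f * vector_field a g + vector_field a f * g"
  by (rule pf_eqI; simp add: vector_field.rep_eq dirderiv_simps del: pf_app_simps;
    simp add: vector_field.rep_eq)+

section \<open>Derivations and multiplications as elements of one ring\<close>

typedef (overloaded) 'p add_endo = "{f :: 'p::comm_ring_1 \<Rightarrow> 'p. \<forall>x y. f (x + y) = f x + f y}"
  morphisms ae_app Abs_add_endo
  by (rule exI[of _ id]) simp

setup_lifting type_definition_add_endo

instantiation add_endo :: (comm_ring_1) ring_1
begin
lift_definition zero_add_endo :: "'a add_endo" is "\<lambda>x. 0" by simp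
lift_definition one_add_endo :: "'a add_endo" is "\<lambda>x. x" by simp
lift_definition plus_add_endo :: "'a add_endo \<Rightarrow> 'a add_endo \<Rightarrow> 'a add_endo"
  is "\<lambda>f g x. f x + g x" by (simp add: algebra_simps)
lift_definition minus_add_endo :: "'a add_endo \<Rightarrow> 'a add_endo \<Rightarrow> 'a add_endo"
  is "\<lambda>f g x. f x - g x" by (simp add: algebra_simps)
lift_definition uminus_add_endo :: "'a add_endo \<Rightarrow> 'a add_endo"
  is "\<lambda>f x. - f x" by (simp add: algebra_simps)
lift_definition times_add_endo :: "'a add_endo \<Rightarrow> 'a add_endo \<Rightarrow> 'a add_endo"
  is "\<lambda>f g x. f (g x)" by simp
instance
proof
  show "(0 :: 'a add_endo) \<noteq> 1"
    by transfer (auto simp: fun_eq_iff intro!: exI[of _ 1])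
qed (transfer; simp add: algebra_simps)+
end

lemmas ae_app_simps [simp] =
  zero_add_endo.rep_eq one_add_endo.rep_eq plus_add_endo.rep_eq
  minus_add_endo.rep_eq uminus_add_endo.rep_eq times_add_endo.rep_eq

lemma ae_app_add [simp]: "ae_app a (x + y) = ae_app a x + ae_app a y"
  using ae_app[of a] by simp

lemma ae_eqI: "(\<And>x. ae_app a x = ae_app b x) \<Longrightarrow> a = b"
  by (metis ext ae_app_inject)

lemma ae_app_zero [simp]: "ae_app a 0 = 0"
  using ae_app_add[of a 0 0] by simp

lemma ae_app_uminus [simp]: "ae_app a (- x) = - ae_app a x"
  using ae_app_add[of a x "- x"] by (simp add: eq_neg_iff_add_eq_0 add.commute)

lemma ae_app_sum [simp]: "ae_app a (\<Sum>i\<in>I. x i) = (\<Sum>i\<in>I. ae_app a (x i))"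
  by (induction I rule: infinite_finite_induct) simp_all

lemma ae_app_power: "ae_app (a ^ n) x = (ae_app a ^^ n) x"
  by (induction n) simp_all

text \<open>Functions enter the same noncommutative ring as derivations, so that Jacobson's formula
  applies to \<open>d + mult_op f\<close>.\<close>

lift_definition mult_op :: "'p::comm_ring_1 \<Rightarrow> 'p add_endo" is "\<lambda>h x. h * x"
  by (simp add: algebra_simps)

lemma mult_op_simps [simp]:
  "mult_op 0 = 0" "mult_op 1 = 1" "mult_op (a + b) = mult_op a + mult_op b"
  "mult_op (a - b) = mult_op a - mult_op b" "mult_op (- a) = - mult_op a"
  "mult_op (a * b) = mult_op a * mult_op b"
  by (rule ae_eqI; simp add: mult_op.rep_eq algebra_simps)+

lemma mult_op_power [simp]: "mult_op (a ^ n) = mult_op a ^ n"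
  by (induction n) simp_all

lemma mult_op_of_nat: "mult_op (of_nat n) = of_nat n"
  by (induction n) simp_all

lemma mult_op_commute: "mult_op a * mult_op b = mult_op b * mult_op a"
  by (rule ae_eqI) (simp add: mult_op.rep_eq algebra_simps)

text \<open>The Leibniz rule in commutator form, which is what iterated commutators consume.\<close>

definition derivation :: "'p::comm_ring_1 add_endo \<Rightarrow> bool" where
  "derivation d \<longleftrightarrow> (\<forall>h. d * mult_op h - mult_op h * d = mult_op (ae_app d h))"

lemma derivation_leibniz: "derivation d \<longleftrightarrow> (\<forall>f g. ae_app d (f * g) = f * ae_app d g + ae_app d f * g)"
proof
  assume d: "derivation d"
  show "\<forall>f g. ae_app d (f * g) = f * ae_app d g + ae_app d f * g"
  proof (intro allI)
    fix f g
    have "ae_app (d * mult_op f - mult_op f * d) g = ae_app (mult_op (ae_app d f)) g"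
      using d by (simp only: derivation_def)
    then show "ae_app d (f * g) = f * ae_app d g + ae_app d f * g"
      by (simp add: mult_op.rep_eq algebra_simps)
  qed
next
  assume "\<forall>f g. ae_app d (f * g) = f * ae_app d g + ae_app d f * g"
  then show "derivation d"
    unfolding derivation_def by (intro allI ae_eqI) (simp add: mult_op.rep_eq algebra_simps)
qed

lemma derivation_intros:
  "derivation d \<Longrightarrow> derivation e \<Longrightarrow> derivation (d + e)"
  "derivation d \<Longrightarrow> derivation (mult_op c * d)"
  "derivation d \<Longrightarrow> derivation e \<Longrightarrow> derivation (d * e - e * d)"
  unfolding derivation_leibniz by (auto simp: mult_op.rep_eq algebra_simps)

lemma derivation_ad_power:
  assumes "derivation d"
  shows "((\<lambda>w. d * w - w * d) ^^ n) (mult_op h) = mult_op ((ae_app d ^^ n) h)"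
  using assms by (induction n) (simp_all add: derivation_def)

text \<open>In characteristic p the p-th iterate of the commutator with d is the commutator with
  d^p. Applied to a multiplication operator it gives the Leibniz rule for d^p.\<close>

lemma derivation_power_prime:
  assumes "derivation d" "prime p" "of_nat p = (0 :: 'p::comm_ring_1 add_endo)"
  shows "derivation (d ^ p :: 'p add_endo)"
  unfolding derivation_def
  by (simp only: ad_pow_prime[OF assms(2,3), symmetric] derivation_ad_power[OF assms(1)] ae_app_power simp_thms)

lemma derivation_one: "derivation d \<Longrightarrow> ae_app d 1 = 0"
  unfolding derivation_leibniz by (drule spec[of _ 1], drule spec[of _ 1]) simp

lemma derivation_eqI:
  fixes d e :: "('i, 'k::field) polyfun add_endo"
  assumes "derivation d" "derivation e"
    "\<And>c. ae_app d (pf_const c) = 0" "\<And>c. ae_app e (pf_const c) = 0"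
    "\<And>q. ae_app d (pf_coord q) = ae_app e (pf_coord q)"
  shows "d = e"
proof (rule ae_eqI)
  fix f
  show "ae_app d f = ae_app e f"
    using assms(1,2) by (induction f rule: polyfun_induct) (simp_all add: assms(3-) derivation_leibniz)
qed

text \<open>The commutators of \<open>d\<close> with the commuting operators \<open>mult_op (d\<^sup>n f)\<close> leave only
  one of Jacobson's correction terms.\<close>

lemma derivation_plus_mult_power:
  fixes d :: "'p::comm_ring_1 add_endo"
  assumes d: "derivation d" and p: "prime p" "of_nat p = (0 :: 'p add_endo)"
    and inv: "\<And>i. 0 < i \<Longrightarrow> i < p \<Longrightarrow> \<exists>j. j * of_nat i = (1 :: 'p add_endo)"
  shows "(d + mult_op f) ^ p = d ^ p + mult_op ((ae_app d ^^ (p - 1)) f) + mult_op f ^ p"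
proof -
  have coeff: "ring_ad_coeff (mult_op f) d n k = (if k = 0 then mult_op ((ae_app d ^^ n) f) else 0)" for n k
  proof (induction n arbitrary: k)
    case (Suc n)
    have "d * mult_op h - mult_op h * d = mult_op (ae_app d h)" for h
      using d by (simp add: derivation_def)
    then show ?case by (cases k) (simp_all add: Suc mult_op_commute)
  qed simp
  obtain s where s: "(mult_op f + d) ^ p = mult_op f ^ p + d ^ p + (\<Sum>i\<in>{1..<p}. s i)"
    "\<And>i. i \<in> {1..<p} \<Longrightarrow> of_nat i * s i = ring_ad_coeff (mult_op f) d (p - 1) (i - 1)"
    using jacobson[OF p] by metis
  have si: "s i = (if i = 1 then mult_op ((ae_app d ^^ (p - 1)) f) else 0)" if i: "i \<in> {1..<p}" for i
  proof -
    obtain j :: "'p add_endo" where j: "j * of_nat i = 1" using inv[of i] i by auto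
    have "s i = j * (of_nat i * s i)" using j by (simp add: mult.assoc[symmetric])
    then show ?thesis using s(2)[OF i] i j by (auto simp: coeff)
  qed
  have "1 \<in> {1..<p}" using prime_gt_1_nat[OF p(1)] by simp
  moreover have "(\<Sum>i\<in>{1..<p}. s i) =
      (\<Sum>i\<in>{1..<p}. if i = 1 then mult_op ((ae_app d ^^ (p - 1)) f) else 0)"
    by (intro sum.cong refl si)
  ultimately have "(\<Sum>i\<in>{1..<p}. s i) = mult_op ((ae_app d ^^ (p - 1)) f)"
    by (simp only: sum.delta[OF finite_atLeastLessThan]) simp
  then show ?thesis using s(1) by (simp add: add_ac)
qed

section \<open>A module with the given character\<close>

lift_definition field_endo ::
  "('i \<Rightarrow> ('i, 'k::alg_closed_field) polyfun) \<Rightarrow> ('i, 'k) polyfun add_endo" is vector_field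
  by (simp add: vector_field_simps)

lemma derivation_field_endo: "derivation (field_endo a)"
  by (simp add: derivation_leibniz field_endo.rep_eq vector_field_simps)

lemma field_endo_const: "ae_app (field_endo a) (pf_const c) = 0"
  and field_endo_coord: "ae_app (field_endo a) (pf_coord q) = a q"
  and field_endo_const_mult: "ae_app (field_endo a) (pf_const c * f) = pf_const c * ae_app (field_endo a) f"
  by (simp_all add: field_endo.rep_eq vector_field_simps)

locale witt_character = witt_setting p l ty
  for p l :: nat and ty :: "'k::alg_closed_field itself" +
  fixes \<chi> :: "(int \<times> nat \<Rightarrow> 'k) \<Rightarrow> 'k"
  assumes \<chi>_linear: "linear_form (witt_current p l) \<chi>" and p3: "p > 3"
begin

abbreviation "X \<equiv> witt_index p l"
abbreviation "e r \<equiv> E (fst r) (snd r)"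

lemma \<chi>_add: "x \<in> V \<Longrightarrow> y \<in> V \<Longrightarrow> \<chi> (\<lambda>q. x q + y q) = \<chi> x + \<chi> y"
  and \<chi>_scale: "x \<in> V \<Longrightarrow> \<chi> (\<lambda>q. c * x q) = c * \<chi> x"
  using \<chi>_linear by (simp_all add: linear_form_def witt_sel)

lemma \<chi>_expand:
  assumes "x \<in> V" shows "\<chi> x = (\<Sum>r\<in>X. x r * \<chi> (e r))"
proof -
  have z: "(\<lambda>q. 0) \<in> V" by (simp add: mem_witt_space)
  have sum: "(\<lambda>q. \<Sum>r\<in>A. x r * e r q) \<in> V \<and> \<chi> (\<lambda>q. \<Sum>r\<in>A. x r * e r q) = (\<Sum>r\<in>A. x r * \<chi> (e r))"
    if "finite A" for A
    using that
  proof (induction A rule: finite_induct)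
    case empty
    then show ?case using \<chi>_scale[OF z, of 0] z by simp
  next
    case (insert r A)
    have e: "(\<lambda>q. x r * e r q) \<in> V" by (rule witt_space_scale[OF witt_basis_in_space])
    show ?case
      using insert \<chi>_add[OF e, of "\<lambda>q. \<Sum>r\<in>A. x r * e r q"] witt_space_add[OF e, of "\<lambda>q. \<Sum>r\<in>A. x r * e r q"]
        \<chi>_scale[OF witt_basis_in_space] by simp
  qed
  have "(\<lambda>q. \<Sum>r\<in>X. x r * e r q) = x" by (rule witt_expand[OF assms, symmetric])
  then show ?thesis using sum[OF finite_witt_index, of p l] by simp
qed

text \<open>The coordinate of A v at r as a polynomial function of v. Summing over \<open>X\<close>
  only is correct for operators that ignore coordinates outside \<open>X\<close>, hence the
  restriction hypothesis in the lemmas on \<open>lin\<close>.\<close>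

definition lin :: "((int \<times> nat \<Rightarrow> 'k) \<Rightarrow> int \<times> nat \<Rightarrow> 'k) \<Rightarrow> int \<times> nat \<Rightarrow> (int \<times> nat, 'k) polyfun" where
  "lin A r = (\<Sum>s\<in>X. pf_const (A (e s) r) * pf_coord s)"

lemma lin_app:
  assumes A: "linear_op A" "\<And>v. A (witt_restrict p l v) = A v"
  shows "pf_app (lin A r) v = A v r"
proof -
  have "A v = A (\<lambda>q. \<Sum>s\<in>X. witt_restrict p l v s * e s q)"
    using witt_expand[OF witt_restrict, of p l v] A(2) by metis
  also have "\<dots> = (\<lambda>q. \<Sum>s\<in>X. witt_restrict p l v s * A (e s) q)"
    by (simp only: linear_op_sum[OF A(1) finite_witt_index] linear_op_scale[OF A(1)])
  finally show ?thesis
    by (simp add: lin_def witt_restrict_def mult.commute cong: sum.cong)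
qed

lemmas lin_act = lin_app[OF linear_op_witt(1) witt_act_restrict]

text \<open>\<open>T x = exp (- pot) \<circ> D x \<circ> exp pot\<close> formally, whence \<open>T\<close> is a representation, and
  \<open>T x\<^sup>p - T (x\<^sup>[\<^sup>p\<^sup>])\<close> is multiplication by \<open>(D x pot)\<^sup>p\<close>.\<close>

definition D :: "(int \<times> nat \<Rightarrow> 'k) \<Rightarrow> (int \<times> nat, 'k) polyfun add_endo" where
  "D x = field_endo (\<lambda>q. - lin (act x) q)"

definition pot :: "(int \<times> nat, 'k) polyfun" where
  "pot = - (\<Sum>r\<in>X. pf_const (\<chi> (e r)) * pf_coord r)"

definition T :: "(int \<times> nat \<Rightarrow> 'k) \<Rightarrow> (int \<times> nat, 'k) polyfun add_endo" where
  "T x = D x + mult_op (ae_app (D x) pot)"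

lemma D_simps:
  "derivation (D x)" "ae_app (D x) (pf_const c) = 0" "ae_app (D x) (pf_coord q) = - lin (act x) q"
  by (simp_all add: D_def derivation_field_endo field_endo_const field_endo_coord)

lemma D_mult_op: "D x * mult_op h = mult_op h * D x + mult_op (ae_app (D x) h)"
  using D_simps(1)[of x] by (simp add: derivation_def algebra_simps)

lemma D_const_mult: "ae_app (D x) (pf_const c * f) = pf_const c * ae_app (D x) f"
  by (simp add: D_def field_endo_const_mult)

lemma D_lin:
  assumes A: "linear_op A" "\<And>v. A (witt_restrict p l v) = A v"
  shows "ae_app (D x) (lin A r) = - lin (\<lambda>v. A (act x v)) r"
proof (rule pf_eqI)
  fix v
  have A': "linear_op (\<lambda>v. A (act x v))"
    by (rule linear_op_intros(2)[OF A(1) linear_op_witt(1)])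
  have "pf_app (ae_app (D x) (lin A r)) v = - (\<Sum>s\<in>X. A (e s) r * act x v s)"
    by (simp add: lin_def[of A] D_const_mult D_simps lin_act sum_negf)
  also have "\<dots> = - pf_app (lin A r) (act x v)"
    by (simp add: lin_def)
  also have "\<dots> = - A (act x v) r" by (simp only: lin_app[OF A])
  also have "\<dots> = pf_app (- lin (\<lambda>v. A (act x v)) r) v"
    using lin_app[OF A', of r v] by (simp add: witt_act_restrict)
  finally show "pf_app (ae_app (D x) (lin A r)) v = pf_app (- lin (\<lambda>v. A (act x v)) r) v" .
qed

lemma D_eqI:
  assumes "derivation d" "\<And>c. ae_app d (pf_const c) = 0"
    "\<And>q v. pf_app (ae_app d (pf_coord q)) v = - act x v q"
  shows "d = D x"
  using assms by (intro derivation_eqI) (auto simp: D_simps lin_act intro!: pf_eqI)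

lemma D_add: "D (\<lambda>q. x q + y q) = D x + D y"
  by (rule D_eqI[symmetric])
    (simp_all add: derivation_intros D_simps lin_act linear_op_add[OF linear_op_witt(2)])

lemma D_scale: "D (\<lambda>q. c * x q) = mult_op (pf_const c) * D x"
  by (rule D_eqI[symmetric])
    (simp_all add: derivation_intros D_simps lin_act mult_op.rep_eq linear_op_scale[OF linear_op_witt(2)])

text \<open>Composing linear vector fields reverses the order of their operators; the sign in
  \<open>D\<close> undoes the reversal.\<close>

lemma D_bracket:
  assumes "x \<in> V" "y \<in> V"
  shows "D (brk x y) = D x * D y - D y * D x"
proof (rule D_eqI[symmetric])
  fix q v
  have "act (brk x y) (witt_restrict p l v) q =
      act x (act y (witt_restrict p l v)) q - act y (act x (witt_restrict p l v)) q"
    using act_left_symmetric[OF assms witt_restrict[of p l v]] by simp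
  moreover have "pf_app (lin (\<lambda>v. act y (act x v)) q) v = act y (act x v) q" for x y
    by (rule lin_app) (auto intro: linear_op_intros linear_op_witt simp: witt_act_restrict)
  ultimately show "pf_app (ae_app (D x * D y - D y * D x) (pf_coord q)) v = - act (brk x y) v q"
    by (simp add: D_simps D_lin[OF linear_op_witt(1) witt_act_restrict] witt_act_restrict)
qed (simp_all add: derivation_intros D_simps)

lemma of_nat_p_add_endo: "of_nat p = (0 :: (int \<times> nat, 'k) polyfun add_endo)"
proof -
  have "of_nat p = (0 :: (int \<times> nat, 'k) polyfun)"
    by (rule pf_eqI) (simp add: of_nat_p)
  then show ?thesis by (metis mult_op_of_nat mult_op_simps(1))
qed

lemma of_nat_inverse:
  assumes "0 < i" "i < p"
  shows "\<exists>j. j * of_nat i = (1 :: (int \<times> nat, 'k) polyfun add_endo)"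
proof -
  have "of_nat i \<noteq> (0 :: 'k)"
    using assms of_nat_eq_0_iff_char_dvd[where ?'a = 'k, of i] char by (auto dest: dvd_imp_le)
  then have "pf_const (inverse (of_nat i)) * of_nat i = (1 :: (int \<times> nat, 'k) polyfun)"
    by (intro pf_eqI) simp
  then have "mult_op (pf_const (inverse (of_nat i))) * of_nat i = (1 :: (int \<times> nat, 'k) polyfun add_endo)"
    by (metis mult_op_of_nat mult_op_simps(2,6))
  then show ?thesis by blast
qed

text \<open>Both sides are derivations, so coordinates suffice. There the left-hand operator
  \<open>act (pmap x)\<close> is the p-th power of \<open>act x\<close> by \<open>L_pmap\<close>,
  and the sign (-1)^p equals -1 because p is odd.\<close>

lemma D_pmap:
  assumes x: "x \<in> V"
  shows "D (pmap x) = D x ^ p"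
proof (rule D_eqI[symmetric])
  show "derivation (D x ^ p)"
    by (rule derivation_power_prime[OF D_simps(1) prime_p of_nat_p_add_endo])
  have p1: "p = Suc (p - 1)" using p0 by simp
  fix c
  show "ae_app (D x ^ p) (pf_const c) = 0"
    by (subst p1) (simp only: power_Suc2 times_add_endo.rep_eq D_simps ae_app_zero)
next
  fix q v
  have lin_n: "linear_op (act x ^^ n)" for n
    by (induction n) (simp_all add: linear_op_def linear_op_add[OF linear_op_witt(1)]
        linear_op_scale[OF linear_op_witt(1)])
  \<comment> \<open>Positive powers only: the identity sees coordinates outside \<open>X\<close>,
    whereas \<open>act x\<close> ignores them.\<close>
  have res: "(act x ^^ Suc n) (witt_restrict p l v) = (act x ^^ Suc n) v" for n v
    by (simp only: funpow_Suc_right o_apply witt_act_restrict)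
  have step: "ae_app (D x) (lin (act x ^^ Suc n) q) = - lin (act x ^^ Suc (Suc n)) q" for n
  proof -
    have "(\<lambda>v. (act x ^^ Suc n) (act x v)) = act x ^^ Suc (Suc n)"
      by (rule ext) (metis funpow_Suc_right o_apply)
    then show ?thesis using D_lin[OF lin_n res, of x n q] by (simp only:)
  qed
  have "(ae_app (D x) ^^ Suc n) (pf_coord q) = pf_const ((- 1) ^ Suc n) * lin (act x ^^ Suc n) q" for n
  proof (induction n)
    case 0
    then show ?case by (simp add: D_simps)
  next
    case (Suc n)
    show ?case
      unfolding funpow.simps(2)[of "Suc n" "ae_app (D x)"] o_apply Suc D_const_mult step
      by (simp del: funpow.simps)
  qed
  from this[of "p - 1"] have "ae_app (D x ^ p) (pf_coord q) = pf_const ((- 1) ^ p) * lin (act x ^^ p) q"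
    using p0 by (simp only: ae_app_power Suc_diff_1)
  moreover have "odd p" using prime_odd_nat[OF prime_p] p3 by simp
  moreover have "pf_app (lin (act x ^^ p) q) v = (act x ^^ p) v q"
    using lin_app[OF lin_n res, of "p - 1" q v] p0 by (simp only: Suc_diff_1)
  moreover have "(act x ^^ p) v q = act (pmap x) v q"
    using L_pmap[OF x] by (metis act_endo.rep_eq endo_app_power)
  ultimately show "pf_app (ae_app (D x ^ p) (pf_coord q)) v = - act (pmap x) v q"
    by simp
qed

text \<open>Jacobson's surviving correction is the (p - 1)-st iterate of \<open>D x\<close> on
  \<open>D x pot\<close>, that is \<open>D x ^ p\<close> on \<open>pot\<close>. This is
  \<open>D (pmap x) pot\<close>, exactly the multiplication part of
  \<open>T (pmap x)\<close>.\<close>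

lemma T_power:
  assumes x: "x \<in> V"
  shows "T x ^ p = T (pmap x) + mult_op (ae_app (D x) pot ^ p)"
proof -
  have "(ae_app (D x) ^^ (p - 1)) (ae_app (D x) pot) = ae_app (D (pmap x)) pot"
    using p0 funpow_Suc_right[of "p - 1" "ae_app (D x)"]
    by (simp add: D_pmap[OF x] ae_app_power o_def fun_eq_iff)
  then show ?thesis
    unfolding T_def
    by (simp add: derivation_plus_mult_power[OF D_simps(1) prime_p of_nat_p_add_endo of_nat_inverse]
        D_pmap[OF x])
qed

text \<open>The added multiplications commute with each other, and \<open>D x pot\<close> is the
  coboundary of \<open>pot\<close>, hence a cocycle: the cross terms combine to
  \<open>D (brk x y) pot\<close>.\<close>

lemma T_bracket:
  assumes "x \<in> V" "y \<in> V"
  shows "T (brk x y) = T x * T y - T y * T x"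
  unfolding T_def D_bracket[OF assms]
  by (simp add: algebra_simps D_mult_op mult_op_commute)

lemma T_hom: "free_hom (\<lambda>c. mult_op (pf_const c)) T"
proof
  fix c x
  show "mult_op (pf_const c) * T x = T x * mult_op (pf_const c)"
    by (simp add: T_def algebra_simps D_mult_op D_simps mult_op_commute)
qed simp_all

text \<open>At v = \<open>E 0 0\<close> the vector x v is x, since \<open>E 0 0\<close> is a right
  unit; the signs in \<open>D\<close> and \<open>pot\<close> cancel.\<close>

lemma pot_app: "x \<in> V \<Longrightarrow> pf_app (ae_app (D x) pot) (E 0 0) = \<chi> x"
  by (simp add: pot_def D_const_mult D_simps lin_act act_e0 \<chi>_expand[of x] sum_negf)
    (simp add: mult.commute)

abbreviation "\<rho> \<equiv> free_ext (\<lambda>c. mult_op (pf_const c)) T"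

lemmas \<rho>_simps = free_hom.ext_simps[OF T_hom]

text \<open>Derivations kill p-th powers in characteristic p, so these commute with every
  \<open>T x\<close> and hence with the whole image of \<rho>.\<close>

lemma power_p_central:
  shows "mult_op (h ^ p) * \<rho> g = \<rho> g * mult_op (h ^ p)"
proof -
  have "D x * mult_op (h ^ p) = mult_op (h ^ p) * D x" for x
  proof -
    have "ae_app (D x) (h ^ n) = of_nat n * (h ^ (n - 1) * ae_app (D x) h)" for n
    proof (induction n)
      case 0
      then show ?case using derivation_one[OF D_simps(1)] by simp
    next
      case (Suc n)
      have "ae_app (D x) (h * h ^ n) = h * ae_app (D x) (h ^ n) + ae_app (D x) h * h ^ n"
        using D_simps(1)[of x] unfolding derivation_leibniz by blast
      then show ?case using Suc by (cases n) (simp_all add: algebra_simps)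
    qed
    moreover have "of_nat p = (0 :: (int \<times> nat, 'k) polyfun)"
      by (rule pf_eqI) (simp add: of_nat_p)
    ultimately have "ae_app (D x) (h ^ p) = 0" by simp
    then show ?thesis by (simp add: D_mult_op del: mult_op_power)
  qed
  then have T: "T x * mult_op (h ^ p) = mult_op (h ^ p) * T x" for x
    by (simp add: T_def algebra_simps mult_op_commute del: mult_op_power)
  have "g \<in> free_on UNIV" by (simp add: free_on_def)
  then show ?thesis
  proof (induction g rule: free_on_induct)
    case (scale c f)
    then show ?case
      by (simp only: \<rho>_simps mult.assoc[symmetric] mult_op_commute[of "h ^ p"]) (simp only: mult.assoc scale)
  next
    case (gen x f)
    then show ?case
      by (simp only: \<rho>_simps mult.assoc[symmetric] T[symmetric]) (simp only: mult.assoc gen)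
  qed (simp_all only: \<rho>_simps distrib_left distrib_right mult_1_left mult_1_right)
qed

lemma lie_carrier_witt: "lie_carrier W"
proof -
  interpret restricted_lie_algebra W by (rule restricted_lie_algebra_witt)
  show ?thesis
    by unfold_locales (simp_all add: bracket_closed p_map_closed)
qed

text \<open>The power relation does not act as zero, because the p-character of \<open>T\<close> is
  not constant. It acts as multiplication by k^p with k = \<open>D x pot\<close> - \<chi>(x), and k
  vanishes at \<open>E 0 0\<close>. By centrality k^p can be pulled out of every product, so all
  two-sided multiples vanish at that point.\<close>

theorem one_notin_red_kernel: "1 \<notin> red_kernel W \<chi>"
proof -
  \<comment> \<open>Vanishing at one point after acting on all u is stable under multiplication on
    the right only; the quantifiers over g and h make the ideal two-sided.\<close>
  define Q where "Q = {f \<in> free_on V. \<forall>g h u. pf_app (ae_app (\<rho> (g * f * h)) u) (E 0 0) = 0}"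
  have Q0: "f \<in> Q" if "f \<in> free_on V" "\<rho> f = 0" for f
    using that by (simp add: Q_def \<rho>_simps)
  have W: "carrier W = V" by (rule witt_sel)
  have "alg_ideal V Q"
    unfolding alg_ideal_def
  proof (intro conjI ballI)
    fix f g :: "('k, int \<times> nat \<Rightarrow> 'k) free_alg"
    assume fg: "f \<in> free_on V" "g \<in> Q"
    have "a * (f * g) * b = (a * f) * g * b" "a * (g * f) * b = a * g * (f * b)" for a b
      by (simp_all add: mult.assoc)
    then show "f * g \<in> Q" "g * f \<in> Q" using fg by (auto simp: Q_def)
  qed (auto simp: Q_def \<rho>_simps distrib_left distrib_right)
  moreover have "red_relations W \<chi> Q"
    unfolding red_relations_def W
  proof (intro conjI ballI allI)
    fix x y assume x: "x \<in> V" and y: "y \<in> V"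
    then show "gen (x \<oplus>\<^bsub>W\<^esub> y) - gen x - gen y \<in> Q"
      by (intro Q0) (simp_all add: witt_sel witt_space_add \<rho>_simps T_def D_add)
    show "gen x * gen y - gen y * gen x - gen (bracket W x y) \<in> Q"
      using x y by (intro Q0) (simp_all add: witt_sel witt_bracket_in_space \<rho>_simps T_bracket)
  next
    fix c x assume x: "x \<in> V"
    then show "gen (c \<odot>\<^bsub>W\<^esub> x) - scal c * gen x \<in> Q"
      by (intro Q0) (simp_all add: witt_sel witt_space_scale \<rho>_simps T_def D_scale mult_op.rep_eq algebra_simps)
  next
    fix x assume x: "x \<in> V"
    define k where "k = ae_app (D x) pot - pf_const (\<chi> x)"
    have k0: "pf_app (k ^ p) (E 0 0) = 0"
      using x p0 by (simp add: k_def pot_app)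
    have "\<rho> (gen x ^ p - gen (pmap x) - scal (\<chi> x ^ p)) =
        mult_op (ae_app (D x) pot ^ p - pf_const (\<chi> x) ^ p)"
      using T_power[OF x] by (simp add: \<rho>_simps del: scal_simps mult_op_power)
    also have "ae_app (D x) pot ^ p - pf_const (\<chi> x) ^ p = k ^ p"
    proof (rule pf_eqI)
      fix v
      have "(a - b + b) ^ p = (a - b) ^ p + b ^ p" for a b :: 'k
        by (rule freshmans_dream) (use prime_p char in simp_all)
      then have "(a - b) ^ p = a ^ p - b ^ p" for a b :: 'k by (simp add: algebra_simps)
      then show "pf_app (ae_app (D x) pot ^ p - pf_const (\<chi> x) ^ p) v = pf_app (k ^ p) v"
        by (simp add: k_def)
    qed
    finally have rel: "\<rho> (gen x ^ p - gen (pmap x) - scal (\<chi> x ^ p)) = mult_op (k ^ p)" .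
    have "\<rho> (g * (gen x ^ p - gen (pmap x) - scal (\<chi> x ^ p)) * h) = mult_op (k ^ p) * \<rho> (g * h)" for g h
      by (simp only: \<rho>_simps(6) rel) (simp only: power_p_central[symmetric] mult.assoc)
    then show "gen x ^ CHAR('k) - gen (p_map W x) - scal (\<chi> x ^ CHAR('k)) \<in> Q"
      using x k0 pmap_in_space unfolding char
      by (simp add: Q_def witt_sel mult_op.rep_eq del: scal_simps mult_op_power pf_app_power)
  qed
  ultimately have "red_kernel W \<chi> \<subseteq> Q"
    using lie_carrier.red_kernel_minimal[OF lie_carrier_witt] by (simp add: W)
  moreover have "1 \<notin> Q"
    by (auto simp: Q_def \<rho>_simps intro!: exI[of _ 1])
  ultimately show ?thesis by blast
qed

end

section \<open>Adjoining one generator\<close>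

text \<open>\<open>N / K\<close> is a module for the algebra generated by \<open>Hs\<close>, sitting in the module \<open>F / K\<close>,
  on which \<open>y\<close> acts as the scalar \<open>c\<close>.  As \<open>[y, x] = z\<close> is invertible, \<open>y - c\<close> acts on
  \<open>N + x N + x\<^sup>2 N + \<dots>\<close> like \<open>z d/dx\<close>, up to terms of lower degree in \<open>x\<close>.\<close>

locale adjoin =
  fixes F K N Hs Zs :: "'r::ring_1 set" and x y z c z' :: 'r and p :: nat
  assumes F_add: "\<lbrakk>f \<in> F; g \<in> F\<rbrakk> \<Longrightarrow> f + g \<in> F" and F_mult: "\<lbrakk>f \<in> F; g \<in> F\<rbrakk> \<Longrightarrow> f * g \<in> F"
    and F_uminus: "f \<in> F \<Longrightarrow> - f \<in> F" and F_one: "1 \<in> F"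
    and K_add: "\<lbrakk>f \<in> K; g \<in> K\<rbrakk> \<Longrightarrow> f + g \<in> K" and K_mult: "\<lbrakk>f \<in> F; g \<in> K\<rbrakk> \<Longrightarrow> f * g \<in> K"
    and K_zero: "0 \<in> K"
    and N_add: "\<lbrakk>f \<in> N; g \<in> N\<rbrakk> \<Longrightarrow> f + g \<in> N"
    and KN: "K \<subseteq> N" and NF: "N \<subseteq> F"
    and Hs_F: "Hs \<subseteq> F" and Hs_N: "\<lbrakk>w \<in> Hs; n \<in> N\<rbrakk> \<Longrightarrow> w * n \<in> N"
    and Zs_F: "Zs \<subseteq> F" and Zs_N: "\<lbrakk>d \<in> Zs; n \<in> N\<rbrakk> \<Longrightarrow> d * n \<in> N"
    and Zs_central: "\<lbrakk>d \<in> Zs; f \<in> F\<rbrakk> \<Longrightarrow> d * f = f * d"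
    and x_F: "x \<in> F"
    and Hs_x: "w \<in> Hs \<Longrightarrow> \<exists>w'\<in>Hs. \<exists>d\<in>Zs. \<forall>f\<in>F. (w * x - x * w - w' - d * x) * f \<in> K"
    and x_power: "\<exists>w\<in>Hs. \<exists>d\<in>Zs. \<exists>d'\<in>Zs. \<forall>f\<in>F. (x ^ p - w - d' * x - d) * f \<in> K"
    and y_Hs: "y \<in> Hs" and c_Zs: "c \<in> Zs" and y_N: "n \<in> N \<Longrightarrow> (y - c) * n \<in> K"
    and z_Hs: "z \<in> Hs" and yx: "f \<in> F \<Longrightarrow> (y * x - x * y - z) * f \<in> K"
    and zx: "\<exists>w\<in>Hs. \<forall>f\<in>F. (z * x - x * z - w) * f \<in> K"
    and z'_F: "z' \<in> F" and z'_z: "f \<in> F \<Longrightarrow> (z' * z - 1) * f \<in> K"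
    and of_nat_inv: "\<lbrakk>0 < a; a < p\<rbrakk> \<Longrightarrow> \<exists>b\<in>F. b * of_nat a = 1"
    and p2: "2 \<le> p"
begin

text \<open>K + N + x N + ... with exponents below the index. Starting with \<open>K\<close> at 0
  makes \<open>filt 1\<close> equal to \<open>N\<close> and \<open>filt p\<close> the full
  stage.\<close>

primrec filt :: "nat \<Rightarrow> 'r set" where
  "filt 0 = K"
| "filt (Suc a) = {u + x ^ a * n |u n. u \<in> filt a \<and> n \<in> N}"

lemma filt_SucI: "\<lbrakk>u \<in> filt a; n \<in> N\<rbrakk> \<Longrightarrow> u + x ^ a * n \<in> filt (Suc a)"
  by auto

lemma F_diff: "\<lbrakk>f \<in> F; g \<in> F\<rbrakk> \<Longrightarrow> f - g \<in> F"
  using F_add[OF _ F_uminus] by simp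

lemma F_power: "f \<in> F \<Longrightarrow> f ^ n \<in> F"
  by (induction n) (auto intro: F_one F_mult)

lemma K_uminus: "f \<in> K \<Longrightarrow> - f \<in> K"
  using K_mult[OF F_uminus[OF F_one]] by simp

lemma K_diff: "\<lbrakk>f \<in> K; g \<in> K\<rbrakk> \<Longrightarrow> f - g \<in> K"
  using K_add[OF _ K_uminus] by simp

lemma filt_add: "\<lbrakk>u \<in> filt a; v \<in> filt a\<rbrakk> \<Longrightarrow> u + v \<in> filt a"
proof (induction a arbitrary: u v)
  case (Suc a)
  then obtain u' n v' m where "u = u' + x ^ a * n" "v = v' + x ^ a * m"
    "u' \<in> filt a" "v' \<in> filt a" "n \<in> N" "m \<in> N" by auto
  then have "u + v = (u' + v') + x ^ a * (n + m)" "u' + v' \<in> filt a" "n + m \<in> N"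
    using Suc.IH N_add by (auto simp: algebra_simps)
  then show ?case by auto
qed (simp add: K_add)

lemma filt_Suc: "u \<in> filt a \<Longrightarrow> u \<in> filt (Suc a)"
  using filt_SucI[of u a 0] K_zero KN by auto

lemma filt_mono: "a \<le> b \<Longrightarrow> filt a \<subseteq> filt b"
  by (rule lift_Suc_mono_le) (use filt_Suc in blast)+

lemma K_filt: "K \<subseteq> filt a"
  using filt_mono[of 0 a] by simp

lemma top_filt: "n \<in> N \<Longrightarrow> x ^ a * n \<in> filt (Suc a)"
  using filt_SucI[OF subsetD[OF K_filt K_zero], of n a] by (simp del: filt.simps)

lemma N_filt: "N \<subseteq> filt (Suc a)"
  using top_filt[of _ 0] filt_mono[of 1 "Suc a"] by (auto simp del: filt.simps)

lemma filt_F: "filt a \<subseteq> F"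
  by (induction a) (use KN NF in \<open>auto intro!: F_add F_mult F_power x_F\<close>)

lemma filt_Zs:
  assumes d: "d \<in> Zs"
  shows "u \<in> filt a \<Longrightarrow> d * u \<in> filt a"
proof (induction a arbitrary: u)
  case 0
  then show ?case using K_mult Zs_F d by auto
next
  case (Suc a)
  then obtain u' n where u: "u = u' + x ^ a * n" "u' \<in> filt a" "n \<in> N" by auto
  have "d * u = d * u' + x ^ a * (d * n)"
    using Zs_central[OF d F_power[OF x_F, of a]]
    by (simp add: u distrib_left mult.assoc[symmetric])
  moreover have "d * u' \<in> filt a" "d * n \<in> N" using Suc.IH u Zs_N d by auto
  ultimately show ?case unfolding filt.simps by blast
qed

lemma filt_x: "u \<in> filt a \<Longrightarrow> x * u \<in> filt (Suc a)"
proof (induction a arbitrary: u)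
  case 0
  then show ?case using K_mult[OF x_F] K_filt[of 1] by auto
next
  case (Suc a)
  then obtain u' n where u: "u = u' + x ^ a * n" "u' \<in> filt a" "n \<in> N" by auto
  have "x * u = x * u' + x ^ Suc a * n" by (simp add: u distrib_left mult.assoc)
  moreover have "x * u' \<in> filt (Suc a)" using Suc.IH u by blast
  ultimately show ?case unfolding filt.simps(2)[of "Suc a"] using u by blast
qed

lemma filt_K_diff: "\<lbrakk>u - v \<in> K; v \<in> filt a\<rbrakk> \<Longrightarrow> u \<in> filt a"
  using filt_add[of "u - v" a v] K_filt by auto

text \<open>Moving w past one x costs an element w' of \<open>Hs\<close> and a multiple d x, neither
  of which raises the degree. The induction is over all w at once since w' is a new one.\<close>

lemma filt_Hs: "\<lbrakk>w \<in> Hs; u \<in> filt a\<rbrakk> \<Longrightarrow> w * u \<in> filt a"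
proof (induction a arbitrary: w u)
  case 0
  then show ?case using K_mult Hs_F by auto
next
  case (Suc a)
  obtain u' n where u: "u = u' + x ^ a * n" "u' \<in> filt a" "n \<in> N" using Suc.prems by auto
  have "w * (x ^ a * n) \<in> filt (Suc a)"
  proof (cases a)
    case 0
    then show ?thesis using top_filt[of "w * n" 0] Hs_N Suc.prems u by simp
  next
    case (Suc b)
    define g where "g = x ^ b * n"
    have g: "g \<in> filt a" "g \<in> F"
      using top_filt[OF u(3), of b] filt_F Suc by (auto simp: g_def simp del: filt.simps)
    obtain w' d where w': "w' \<in> Hs" "d \<in> Zs" "\<forall>f\<in>F. (w * x - x * w - w' - d * x) * f \<in> K"
      using Hs_x[OF Suc.prems(1)] by blast
    have "w * (x * g) - (x * (w * g) + w' * g + d * (x * g)) \<in> K"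
      using bspec[OF w'(3) g(2)] by (simp add: algebra_simps)
    moreover have "x * (w * g) + w' * g + d * (x * g) \<in> filt (Suc a)"
      using Suc.IH[OF _ g(1)] Suc.prems(1) w' g filt_x filt_Zs filt_Suc filt_add by presburger
    ultimately have "w * (x * g) \<in> filt (Suc a)" by (rule filt_K_diff)
    then show ?thesis by (simp add: g_def Suc mult.assoc del: filt.simps)
  qed
  moreover have "w * u' \<in> filt (Suc a)" using Suc u filt_Suc by blast
  ultimately show ?case unfolding u(1) distrib_left by (rule filt_add[rotated])
qed

lemma filt_closed_x:
  assumes u: "u \<in> filt p"
  shows "x * u \<in> filt p"
proof -
  define a where "a = p - 1"
  have p: "p = Suc a" using p2 by (simp add: a_def)
  obtain u' n where u: "u = u' + x ^ a * n" "u' \<in> filt a" "n \<in> N" using u unfolding p by auto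
  obtain w d d' where w: "w \<in> Hs" "d \<in> Zs" "d' \<in> Zs" "\<forall>f\<in>F. (x ^ p - w - d' * x - d) * f \<in> K"
    using x_power by blast
  have nF: "n \<in> F" using u NF by blast
  have "x ^ p * n - (w * n + d * n + d' * (x * n)) \<in> K"
    using bspec[OF w(4) nF] by (simp add: algebra_simps)
  moreover have "w * n \<in> filt p" "d * n \<in> filt p"
    using N_filt[of a] Hs_N Zs_N w u unfolding p by (auto simp del: filt.simps)
  \<comment> \<open>This term has degree one, so it fits below degree p because 2 \<le> p.\<close>
  moreover have "d' * (x * n) \<in> filt p"
    using filt_Zs[OF w(3)] top_filt[OF u(3), of 1] filt_mono[of 2 p] p2 by (auto simp: numeral_2_eq_2 simp del: filt.simps)
  ultimately have "x ^ p * n \<in> filt p"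
    using filt_K_diff filt_add by blast
  moreover have "x * u = x * u' + x ^ p * n" by (simp add: u p distrib_left mult.assoc)
  moreover have "x * u' \<in> filt p" using filt_x[OF u(2)] by (simp add: p)
  ultimately show ?thesis using filt_add by simp
qed

text \<open>The commutator of z with x contains no multiple of x, so z commutes with x^a up to lower
  degree. A term d x, as allowed for general elements of \<open>Hs\<close>, would alter the leading
  coefficient.\<close>

lemma z_filt:
  assumes n: "n \<in> N"
  shows "z * (x ^ a * n) - x ^ a * (z * n) \<in> filt a"
proof (induction a)
  case 0
  then show ?case using K_zero by simp
next
  case (Suc a)
  obtain w where w: "w \<in> Hs" "\<forall>f\<in>F. (z * x - x * z - w) * f \<in> K" using zx by blast
  define g where "g = x ^ a * n"
  have g: "g \<in> filt (Suc a)" using top_filt[OF n] by (simp add: g_def)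
  have gF: "g \<in> F" using g filt_F by blast
  have "(z * x - x * z - w) * g + w * g + x * (z * (x ^ a * n) - x ^ a * (z * n)) \<in> filt (Suc a)"
    using filt_x[OF Suc] filt_Hs[OF w(1) g] bspec[OF w(2) gF] K_filt filt_add by blast
  then show ?case by (simp add: g_def algebra_simps)
qed

lemma of_nat_N: "n \<in> N \<Longrightarrow> of_nat a * n \<in> N"
  by (induction a) (use K_zero KN N_add in \<open>auto simp: distrib_right\<close>)

text \<open>The derivative of x^(a+1): passing y - c through one factor x leaves a z, and z slides
  past the remaining powers up to lower degree. In the end y - c reaches n and kills it.\<close>

lemma y_top:
  assumes n: "n \<in> N"
  shows "(y - c) * (x ^ Suc a * n) - x ^ a * (of_nat (Suc a) * (z * n)) \<in> filt a"
proof (induction a)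
  case 0
  have nF: "n \<in> F" using n NF by blast
  have "(y * x - x * y - z) * n + x * ((y - c) * n) \<in> K"
    using yx[OF nF] K_mult[OF x_F y_N[OF n]] K_add by blast
  moreover have "x * (c * n) = c * (x * n)"
    using Zs_central[OF c_Zs x_F] by (simp add: mult.assoc[symmetric])
  ultimately show ?case by (simp add: algebra_simps)
next
  case (Suc a)
  define g where "g = x ^ Suc a * n"
  have gF: "g \<in> F" using F_mult F_power x_F n NF by (auto simp: g_def simp del: power_Suc)
  have c: "c * (x * g) = x * (c * g)"
    using Zs_central[OF c_Zs x_F] by (simp add: mult.assoc[symmetric])
  have com: "x ^ b * (of_nat m * f) = of_nat m * (x ^ b * f)" for b m f
    by (metis mult.assoc mult_of_nat_commute)
  have "x * ((y - c) * g - x ^ a * (of_nat (Suc a) * (z * n))) \<in> filt (Suc a)"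
    using filt_x[OF Suc] by (simp only: g_def)
  moreover have "z * g - x ^ Suc a * (z * n) \<in> filt (Suc a)"
    using z_filt[OF n, of "Suc a"] by (simp only: g_def)
  moreover have "(y * x - x * y - z) * g \<in> filt (Suc a)" using yx[OF gF] K_filt by blast
  ultimately have "x * ((y - c) * g - x ^ a * (of_nat (Suc a) * (z * n))) +
      (z * g - x ^ Suc a * (z * n)) + (y * x - x * y - z) * g \<in> filt (Suc a)"
    using filt_add by blast
  also have "x * ((y - c) * g - x ^ a * (of_nat (Suc a) * (z * n))) +
      (z * g - x ^ Suc a * (z * n)) + (y * x - x * y - z) * g =
      (y - c) * (x * g) - x ^ Suc a * (of_nat (Suc (Suc a)) * (z * n))"
    using c by (simp add: algebra_simps com)
  finally show ?case by (simp add: g_def mult.assoc)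
qed

lemma y_filt: "u \<in> filt (Suc a) \<Longrightarrow> (y - c) * u \<in> filt a"
proof (induction a arbitrary: u)
  case 0
  have yc: "y - c \<in> F" using F_diff Hs_F y_Hs Zs_F c_Zs by blast
  obtain k n where "u = k + n" "k \<in> K" "n \<in> N" using 0 by auto
  then show ?case using K_add[OF K_mult[OF yc] y_N] by (simp add: distrib_left)
next
  case (Suc a)
  then obtain u' n where u: "u = u' + x ^ Suc a * n" "u' \<in> filt (Suc a)" "n \<in> N"
    unfolding filt.simps(2)[of "Suc a"] by blast
  have "x ^ a * (of_nat (Suc a) * (z * n)) \<in> filt (Suc a)"
    by (intro top_filt of_nat_N Hs_N z_Hs u)
  then have "(y - c) * (x ^ Suc a * n) \<in> filt (Suc a)"
    using filt_add[OF filt_Suc[OF y_top[OF u(3), of a]]] by fastforce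
  then show ?case
    using filt_add[OF filt_Suc[OF Suc.IH[OF u(2)]]] by (simp only: u(1) distrib_left)
qed

text \<open>Applying y - c lowers the degree by one and multiplies the leading coefficient by z and
  by the exponent. Both are invertible modulo \<open>K\<close> while the exponent is below p, so a
  coefficient outside \<open>K\<close> survives down to degree zero.\<close>

lemma leading_term:
  assumes "u \<in> filt a" "n \<in> N" "n \<notin> K" "a < p"
  shows "\<exists>w\<in>F. w * (u + x ^ a * n) \<in> N - K"
  using assms
proof (induction a arbitrary: u n)
  case 0
  then have "u + n \<in> N" "u + n \<notin> K"
    using KN N_add K_diff[of "u + n" u] by auto
  then show ?case using F_one by (intro bexI[of _ 1]) auto
next
  case (Suc a)
  define n' where "n' = of_nat (Suc a) * (z * n)"
  have nF: "n \<in> F" using Suc.prems NF by blast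
  have yc: "y - c \<in> F" using F_diff Hs_F y_Hs Zs_F c_Zs by blast
  have n': "n' \<in> N" unfolding n'_def by (intro of_nat_N Hs_N z_Hs Suc.prems)
  have "n' \<notin> K"
  proof
    assume K: "n' \<in> K"
    obtain b where b: "b \<in> F" "b * of_nat (Suc a) = 1" using of_nat_inv Suc.prems(4) by blast
    have "z * n = b * n'"
      by (simp only: n'_def mult.assoc[symmetric] b(2)) simp
    then have "z' * (z * n) \<in> K" using K b z'_F K_mult by simp
    then have "z' * (z * n) - (z' * z - 1) * n \<in> K" by (rule K_diff[OF _ z'_z[OF nF]])
    then have "n \<in> K" by (simp add: algebra_simps)
    then show False using Suc.prems by blast
  qed
  define v where "v = (y - c) * u + ((y - c) * (x ^ Suc a * n) - x ^ a * n')"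
  have "v \<in> filt a"
    unfolding v_def n'_def by (intro filt_add y_filt y_top Suc.prems)
  then obtain w where "w \<in> F" "w * (v + x ^ a * n') \<in> N - K"
    using Suc.IH[OF _ n' \<open>n' \<notin> K\<close>, of v] Suc.prems(4) by auto
  moreover have "v + x ^ a * n' = (y - c) * (u + x ^ Suc a * n)"
    by (simp add: v_def distrib_left)
  ultimately show ?case
    using F_mult yc by (intro bexI[of _ "w * (y - c)"]) (simp_all add: mult.assoc)
qed

lemma filt_descend: "\<lbrakk>u \<in> filt a; a \<le> p; u \<notin> K\<rbrakk> \<Longrightarrow> \<exists>w\<in>F. w * u \<in> N - K"
proof (induction a arbitrary: u)
  case (Suc a)
  then obtain u' n where u: "u = u' + x ^ a * n" "u' \<in> filt a" "n \<in> N" by auto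
  show ?case
  proof (cases "n \<in> K")
    case True
    then have k: "x ^ a * n \<in> K" using K_mult F_power x_F by blast
    then have "u' \<notin> K" using Suc.prems u K_add by blast
    then obtain w where w: "w \<in> F" "w * u' \<in> N - K" using Suc u by auto
    have wk: "w * (x ^ a * n) \<in> K" using K_mult w k by blast
    have "w * u \<in> N" using w wk KN N_add by (auto simp: u distrib_left)
    moreover have "w * u \<notin> K"
      using K_diff[OF _ wk, of "w * u"] w by (auto simp: u distrib_left)
    ultimately show ?thesis using w by blast
  next
    case False
    then show ?thesis using leading_term[OF u(2,3)] Suc.prems u by simp
  qed
qed simp

text \<open>Descent from an element of the left ideal \<open>K\<close> stays in \<open>K\<close>,
  whereas a coefficient outside \<open>K\<close> would lead out of it.\<close>

lemma filt_independent:
  assumes "u \<in> filt a" "n \<in> N" "a < p" "u + x ^ a * n \<in> K"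
  shows "n \<in> K"
proof (rule ccontr)
  assume "n \<notin> K"
  then obtain w where "w \<in> F" "w * (u + x ^ a * n) \<in> N - K" using leading_term assms by blast
  then show False using K_mult assms(4) by blast
qed

lemma sum_filt: "(\<And>a. a < b \<Longrightarrow> m a \<in> N) \<Longrightarrow> (\<Sum>a<b. x ^ a * m a) \<in> filt b"
  by (induction b) (auto simp: K_zero)

lemma sum_independent:
  assumes "(\<Sum>a<b. x ^ a * m a) \<in> K" "\<And>a. a < b \<Longrightarrow> m a \<in> N" "b \<le> p" "a < b"
  shows "m a \<in> K"
  using assms
proof (induction b)
  case (Suc b)
  have mb: "m b \<in> K"
    using Suc.prems by (intro filt_independent[OF sum_filt[of b m], of "m b" ]) auto
  then have "x ^ b * m b \<in> K" using K_mult F_power x_F by blast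
  then have "(\<Sum>a<b. x ^ a * m a) \<in> K"
    using K_diff[OF Suc.prems(1), of "x ^ b * m b"] by simp
  then show ?case using Suc mb by (cases "a = b") auto
qed simp

lemma filt_sum:
  "u \<in> filt b \<Longrightarrow> \<exists>m. (\<forall>a. m a \<in> N) \<and> u - (\<Sum>a<b. x ^ a * m a) \<in> K"
proof (induction b arbitrary: u)
  case 0
  then show ?case using K_zero KN by (intro exI[of _ "\<lambda>_. 0"]) auto
next
  case (Suc b)
  then obtain u' n where u: "u = u' + x ^ b * n" "u' \<in> filt b" "n \<in> N" by auto
  then obtain m where m: "\<forall>a. m a \<in> N" "u' - (\<Sum>a<b. x ^ a * m a) \<in> K" using Suc.IH by blast
  have "(\<Sum>a<b. x ^ a * (m(b := n)) a) = (\<Sum>a<b. x ^ a * m a)" by (intro sum.cong) auto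
  then show ?case using m u by (intro exI[of _ "m(b := n)"]) (auto simp: algebra_simps)
qed

end

section \<open>The Witt algebra in height r\<close>

lemma ring_ad_coeff_commute:
  assumes "x * y = y * (x :: 'r::ring_1)"
  shows "ring_ad_coeff x y (Suc n) k = 0"
proof (induction n arbitrary: k)
  case 0
  show ?case using assms by (cases k) auto
next
  case (Suc n)
  then show ?case by (cases k) (simp_all only: ring_ad_coeff.simps(2,3)[of _ _ "Suc n"] mult_zero_left mult_zero_right diff_self add_0)
qed

text \<open>All commutators in Jacobson's formula vanish. It serves for \<open>gen x\<close> and a
  scalar, which commute inside the noncommutative free algebra.\<close>

lemma add_power_prime_commute:
  fixes x y :: "'r::ring_1"
  assumes p: "prime p" "of_nat p = (0 :: 'r)" and xy: "x * y = y * x"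
    and inv: "\<And>i. 0 < i \<Longrightarrow> i < p \<Longrightarrow> \<exists>j. j * of_nat i = (1 :: 'r)"
  shows "(x + y) ^ p = x ^ p + y ^ p"
proof -
  obtain s where s: "(x + y) ^ p = x ^ p + y ^ p + (\<Sum>i\<in>{1..<p}. s i)"
    "\<And>i. i \<in> {1..<p} \<Longrightarrow> of_nat i * s i = ring_ad_coeff x y (p - 1) (i - 1)"
    using jacobson[OF p] by metis
  have "s i = 0" if i: "i \<in> {1..<p}" for i
  proof -
    obtain j :: 'r where j: "j * of_nat i = 1" using inv[of i] i by auto
    have "p - 1 = Suc (p - 2)" using prime_ge_2_nat[OF p(1)] i by auto
    then have "of_nat i * s i = 0" using s(2)[OF i] ring_ad_coeff_commute[OF xy] by metis
    moreover have "s i = j * (of_nat i * s i)" using j by (simp add: mult.assoc[symmetric])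
    ultimately show ?thesis by simp
  qed
  then show ?thesis using s(1) by simp
qed

section \<open>Supports, ranks and the height\<close>

locale witt_leading = witt_character p l ty \<chi>
  for p l :: nat and ty :: "'k::alg_closed_field itself" and \<chi> :: "(int \<times> nat \<Rightarrow> 'k) \<Rightarrow> 'k" +
  fixes r s :: int
  assumes r_height: "r = witt_height p l \<chi>" and r1: "1 < r" and rp: "r < int p - 1"
    and \<chi>_top: "\<chi> (E (r - 1) l) \<noteq> 0" and s_def: "s = r div 2"
begin

sublocale LC: lie_carrier W \<chi>
  by (rule lie_carrier_witt)

lemma W_carrier: "carrier W = V"
  by (rule witt_sel)

abbreviation "FF \<equiv> (free_on V :: ('k, int \<times> nat \<Rightarrow> 'k) free_alg set)"
abbreviation "JJ \<equiv> red_kernel W \<chi>"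

lemma s_bounds: "1 \<le> s" "2 * s \<le> r" "r \<le> 2 * s + 1"
  using r1 by (auto simp: s_def)

lemma mem_X: "(i, k) \<in> X \<longleftrightarrow> -1 \<le> i \<and> i \<le> int p - 2 \<and> k \<le> l"
  by (auto simp: witt_index_def)

text \<open>Subspaces spanned by basis elements. \<open>H\<close> and the initial segments are of
  this kind, which turns closure under brackets into conditions on indices.\<close>

definition supp :: "(int \<times> nat \<Rightarrow> bool) \<Rightarrow> (int \<times> nat \<Rightarrow> 'k) set" where
  "supp P = {x \<in> V. \<forall>q. x q \<noteq> 0 \<longrightarrow> P q}"

lemma supp_V: "supp P \<subseteq> V"
  by (auto simp: supp_def)

lemma supp_mono: "x \<in> supp P \<Longrightarrow> (\<And>q. q \<in> X \<Longrightarrow> P q \<Longrightarrow> Q q) \<Longrightarrow> x \<in> supp Q"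
  unfolding supp_def mem_witt_space by blast

lemma supp_zero: "(\<lambda>q. 0) \<in> supp P"
  by (simp add: supp_def mem_witt_space)

lemma supp_add: "x \<in> supp P \<Longrightarrow> y \<in> supp P \<Longrightarrow> (\<lambda>q. x q + y q) \<in> supp P"
proof -
  assume xy: "x \<in> supp P" "y \<in> supp P"
  have "x q \<noteq> 0 \<or> y q \<noteq> 0" if "x q + y q \<noteq> 0" for q using that by auto
  then show ?thesis using xy unfolding supp_def by (blast intro: witt_space_add)
qed

lemma supp_scale: "x \<in> supp P \<Longrightarrow> (\<lambda>q. d * x q) \<in> supp P"
  unfolding supp_def by (auto simp: witt_space_scale)

lemma supp_E: "((i, k) \<in> X \<Longrightarrow> P (i, k)) \<Longrightarrow> E i k \<in> supp P"
  unfolding supp_def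
  by (intro CollectI conjI witt_basis_in_space allI impI) (auto simp: witt_basis_def split: if_splits)

text \<open>The factor j - i removes equal degrees and truncation removes index sums outside
  \<open>X\<close>; the later estimates depend on both.\<close>

lemma supp_bracket:
  assumes x: "x \<in> supp P" and y: "y \<in> supp Q"
    and PQ: "\<And>i k j m. \<lbrakk>(i, k) \<in> X; (j, m) \<in> X; P (i, k); Q (j, m); i \<noteq> j; (i + j, k + m) \<in> X\<rbrakk> \<Longrightarrow> S (i + j, k + m)"
  shows "brk x y \<in> supp S"
  unfolding supp_def
proof (intro CollectI conjI allI impI)
  show "brk x y \<in> V" by (rule witt_bracket_in_space)
  fix q assume q: "brk x y q \<noteq> 0"
  show "S q"
  proof (rule ccontr)
    assume S: "\<not> S q"
    have "x (i, k) * y (j, m) * (of_int (j - i) * E (i + j) (k + m) q) = 0"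
      if "(i, k) \<in> X" "(j, m) \<in> X" for i k j m
    proof (rule ccontr)
      assume n: "x (i, k) * y (j, m) * (of_int (j - i) * E (i + j) (k + m) q) \<noteq> 0"
      then have "x (i, k) \<noteq> 0" "y (j, m) \<noteq> 0" "i \<noteq> j" "E (i + j) (k + m) q \<noteq> 0" by auto
      moreover from this have "(i + j, k + m) \<in> X" "q = (i + j, k + m)"
        by (auto simp: witt_basis_def split: if_splits)
      ultimately show False using PQ[OF that] x y S by (auto simp: supp_def)
    qed
    then have "brk x y q = 0"
      unfolding witt_bracket_def by (intro sum.neutral ballI) (auto intro!: sum.neutral)
    then show False using q by simp
  qed
qed

text \<open>Numbers the basis elements \<open>e\<^sub>i t\<^sup>k\<close> by decreasing \<open>i\<close> and then by decreasing \<open>k\<close>, so that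
  every initial segment spans a subalgebra.\<close>

definition rank :: "int \<times> nat \<Rightarrow> nat" where
  "rank q = nat (int p - 2 - fst q) * (l + 1) + (l - snd q)"

lemma rank_less:
  assumes "(i, k) \<in> X" "(i', k') \<in> X"
  shows "rank (i', k') < rank (i, k) \<longleftrightarrow> i < i' \<or> i = i' \<and> k < k'"
proof -
  have less: "rank (i', k') < rank (i, k)" if "i < i'" "(i, k) \<in> X" "(i', k') \<in> X" for i i' k k'
  proof -
    have "nat (int p - 2 - i') + 1 \<le> nat (int p - 2 - i)" using that by (auto simp: mem_X)
    then have "(nat (int p - 2 - i') + 1) * (l + 1) \<le> nat (int p - 2 - i) * (l + 1)"
      by (rule mult_le_mono1)
    then have "nat (int p - 2 - i') * (l + 1) + (l + 1) \<le> nat (int p - 2 - i) * (l + 1)"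
      by (simp only: add_mult_distrib mult_1)
    then show ?thesis unfolding rank_def fst_conv snd_conv by linarith
  qed
  consider "i < i'" | "i' < i" | "i = i'" by linarith
  then show ?thesis
  proof cases
    case 1
    then show ?thesis using less assms by auto
  next
    case 2
    then show ?thesis using less[OF 2 assms(2,1)] by auto
  next
    case 3
    then show ?thesis using assms by (auto simp: rank_def mem_X)
  qed
qed

lemma rank_surj:
  assumes "j < p * (l + 1)"
  obtains i k where "(i, k) \<in> X" "rank (i, k) = j"
proof
  \<comment> \<open>Quotient and remainder of j by l + 1, both reversed because the rank falls as i
    or k grows.\<close>
  let ?i = "int p - 2 - int (j div (l + 1))" and ?k = "l - j mod (l + 1)"
  have "j div (l + 1) < p" using assms by (simp add: less_mult_imp_div_less)
  then show "(?i, ?k) \<in> X" by (auto simp: mem_X)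
  have "j mod (l + 1) \<le> l" using mod_less_divisor[of "l + 1" j] by linarith
  then have "rank (?i, ?k) = j div (l + 1) * (l + 1) + j mod (l + 1)"
    by (simp add: rank_def)
  then show "rank (?i, ?k) = j" by (simp only: div_mult_mod_eq)
qed

abbreviation "C j \<equiv> supp (\<lambda>q. rank q < j)"
text \<open>Ranks below \<open>j0\<close> are those with s \<le> i, so \<open>C j0\<close> is
  \<open>H\<close>, and \<open>C j1\<close> is all of \<open>V\<close>.\<close>

definition "j0 = nat (int p - 1 - s) * (l + 1)"
definition "j1 = p * (l + 1)"
abbreviation "H \<equiv> (witt_filtration p l s :: (int \<times> nat \<Rightarrow> 'k) set)"

lemma sp: "s < int p - 1"
  using s_bounds rp by linarith

lemma rank_j0:
  assumes "(i, k) \<in> X" shows "rank (i, k) < j0 \<longleftrightarrow> s \<le> i"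
proof
  assume "s \<le> i"
  then have "nat (int p - 2 - i) + 1 \<le> nat (int p - 1 - s)" using assms sp by (auto simp: mem_X)
  then have "(nat (int p - 2 - i) + 1) * (l + 1) \<le> j0"
    unfolding j0_def by (rule mult_le_mono1)
  then show "rank (i, k) < j0" by (simp add: rank_def)
next
  assume less: "rank (i, k) < j0"
  show "s \<le> i"
  proof (rule ccontr)
    assume "\<not> s \<le> i"
    then have "nat (int p - 1 - s) \<le> nat (int p - 2 - i)" by simp
    then have "j0 \<le> nat (int p - 2 - i) * (l + 1)" unfolding j0_def by (rule mult_le_mono1)
    then show False using less by (simp add: rank_def)
  qed
qed

lemma rank_j1:
  assumes "(i, k) \<in> X" shows "rank (i, k) < j1"
proof -
  have "nat (int p - 2 - i) + 1 \<le> p" using assms by (auto simp: mem_X)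
  then have "(nat (int p - 2 - i) + 1) * (l + 1) \<le> j1"
    unfolding j1_def by (rule mult_le_mono1)
  then show "rank (i, k) < j1" by (simp add: rank_def)
qed

text \<open>The generators to adjoin have s + 1 degrees, from -1 to s - 1, each with l + 1 powers of
  t. This count is the exponent of the dimension.\<close>

lemma j01: "j0 \<le> j1" "j1 - j0 = nat ((int l + 1) * (s + 1))"
proof -
  have le: "nat (int p - 1 - s) \<le> p" using s_bounds by linarith
  then show "j0 \<le> j1" unfolding j0_def j1_def by (rule mult_le_mono1)
  have "p - nat (int p - 1 - s) = nat (s + 1)" using sp s_bounds by linarith
  then have "j1 - j0 = nat (s + 1) * (l + 1)"
    unfolding j0_def j1_def by (metis diff_mult_distrib)
  also have "\<dots> = nat ((int l + 1) * (s + 1))"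
    using s_bounds by (simp add: nat_mult_distrib nat_add_distrib mult.commute)
  finally show "j1 - j0 = nat ((int l + 1) * (s + 1))" .
qed

lemma H_supp: "H = C j0"
proof -
  have "H = {x \<in> V. \<forall>j k. j < s \<longrightarrow> x (j, k) = 0}"
    by (simp add: witt_filtration_def witt_sel)
  also have "\<dots> = C j0"
    unfolding supp_def
  proof (intro Collect_cong conj_cong refl)
    fix x :: "int \<times> nat \<Rightarrow> 'k" assume "x \<in> V"
    then have "q \<in> X" if "x q \<noteq> 0" for q using that unfolding mem_witt_space by blast
    then have "x (i, k) \<noteq> 0 \<Longrightarrow> rank (i, k) < j0 \<longleftrightarrow> \<not> i < s" for i k using rank_j0[of i k] by auto
    then show "(\<forall>j k. j < s \<longrightarrow> x (j, k) = 0) \<longleftrightarrow> (\<forall>q. x q \<noteq> 0 \<longrightarrow> rank q < j0)"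
      by (auto simp only: split_paired_all)
  qed
  finally show ?thesis .
qed

lemma C_V: "C j1 = V"
  unfolding supp_def using rank_j1 by (fastforce simp: mem_witt_space)

lemma C_mono: "i \<le> j \<Longrightarrow> C i \<subseteq> C j"
  using supp_mono by fastforce

lemma C_0: "C 0 = {\<lambda>q. 0}"
  using supp_zero by (auto simp: supp_def)

lemma C_Suc:
  assumes w: "w \<in> C (Suc j)" and ik: "(i, k) \<in> X" "rank (i, k) = j"
  obtains w' where "w' \<in> C j" "w = (\<lambda>q. w' q + w (i, k) * E i k q)"
proof
  let ?w' = "\<lambda>q. if q = (i, k) then 0 else w q"
  have *: "q = (i, k)" if q: "q \<in> X" "rank q = j" for q
  proof (cases q)
    case (Pair a b)
    then show ?thesis
      using rank_less[of i k a b] rank_less[of a b i k] q ik by (auto simp: not_less)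
  qed
  show "?w' \<in> C j"
    unfolding supp_def mem_witt_space
  proof (intro CollectI conjI allI impI)
    fix q assume n: "?w' q \<noteq> 0"
    then have q: "q \<noteq> (i, k)" "w q \<noteq> 0" by (auto split: if_splits)
    then have "q \<in> X" "rank q < Suc j"
      using w unfolding supp_def mem_witt_space by blast+
    then show "rank q < j" using *[of q] q by (auto simp: less_Suc_eq)
  qed (use w in \<open>auto simp: supp_def mem_witt_space\<close>)
  show "w = (\<lambda>q. ?w' q + w (i, k) * E i k q)"
    using ik by (auto simp: witt_basis_def)
qed

lemma \<chi>_height:
  assumes "x \<in> supp (\<lambda>q. r \<le> fst q)"
  shows "\<chi> x = 0"
proof -
  let ?P = "\<lambda>i. -1 \<le> i \<and> (\<forall>x \<in> witt_filtration p l i. \<chi> x = 0)"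
  have z: "\<chi> (\<lambda>q. 0) = 0" using \<chi>_scale[of "\<lambda>q. 0" 0] supp_V supp_zero by auto
  have "x = (\<lambda>q. 0)" if "x \<in> witt_filtration p l (int p)" for x :: "int \<times> nat \<Rightarrow> 'k"
  proof
    fix q show "x q = 0"
      using that by (cases q, cases "q \<in> X") (auto simp: witt_filtration_def witt_sel mem_witt_space mem_X)
  qed
  then have "?P (int p)" using z by auto
  \<comment> \<open>The minimum over integers i \<ge> -1 is taken over naturals n = i + 1; the
    filtration is zero from degree p on, so it exists.\<close>
  then have ex: "\<exists>n. ?P (int n - 1)" by (intro exI[of _ "p + 1"]) simp
  define n where "n = (LEAST n. ?P (int n - 1))"
  have Pn: "?P (int n - 1)" unfolding n_def by (rule LeastI_ex[OF ex])
  have "int n - 1 \<le> i" if "?P i" for i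
  proof -
    have "?P (int (nat (i + 1)) - 1)" using that by simp
    then have "n \<le> nat (i + 1)" unfolding n_def by (rule Least_le)
    then show ?thesis using that by linarith
  qed
  then have "r = int n - 1"
    unfolding r_height witt_height_def using Pn by (intro Least_equality)
  then have "\<forall>x \<in> witt_filtration p l r. \<chi> x = 0" using Pn by blast
  moreover have "x \<in> witt_filtration p l r"
    using assms unfolding supp_def witt_filtration_def witt_sel by force
  ultimately show ?thesis by blast
qed

lemma C_H: "j \<le> j0 \<Longrightarrow> C j \<subseteq> supp (\<lambda>q. s \<le> fst q)"
  using rank_j0 by (intro subsetI) (erule supp_mono, force)

text \<open>Distinct degrees at least s add up to at least 2s + 1 \<ge> r.\<close>

lemma \<chi>_bracket_H:
  assumes "x \<in> supp (\<lambda>q. s \<le> fst q)" "y \<in> supp (\<lambda>q. s \<le> fst q)"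
  shows "\<chi> (brk x y) = 0"
  by (intro \<chi>_height supp_bracket[OF assms]) (use s_bounds in auto)

lemma of_int_nonzero:
  assumes "j \<noteq> 0" "\<bar>j\<bar> < int p" shows "of_int j \<noteq> (0 :: 'k)"
proof -
  have "nat \<bar>j\<bar> < p" "0 < nat \<bar>j\<bar>" using assms by auto
  then have "of_nat (nat \<bar>j\<bar>) \<noteq> (0 :: 'k)"
    using of_nat_eq_0_iff_char_dvd[where ?'a = 'k, of "nat \<bar>j\<bar>"] char by (metis dvd_imp_le not_le)
  then show ?thesis by (cases "0 \<le> j") (auto simp: abs_if of_nat_nat)
qed

end

section \<open>Eigenvectors of the subalgebra\<close>

locale witt_ideal = witt_leading p l ty \<chi> r s
  for p l :: nat and ty :: "'k::alg_closed_field itself" and \<chi> :: "(int \<times> nat \<Rightarrow> 'k) \<Rightarrow> 'k"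
    and r s :: int +
  fixes K :: "('k, int \<times> nat \<Rightarrow> 'k) free_alg set"
  assumes K_left: "alg_left_ideal V K" and J_K: "JJ \<subseteq> K"
begin

lemma K_FF: "K \<subseteq> FF" and K_zero: "0 \<in> K"
  and K_add: "\<lbrakk>f \<in> K; g \<in> K\<rbrakk> \<Longrightarrow> f + g \<in> K" and K_mult: "\<lbrakk>f \<in> FF; g \<in> K\<rbrakk> \<Longrightarrow> f * g \<in> K"
  using K_left by (auto simp: alg_left_ideal_def)

lemma J_mult: "\<lbrakk>g \<in> JJ; f \<in> FF\<rbrakk> \<Longrightarrow> g * f \<in> K"
  using LC.J_closed(4)[unfolded W_carrier] J_K by blast

lemma J_relations:
  assumes "x \<in> V"
  shows "y \<in> V \<Longrightarrow> gen (\<lambda>q. x q + y q) - gen x - gen y \<in> JJ"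
    "gen (\<lambda>q. d * x q) - scal d * gen x \<in> JJ"
    "y \<in> V \<Longrightarrow> gen x * gen y - gen y * gen x - gen (brk x y) \<in> JJ"
    "gen x ^ p - gen (pmap x) - scal (\<chi> x) ^ p \<in> JJ"
  using LC.red_relations_J assms
  unfolding red_relations_def W_carrier by (auto simp: witt_sel char)

lemma gen_zero_J: "gen (\<lambda>q. 0) \<in> JJ"
  using J_relations(2)[of "\<lambda>q. 0" 0] supp_V supp_zero by auto

definition \<delta> where "\<delta> x = gen x - scal (\<chi> x)"

lemma \<delta>_FF: "x \<in> V \<Longrightarrow> \<delta> x \<in> FF"
  by (simp add: \<delta>_def)

lemma \<delta>_combine:
  assumes "x \<in> V" "y \<in> V"
  shows "\<delta> (\<lambda>q. x q + d * y q) - \<delta> x - scal d * \<delta> y \<in> JJ"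
proof -
  have dy: "(\<lambda>q. d * y q) \<in> V" by (rule witt_space_scale[OF assms(2)])
  have "\<delta> (\<lambda>q. x q + d * y q) - \<delta> x - scal d * \<delta> y =
      (gen (\<lambda>q. x q + d * y q) - gen x - gen (\<lambda>q. d * y q)) + (gen (\<lambda>q. d * y q) - scal d * gen y)"
    using \<chi>_add[OF assms(1) dy] \<chi>_scale[OF assms(2)] by (simp add: \<delta>_def algebra_simps)
  then show ?thesis
    using LC.J_closed(2)[OF J_relations(1)[OF assms(1) dy] J_relations(2)[OF assms(2), of d]]
    by (simp only:)
qed

lemma \<delta>_bracket:
  assumes "x \<in> V" "y \<in> V" "\<chi> (brk x y) = 0"
  shows "\<delta> x * \<delta> y - \<delta> y * \<delta> x - \<delta> (brk x y) \<in> JJ"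
  using J_relations(3)[OF assms(1,2)]
  by (simp add: \<delta>_def assms(3) algebra_simps scal_commute[of _ "gen _"] scal_commute[of "\<chi> x" "scal _"])

lemma of_nat_p_free: "of_nat p = (0 :: ('k, int \<times> nat \<Rightarrow> 'k) free_alg)"
  by (metis of_nat_p scal_simps(1,8))

lemma of_nat_inverse_free:
  assumes "0 < i" "i < p"
  shows "\<exists>a. scal a * of_nat i = (1 :: ('k, int \<times> nat \<Rightarrow> 'k) free_alg)"
proof -
  have "of_int (int i) \<noteq> (0 :: 'k)" using assms by (intro of_int_nonzero) auto
  then have "scal (inverse (of_nat i) * of_nat i :: 'k) = (1 :: ('k, int \<times> nat \<Rightarrow> 'k) free_alg)"
    by simp
  then show ?thesis by (metis scal_simps(6,8))
qed

text \<open>Subtracting \<chi>(x) cancels the p-character, p being odd. For basis elements of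
  nonzero degree the p-map vanishes, so \<delta> of them is nilpotent modulo
  \<open>JJ\<close>.\<close>

lemma \<delta>_power:
  assumes "x \<in> V"
  shows "\<delta> x ^ p - gen (pmap x) \<in> JJ"
proof -
  have "odd p" using prime_odd_nat[OF prime_p] p3 by simp
  have "\<delta> x ^ p = (gen x + - scal (\<chi> x)) ^ p" by (simp add: \<delta>_def)
  also have "\<dots> = gen x ^ p + (- scal (\<chi> x)) ^ p"
    using of_nat_inverse_free scal_commute[of "\<chi> x" "gen x"]
    by (intro add_power_prime_commute prime_p of_nat_p_free) auto
  also have "\<dots> = gen x ^ p - scal (\<chi> x) ^ p" using \<open>odd p\<close> by simp
  finally show ?thesis using J_relations(4)[OF assms] by (simp only: diff_diff_eq add.commute)
qed

lemma pmap_basis_zero: "(i, k) \<in> X \<Longrightarrow> i \<noteq> 0 \<Longrightarrow> pmap (E i k) = (\<lambda>q. 0)"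
  using witt_p_map_basis by simp

text \<open>Engel's argument, one basis element of \<open>H\<close> at a time: \<open>\<delta> x\<close> is nilpotent and preserves the
  common kernel of the preceding ones.\<close>

lemma common_eigenvector:
  assumes one: "1 \<notin> K" and j: "j \<le> j0"
  shows "\<exists>u\<in>FF - K. \<forall>h\<in>C j. \<delta> h * u \<in> K"
  using j
proof (induction j)
  case 0
  have "\<chi> (\<lambda>q. 0) = 0" using \<chi>_scale[of "\<lambda>q. 0" 0] supp_V supp_zero by auto
  then have "\<delta> (\<lambda>q. 0) * 1 \<in> K" using gen_zero_J J_K by (auto simp: \<delta>_def)
  then show ?case using one unfolding C_0 by (intro bexI[of _ 1]) auto
next
  case (Suc j)
  then obtain u where u: "u \<in> FF - K" "\<forall>h\<in>C j. \<delta> h * u \<in> K" by auto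
  have "j0 \<le> j1" by (rule j01)
  then have "j < j1" using Suc.prems by simp
  then obtain i k where ik: "(i, k) \<in> X" "rank (i, k) = j" using rank_surj by (auto simp: j1_def)
  have si: "s \<le> i" using rank_j0[OF ik(1)] ik Suc.prems by simp
  define x where "x = E i k"
  have xV: "x \<in> V" by (simp add: x_def witt_basis_in_space)
  have xH: "x \<in> supp (\<lambda>q. s \<le> fst q)" unfolding x_def using si by (intro supp_E) simp
  define P where "P f \<longleftrightarrow> f \<in> FF \<and> (\<forall>h\<in>C j. \<delta> h * f \<in> K)" for f
  have P_step: "P (\<delta> x * f)" if f: "P f" for f
    unfolding P_def
  proof (intro conjI ballI)
    show "\<delta> x * f \<in> FF" using f \<delta>_FF[OF xV] by (simp add: P_def)
    fix h assume h: "h \<in> C j"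
    have hV: "h \<in> V" using h supp_V by blast
    have hH: "h \<in> supp (\<lambda>q. s \<le> fst q)" using C_H[of j] h Suc.prems by auto
    \<comment> \<open>Elements of \<open>C j\<close> also have degree at least s \<ge> 1 here, so
      the bracket has degree above i and smaller rank than x.\<close>
    have br: "brk h x \<in> C j"
      by (rule supp_bracket[OF h, of x "\<lambda>q. q = (i, k)"])
        (use ik si s_bounds rank_less in \<open>auto simp: x_def intro!: supp_E\<close>)
    have "(\<delta> h * \<delta> x - \<delta> x * \<delta> h - \<delta> (brk h x)) * f \<in> K"
      using f by (intro J_mult \<delta>_bracket hV xV \<chi>_bracket_H hH xH) (simp add: P_def)
    moreover have "\<delta> x * (\<delta> h * f) \<in> K" "\<delta> (brk h x) * f \<in> K"
      using f h br \<delta>_FF[OF xV] K_mult by (auto simp: P_def)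
    ultimately have "(\<delta> h * \<delta> x - \<delta> x * \<delta> h - \<delta> (brk h x)) * f + (\<delta> x * (\<delta> h * f) + \<delta> (brk h x) * f) \<in> K"
      using K_add by blast
    then show "\<delta> h * (\<delta> x * f) \<in> K" by (simp add: algebra_simps)
  qed
  have P_pow: "P (\<delta> x ^ n * u)" for n
    by (induction n) (use u P_step in \<open>auto simp: P_def mult.assoc\<close>)
  have "\<delta> x ^ p \<in> JJ"
  proof -
    have "pmap x = (\<lambda>q. 0)" using pmap_basis_zero[OF ik(1)] si s_bounds by (simp add: x_def)
    then have "(\<delta> x ^ p - gen (pmap x)) + gen (pmap x) \<in> JJ"
      using \<delta>_power[OF xV] gen_zero_J LC.J_closed(2) by metis
    then show ?thesis by simp
  qed
  then have ex: "\<exists>n. \<delta> x ^ n * u \<in> K" using J_mult u by blast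
  \<comment> \<open>The power just below the least one that lands in \<open>K\<close> provides the
    new eigenvector.\<close>
  define n where "n = (LEAST n. \<delta> x ^ n * u \<in> K)"
  have n: "\<delta> x ^ n * u \<in> K" unfolding n_def by (rule LeastI_ex[OF ex])
  have "n \<noteq> 0" using n u by (cases n) auto
  then obtain m where m: "n = Suc m" by (cases n) auto
  define v where "v = \<delta> x ^ m * u"
  have vK: "v \<notin> K" unfolding v_def using not_less_Least[of m "\<lambda>n. \<delta> x ^ n * u \<in> K"] m n_def by auto
  have vP: "P v" unfolding v_def by (rule P_pow)
  have xv: "\<delta> x * v \<in> K" using n by (simp add: v_def m mult.assoc)
  have "\<delta> w * v \<in> K" if w: "w \<in> C (Suc j)" for w
  proof -
    obtain w' where w': "w' \<in> C j" "w = (\<lambda>q. w' q + w (i, k) * E i k q)"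
      using C_Suc[OF w ik] by blast
    have "(\<delta> w - \<delta> w' - scal (w (i, k)) * \<delta> x) * v \<in> K"
      using \<delta>_combine[of w' x "w (i, k)"] w' supp_V xV vP
      by (intro J_mult) (auto simp: P_def x_def simp flip: w'(2))
    moreover have "\<delta> w' * v \<in> K" "scal (w (i, k)) * (\<delta> x * v) \<in> K"
      using vP w' xv K_mult by (auto simp: P_def)
    ultimately have "(\<delta> w - \<delta> w' - scal (w (i, k)) * \<delta> x) * v + (\<delta> w' * v + scal (w (i, k)) * (\<delta> x * v)) \<in> K"
      using K_add by blast
    then show ?thesis by (simp add: algebra_simps)
  qed
  then show ?case using vK vP by (intro bexI[of _ v]) (auto simp: P_def)
qed

text \<open>The set is the annihilator of the class of u in \<open>FF / K\<close>; multiplying by u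
  makes the eigenvector the generator.\<close>

lemma eigen_ideal_exists:
  assumes "1 \<notin> K"
  obtains u where "u \<in> FF" "eigen_ideal W H \<chi> {f \<in> FF. f * u \<in> K}"
proof -
  obtain u where u: "u \<in> FF" "u \<notin> K" "\<forall>h\<in>H. \<delta> h * u \<in> K"
    using common_eigenvector[OF assms order_refl] unfolding H_supp by blast
  have HV: "H \<subseteq> V" unfolding H_supp by (rule supp_V)
  have "alg_left_ideal V {f \<in> FF. f * u \<in> K}"
    unfolding alg_left_ideal_def using K_zero K_add K_mult by (auto simp: distrib_right mult.assoc)
  moreover have "JJ \<subseteq> {f \<in> FF. f * u \<in> K}"
    using J_mult u LC.J_subset W_carrier by auto
  ultimately have "eigen_ideal W H \<chi> {f \<in> FF. f * u \<in> K}"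
    unfolding eigen_ideal_def W_carrier using u HV by (auto simp: \<delta>_def)
  then show thesis using that u by blast
qed

end

lemma sum_lessThan_mult:
  fixes f :: "nat \<Rightarrow> 'a::comm_monoid_add"
  shows "(\<Sum>i<n * m. f i) = (\<Sum>a<n. \<Sum>i<m. f (a * m + i))"
proof -
  have "sum f {a * m..<a * m + m} = (\<Sum>i<m. f (a * m + i))" for a
    using sum.shift_bounds_nat_ivl[of f 0 "a * m" m]
    by (simp add: add.commute lessThan_atLeast0)
  then show ?thesis using sum.nat_group[of f m n] by simp
qed

section \<open>The chain from the subalgebra to the whole algebra\<close>

locale witt_eigen = witt_leading p l ty \<chi> r s
  for p l :: nat and ty :: "'k::alg_closed_field itself" and \<chi> :: "(int \<times> nat \<Rightarrow> 'k) \<Rightarrow> 'k"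
    and r s :: int +
  fixes K :: "('k, int \<times> nat \<Rightarrow> 'k) free_alg set"
  assumes eigen: "eigen_ideal W H \<chi> K"
begin

sublocale witt_ideal p l ty \<chi> r s K
  by unfold_locales (use eigen in \<open>auto simp: eigen_ideal_def W_carrier\<close>)

lemma one_K: "1 \<notin> K" and \<delta>_K: "h \<in> C j0 \<Longrightarrow> \<delta> h \<in> K"
  using eigen by (auto simp: eigen_ideal_def H_supp \<delta>_def)

text \<open>Modulo \<open>K\<close>, what the algebra generated by \<open>C j\<close> makes of the
  cyclic generator. At \<open>j0\<close> this is the line of scalars, at \<open>j1\<close> the whole
  module.\<close>

definition N where "N j = {f + g |f g. f \<in> free_on (C j) \<and> g \<in> K}"

lemma C_FF: "free_on (C j) \<subseteq> FF"
  by (rule free_on_mono[OF supp_V])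

lemma free_N: "f \<in> free_on (C j) \<Longrightarrow> f \<in> N j"
  using K_zero unfolding N_def by force

lemma N_closed:
  "K \<subseteq> N j" "N j \<subseteq> FF" "1 \<in> N j"
  "\<lbrakk>u \<in> N j; v \<in> N j\<rbrakk> \<Longrightarrow> u + v \<in> N j" "u \<in> N j \<Longrightarrow> scal d * u \<in> N j"
  "\<lbrakk>w \<in> C j; u \<in> N j\<rbrakk> \<Longrightarrow> gen w * u \<in> N j"
proof -
  show "K \<subseteq> N j" unfolding N_def by force
  show "N j \<subseteq> FF" unfolding N_def using C_FF K_FF by auto
  show "1 \<in> N j" by (rule free_N) simp
next
  assume "u \<in> N j" "v \<in> N j"
  then obtain f g f' g' where "u = f + g" "v = f' + g'" "f \<in> free_on (C j)" "f' \<in> free_on (C j)" "g \<in> K" "g' \<in> K"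
    by (auto simp: N_def)
  then have "u + v = (f + f') + (g + g')" "f + f' \<in> free_on (C j)" "g + g' \<in> K"
    using K_add by auto
  then show "u + v \<in> N j" unfolding N_def by blast
next
  assume "u \<in> N j"
  then obtain f g where u: "u = f + g" "f \<in> free_on (C j)" "g \<in> K" by (auto simp: N_def)
  then have "scal d * u = scal d * f + scal d * g" "scal d * f \<in> free_on (C j)" "scal d * g \<in> K"
    using u K_mult by (auto simp: distrib_left)
  then show "scal d * u \<in> N j" unfolding N_def by blast
  assume "w \<in> C j"
  then have "gen w * u = gen w * f + gen w * g" "gen w * f \<in> free_on (C j)" "gen w * g \<in> K"
    using u K_mult[of "gen w" g] subsetD[OF supp_V, of w] by (auto simp: distrib_left)
  then show "gen w * u \<in> N j" unfolding N_def by blast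
qed

lemma N_j1: "N j1 = FF"
  using N_closed(2) free_N[of _ j1] by (auto simp: C_V)

lemma N_mono: "N j \<subseteq> N (Suc j)"
  unfolding N_def using free_on_mono[OF C_mono[of j "Suc j"]] by auto

lemma N_j0: "u \<in> N j0 \<Longrightarrow> \<exists>d. u - scal d \<in> K"
proof -
  assume "u \<in> N j0"
  then obtain f g where u: "u = f + g" "f \<in> free_on H" "g \<in> K" by (auto simp: N_def H_supp)
  have "H \<subseteq> carrier W" using supp_V by (simp add: H_supp W_carrier)
  then have "f - scal (free_eval \<chi> f) \<in> K" by (rule eigen_ideal_eval[OF eigen _ u(2)])
  then have "(f - scal (free_eval \<chi> f)) + g \<in> K" using u K_add by blast
  then show ?thesis using u by (intro exI[of _ "free_eval \<chi> f"]) (simp add: algebra_simps)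
qed

text \<open>The coefficient i - (r - 1 - i) is at most -1 by i < s, and at least -(r + 1), which
  exceeds -p by r < p - 1.\<close>

lemma bracket_top:
  assumes ik: "(i, k) \<in> X" "i < s"
  shows "brk (E (r - 1 - i) (l - k)) (E i k) = (\<lambda>q. of_int (2 * i - r + 1) * E (r - 1) l q)"
    "of_int (2 * i - r + 1) \<noteq> (0 :: 'k)"
proof -
  have y: "(r - 1 - i, l - k) \<in> X" using ik r1 rp s_bounds by (auto simp: mem_X)
  have "l - k + k = l" using ik by (simp add: mem_X)
  then show "brk (E (r - 1 - i) (l - k)) (E i k) = (\<lambda>q. of_int (2 * i - r + 1) * E (r - 1) l q)"
    unfolding witt_bracket_basis[OF y ik(1)] by (simp add: algebra_simps)
  show "of_int (2 * i - r + 1) \<noteq> (0 :: 'k)"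
    by (rule of_int_nonzero) (use ik r1 rp s_bounds in \<open>auto simp: mem_X\<close>)
qed

text \<open>Pushing the partner y to the right through a word in \<open>C j\<close> creates only
  brackets in \<open>A\<close>, where \<chi> vanishes. These brackets must be pushed further, so the
  induction treats all of \<open>Q\<close> at once.\<close>

lemma dual_element_acts:
  assumes ik: "(i, k) \<in> X" "rank (i, k) = j" "i < s" and n: "n \<in> N j"
  shows "\<delta> (E (r - 1 - i) (l - k)) * n \<in> K"
proof -
  \<comment> \<open>The bound on the power of t handles i = -1: a bracket with another element of
    degree -1 would lower the degree below r, but that element has k' > k, so the power of t exceeds
    l and the bracket is zero.\<close>
  define A where "A = supp (\<lambda>q. r \<le> fst q \<and> l - k \<le> snd q)"
  define Q where "Q = supp (\<lambda>q. r \<le> fst q \<and> l - k \<le> snd q \<or> q = (r - 1 - i, l - k))"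
  have AQ: "A \<subseteq> Q" unfolding A_def Q_def by (auto elim: supp_mono)
  have QV: "Q \<subseteq> V" unfolding Q_def by (rule supp_V)
  have QH: "Q \<subseteq> C j0"
    unfolding Q_def using ik s_bounds rank_j0 by (intro subsetI) (erule supp_mono, force)
  have A0: "\<chi> q = 0" if "q \<in> A" for q
    using that unfolding A_def by (intro \<chi>_height) (auto elim: supp_mono)
  have br: "brk q h \<in> A" if q: "q \<in> Q" and h: "h \<in> C j" for q h
    unfolding A_def
  proof (rule supp_bracket[OF q[unfolded Q_def] h])
    fix a b i' k'
    assume ab: "(a, b) \<in> X" and i': "(i', k') \<in> X"
      and Q: "r \<le> fst (a, b) \<and> l - k \<le> snd (a, b) \<or> (a, b) = (r - 1 - i, l - k)"
      and less: "rank (i', k') < j" and sum: "(a + i', b + k') \<in> X"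
    have "i < i' \<or> i = i' \<and> k < k'" using less rank_less[OF ik(1) i'] ik by simp
    then show "r \<le> fst (a + i', b + k') \<and> l - k \<le> snd (a + i', b + k')"
      using Q ab i' sum ik by (auto simp: mem_X)
  qed
  have free: "\<forall>q\<in>Q. \<delta> q * f \<in> K" if "f \<in> free_on (C j)" for f
    using that
  proof (induction f rule: free_on_induct)
    case (add f g)
    then show ?case using K_add by (auto simp: distrib_left)
  next
    case (scale d f)
    then show ?case using K_mult[of "scal d"] by (auto simp: scal_assoc_commute)
  next
    case one
    then show ?case using \<delta>_K QH by auto
  next
    case (gen h f)
    show ?case
    proof
      fix q assume q: "q \<in> Q"
      have V: "q \<in> V" "h \<in> V" using q QV gen supp_V by auto
      have fF: "f \<in> FF" using gen C_FF by blast
      have "gen q * gen h - gen h * gen q - gen (brk q h) \<in> JJ" by (rule J_relations(3)[OF V])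
      moreover have "gen q * gen h - gen h * gen q = \<delta> q * gen h - gen h * \<delta> q"
        using scal_commute[of "\<chi> q" "gen h"] by (simp add: \<delta>_def algebra_simps)
      ultimately have "(\<delta> q * gen h - gen h * \<delta> q - gen (brk q h)) * f \<in> K"
        using J_mult fF by simp
      moreover have "gen (brk q h) * f \<in> K"
        using gen(3) br[OF q gen(1)] AQ A0[OF br[OF q gen(1)]] by (force simp: \<delta>_def)
      moreover have "gen h * (\<delta> q * f) \<in> K" using gen(3) q K_mult V by auto
      ultimately have "(\<delta> q * gen h - gen h * \<delta> q - gen (brk q h)) * f + (gen (brk q h) * f + gen h * (\<delta> q * f)) \<in> K"
        using K_add by blast
      then show "\<delta> q * (gen h * f) \<in> K" by (simp add: algebra_simps)
    qed
  qed
  obtain f g where fg: "n = f + g" "f \<in> free_on (C j)" "g \<in> K" using n by (auto simp: N_def)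
  have y: "E (r - 1 - i) (l - k) \<in> Q" unfolding Q_def by (rule supp_E) simp
  then show ?thesis
    using free[OF fg(2)] fg K_mult[OF \<delta>_FF fg(3)] QV K_add by (auto simp: distrib_left)
qed

lemma top_invertible:
  obtains z' where "z' \<in> FF" "z' * gen (E (r - 1) l) - 1 \<in> JJ"
proof
  define e where "e = E (r - 1) l"
  define t where "t = inverse (\<chi> e ^ p)"
  have top: "(r - 1, l) \<in> X" using r1 rp by (simp add: mem_X)
  have eV: "e \<in> V" unfolding e_def by (rule witt_basis_in_space)
  have "pmap e = (\<lambda>q. 0)" unfolding e_def using pmap_basis_zero[OF top] r1 by simp
  then have "(gen e ^ p - gen (pmap e) - scal (\<chi> e) ^ p) + gen (pmap e) \<in> JJ"
    using J_relations(4)[OF eV] gen_zero_J LC.J_closed(2) by metis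
  then have "gen e ^ p - scal (\<chi> e) ^ p \<in> JJ" by (simp add: algebra_simps)
  then have J: "scal t * (gen e ^ p - scal (\<chi> e) ^ p) \<in> JJ"
    using LC.J_closed(3)[unfolded W_carrier] by simp
  have t1: "scal t * scal (\<chi> e) ^ p = 1"
  proof -
    have "t * \<chi> e ^ p = 1" using \<chi>_top by (simp add: t_def e_def)
    then show ?thesis by (metis scal_simps(2,6,7))
  qed
  have "gen e ^ (p - 1) * gen e = (gen e ^ p :: ('k, int \<times> nat \<Rightarrow> 'k) free_alg)"
    using p0 by (metis Suc_diff_1 power_Suc2)
  then have "scal t * gen e ^ (p - 1) * gen e - 1 = scal t * (gen e ^ p - scal (\<chi> e) ^ p)"
    by (simp only: right_diff_distrib mult.assoc t1)
  then show "scal t * gen e ^ (p - 1) * gen (E (r - 1) l) - 1 \<in> JJ"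
    using J by (simp only: e_def)
  show "scal t * gen e ^ (p - 1) \<in> FF" using eV by simp
qed

lemma gen_C_Suc:
  assumes w: "w \<in> C (Suc j)" and ik: "(i, k) \<in> X" "rank (i, k) = j"
  obtains w' d where "w' \<in> C j" "gen w - gen w' - scal d * gen (E i k) \<in> JJ"
proof -
  obtain w' where w': "w' \<in> C j" "w = (\<lambda>q. w' q + w (i, k) * E i k q)" using C_Suc[OF w ik] .
  define d where "d = w (i, k)"
  have V: "w' \<in> V" "E i k \<in> V" using w' supp_V witt_basis_in_space by blast+
  have w: "w = (\<lambda>q. w' q + d * E i k q)" using w'(2) by (simp add: d_def)
  have "gen w - gen w' - scal d * gen (E i k) =
      (gen w - gen w' - gen (\<lambda>q. d * E i k q)) + (gen (\<lambda>q. d * E i k q) - scal d * gen (E i k))"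
    by simp
  then show thesis
    using that[OF w'(1), of d] LC.J_closed(2)[OF J_relations(1)[OF V(1) witt_space_scale[OF V(2)], of d] J_relations(2)[OF V(2), of d]]
    by (simp only: w)
qed

lemma adjoin_step:
  assumes j: "j0 \<le> j" "j < j1" and ik: "(i, k) \<in> X" "rank (i, k) = j"
  obtains y z c z' where "adjoin FF K (N j) (gen ` C j) (range scal) (gen (E i k)) y z c z' p"
proof -
  have si: "i < s" using rank_j0[OF ik(1)] ik j by simp
  define x where "x = E i k"
  define y where "y = E (r - 1 - i) (l - k)"
  define m where "m = (of_int (2 * i - r + 1) :: 'k)"
  define e where "e = E (r - 1) l"
  define z where "z = brk y x"
  have z: "z = (\<lambda>q. m * e q)" and m: "m \<noteq> 0"
    unfolding z_def y_def x_def m_def e_def by (rule bracket_top[OF ik(1) si])+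
  have V: "x \<in> V" "y \<in> V" "z \<in> V" "e \<in> V"
    unfolding x_def y_def z_def e_def by (rule witt_basis_in_space witt_bracket_in_space)+
  obtain e' where e': "e' \<in> FF" "e' * gen e - 1 \<in> JJ" unfolding e_def by (rule top_invertible)
  define z' where "z' = scal (inverse m) * e'"
  have rank_gt: "rank (a, b) < j" if "(a, b) \<in> X" "i < a" for a b
    using rank_less[OF ik(1) that(1)] that ik by simp
  have eC: "e \<in> C j" unfolding e_def using si s_bounds r1 by (intro supp_E rank_gt) auto
  have rank_le: "rank (a, b) < Suc j" if "(a, b) \<in> X" "i < a \<or> i = a \<and> k \<le> b" for a b
  proof (cases "i = a \<and> k = b")
    case False
    then have "i < a \<or> i = a \<and> k < b" using that by auto
    then show ?thesis using rank_less[OF ik(1) that(1)] ik by simp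
  qed (use ik in auto)
  have xx: "x \<in> supp (\<lambda>q. q = (i, k))" unfolding x_def by (rule supp_E) simp
  have "adjoin FF K (N j) (gen ` C j) (range scal) (gen x) (gen y) (gen z) (scal (\<chi> y)) z' p"
  proof
    fix w :: "('k, int \<times> nat \<Rightarrow> 'k) free_alg" assume "w \<in> gen ` C j"
    then obtain h where h: "h \<in> C j" "w = gen h" by auto
    have hV: "h \<in> V" using h supp_V by blast
    \<comment> \<open>A contributing degree a exceeds i \<ge> -1, so a \<ge> 0 and the degree does
      not drop. For i = -1 and a = 0 it stays equal, and h of degree 0 can reproduce x itself: hence
      \<open>Suc j\<close> and the term d x.\<close>
    have "brk h x \<in> C (Suc j)"
    proof (rule supp_bracket[OF h(1) xx])
      fix a b i' k'
      assume *: "(a, b) \<in> X" "rank (a, b) < j" "(i', k') = (i, k)" "a \<noteq> i'" "(a + i', b + k') \<in> X"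
      then have "i < a" using rank_less[OF ik(1), of a b] ik by auto
      then show "rank (a + i', b + k') < Suc j"
        using * ik by (intro rank_le) (auto simp: mem_X)
    qed
    then obtain w' d where w': "w' \<in> C j" "gen (brk h x) - gen w' - scal d * gen x \<in> JJ"
      using gen_C_Suc ik unfolding x_def by blast
    have "gen h * gen x - gen x * gen h - gen w' - scal d * gen x =
        (gen h * gen x - gen x * gen h - gen (brk h x)) + (gen (brk h x) - gen w' - scal d * gen x)"
      by simp
    then have "w * gen x - gen x * w - gen w' - scal d * gen x \<in> JJ"
      using LC.J_closed(2)[OF J_relations(3)[OF hV V(1)] w'(2)] by (simp only: h)
    then show "\<exists>w'\<in>gen ` C j. \<exists>d\<in>range scal. \<forall>f\<in>FF. (w * gen x - gen x * w - w' - d * gen x) * f \<in> K"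
      using w'(1) J_mult by blast
  next
    \<comment> \<open>The p-map fixes \<open>E 0 0\<close>, so x can reappear here as well; this is
      the term d' x of the power relation.\<close>
    have "pmap x \<in> C (Suc j)"
    proof (cases "i = 0")
      case True
      then have "pmap x = E 0 (k * p)" using witt_p_map_basis[OF ik(1)] by (simp add: x_def)
      moreover have "E 0 (k * p) \<in> C (Suc j)"
        using True p0 by (intro supp_E rank_le) auto
      ultimately show ?thesis by simp
    next
      case False
      then show ?thesis using pmap_basis_zero[OF ik(1)] supp_zero by (simp add: x_def)
    qed
    then obtain w d where w: "w \<in> C j" "gen (pmap x) - gen w - scal d * gen x \<in> JJ"
      using gen_C_Suc ik unfolding x_def by blast
    have "gen x ^ p - gen w - scal d * gen x - scal (\<chi> x ^ p) =
        (gen x ^ p - gen (pmap x) - scal (\<chi> x) ^ p) + (gen (pmap x) - gen w - scal d * gen x)"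
      by simp
    then have "gen x ^ p - gen w - scal d * gen x - scal (\<chi> x ^ p) \<in> JJ"
      using LC.J_closed(2)[OF J_relations(4)[OF V(1)] w(2)] by (simp only:)
    then show "\<exists>w\<in>gen ` C j. \<exists>d\<in>range scal. \<exists>d'\<in>range scal. \<forall>f\<in>FF. (gen x ^ p - w - d' * gen x - d) * f \<in> K"
      using w(1) J_mult by blast
  next
    show "gen y \<in> gen ` C j"
      unfolding y_def using si s_bounds by (intro imageI supp_E rank_gt) auto
    show "gen z \<in> gen ` C j" unfolding z using eC by (intro imageI supp_scale)
  next
    fix n assume "n \<in> N j"
    then show "(gen y - scal (\<chi> y)) * n \<in> K"
      using dual_element_acts[OF ik si] by (simp add: y_def \<delta>_def)
  next
    fix f :: "('k, int \<times> nat \<Rightarrow> 'k) free_alg" assume f: "f \<in> FF"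
    show "(gen y * gen x - gen x * gen y - gen z) * f \<in> K"
      unfolding z_def by (intro J_mult J_relations(3) V f)
    have "z' * gen z - 1 = z' * (gen z - scal m * gen e) + (e' * gen e - 1)"
    proof -
      have "scal (inverse m) * scal m = (1 :: ('k, int \<times> nat \<Rightarrow> 'k) free_alg)"
        using m by (simp only: scal_mult[symmetric] left_inverse[OF m] scal_simps)
      moreover have "z' * (scal m * gen e) = (scal (inverse m) * scal m) * (e' * gen e)"
        by (simp only: z'_def mult.assoc scal_assoc_commute[of e' m])
      ultimately show ?thesis by (simp add: right_diff_distrib)
    qed
    moreover have "z' * (gen z - scal m * gen e) \<in> JJ"
      unfolding z using J_relations(2)[OF V(4), of m] e'(1) LC.J_closed(3)[unfolded W_carrier] by (simp add: z'_def)
    ultimately have "z' * gen z - 1 \<in> JJ" using LC.J_closed(2)[OF _ e'(2)] by (simp only:)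
    then show "(z' * gen z - 1) * f \<in> K" using J_mult f by blast
  next
    have zz: "z \<in> supp (\<lambda>q. q = (r - 1, l))" unfolding z e_def by (intro supp_scale supp_E) simp
    \<comment> \<open>Bracketing with z adds r - 1 > 0 to the degree, so no multiple of x
      occurs.\<close>
    have "brk z x \<in> C j"
      by (rule supp_bracket[OF zz xx]) (use r1 rank_gt in auto)
    then show "\<exists>w\<in>gen ` C j. \<forall>f\<in>FF. (gen z * gen x - gen x * gen z - w) * f \<in> K"
      using J_mult[OF J_relations(3)[OF V(3,1)]] by blast
  next
    fix a assume "0 < a" "a < p"
    then show "\<exists>b\<in>FF. b * of_nat a = 1" using of_nat_inverse_free by blast
  next
    show "z' \<in> FF" using e' by (simp add: z'_def)
    show "gen ` C j \<subseteq> FF" using supp_V by auto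
    show "2 \<le> p" using p3 by simp
    show "gen x \<in> FF" using V by simp
  next
    fix d f :: "('k, int \<times> nat \<Rightarrow> 'k) free_alg" assume "d \<in> range scal"
    then show "d * f = f * d" by (auto simp: scal_commute)
  qed (use N_closed K_add K_mult K_zero in auto)
  then show thesis using that unfolding x_def by blast
qed

end

section \<open>Bases along the chain\<close>

context witt_eigen
begin

lemma power_N: "w \<in> C j \<Longrightarrow> n \<in> N j \<Longrightarrow> gen w ^ a * n \<in> N j"
  by (induction a) (auto simp: mult.assoc intro: N_closed(6))

text \<open>\<open>filt p\<close> contains 1 and is stable under all of \<open>C (Suc j)\<close>:
  the power relation keeps exponents below p. Induction over words then exhausts the next
  stage.\<close>

lemma filt_eq_N:
  assumes "adjoin FF K (N j) (gen ` C j) (range scal) (gen (E i k)) y z c z' p"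
    and ik: "(i, k) \<in> X" "rank (i, k) = j"
  shows "adjoin.filt K (N j) (gen (E i k)) p = N (Suc j)"
proof -
  interpret A: adjoin FF K "N j" "gen ` C j" "range scal" "gen (E i k)" y z c z' p by fact
  have p: "p = Suc (p - 1)" using p0 by simp
  have x: "E i k \<in> C (Suc j)" using ik by (intro supp_E) simp
  have "A.filt a \<subseteq> N (Suc j)" for a
  proof (induction a)
    case (Suc a)
    have "u + gen (E i k) ^ a * n \<in> N (Suc j)" if "u \<in> A.filt a" "n \<in> N j" for u n
      using that Suc N_mono by (intro N_closed(4) power_N x) auto
    then show ?case by auto
  qed (simp add: N_closed(1))
  moreover have filt_gen: "gen w * u \<in> A.filt p" if w: "w \<in> C (Suc j)" and u: "u \<in> A.filt p" for w u
  proof -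
    obtain w' d where w': "w' \<in> C j" "gen w - gen w' - scal d * gen (E i k) \<in> JJ"
      using gen_C_Suc[OF w ik] .
    have "u \<in> FF" using u A.filt_F by blast
    then have "(gen w - gen w' - scal d * gen (E i k)) * u \<in> K" by (rule J_mult[OF w'(2)])
    then have "gen w * u - (gen w' * u + scal d * (gen (E i k) * u)) \<in> K"
      by (simp add: algebra_simps)
    moreover have "gen w' * u + scal d * (gen (E i k) * u) \<in> A.filt p"
      using w'(1) u by (intro A.filt_add A.filt_Hs A.filt_Zs A.filt_closed_x) auto
    ultimately show ?thesis by (rule A.filt_K_diff)
  qed
  have "f \<in> A.filt p" if "f \<in> free_on (C (Suc j))" for f
    using that
  proof (induction f rule: free_on_induct)
    case (add f g)
    then show ?case using A.filt_add by blast
  next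
    case (scale d f)
    then show ?case using A.filt_Zs by blast
  next
    case one
    then show ?case using A.N_filt[of "p - 1"] N_closed(3) p by auto
  next
    case (gen x f)
    then show ?case using filt_gen by blast
  qed
  then have "N (Suc j) \<subseteq> A.filt p"
    unfolding N_def[of "Suc j"] using A.K_filt A.filt_add by blast
  ultimately show ?thesis by blast
qed

text \<open>The classes of B 0, ..., B (m - 1) form a basis of \<open>N j / K\<close> over the
  field.\<close>

definition coord_basis :: "nat \<Rightarrow> nat \<Rightarrow> (nat \<Rightarrow> ('k, int \<times> nat \<Rightarrow> 'k) free_alg) \<Rightarrow> bool" where
  "coord_basis j m B \<longleftrightarrow> (\<forall>i. B i \<in> N j) \<and>
     (\<forall>u\<in>N j. \<exists>c. u - (\<Sum>i<m. scal (c i) * B i) \<in> K) \<and>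
     (\<forall>c. (\<Sum>i<m. scal (c i) * B i) \<in> K \<longrightarrow> (\<forall>i<m. c i = 0))"

lemma scal_K: "scal d \<in> K \<Longrightarrow> d = 0"
proof (rule ccontr)
  assume "scal d \<in> K" "d \<noteq> 0"
  then have "scal (inverse d) * scal d \<in> K" by (intro K_mult) auto
  moreover have "scal (inverse d) * scal d = (1 :: ('k, int \<times> nat \<Rightarrow> 'k) free_alg)"
    using \<open>d \<noteq> 0\<close> by (metis left_inverse scal_mult scal_simps(2))
  ultimately show False using one_K by simp
qed

lemma N_sum: "(\<And>i. i \<in> I \<Longrightarrow> f i \<in> N j) \<Longrightarrow> sum f I \<in> N j"
  by (induction I rule: infinite_finite_induct) (use N_closed(1,4) K_zero in auto)

lemma K_sum: "(\<And>i. i \<in> I \<Longrightarrow> f i \<in> K) \<Longrightarrow> sum f I \<in> K"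
  by (induction I rule: infinite_finite_induct) (use K_add K_zero in auto)

lemma coord_basis_step:
  assumes "adjoin FF K (N j) (gen ` C j) (range scal) (gen (E i k)) y z c z' p"
    and ik: "(i, k) \<in> X" "rank (i, k) = j" and B: "coord_basis j m B"
  shows "coord_basis (Suc j) (p * m) (\<lambda>n. gen (E i k) ^ (n div m) * B (n mod m))"
proof -
  interpret A: adjoin FF K "N j" "gen ` C j" "range scal" "gen (E i k)" y z c z' p by fact
  note filt = filt_eq_N[OF assms(1) ik]
  define x where "x = (gen (E i k) :: ('k, int \<times> nat \<Rightarrow> 'k) free_alg)"
  have x: "E i k \<in> C (Suc j)" using ik by (intro supp_E) simp
  have B_N: "B i \<in> N j" for i using B by (simp add: coord_basis_def)
  \<comment> \<open>The index n = a m + i stands for the monomial x^a B i.\<close>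
  have expand: "(\<Sum>n<p * m. scal (d n) * (x ^ (n div m) * B (n mod m))) =
      (\<Sum>a<p. x ^ a * (\<Sum>i<m. scal (d (a * m + i)) * B i))" for d
    by (simp add: sum_lessThan_mult sum_distrib_left scal_assoc_commute)
  show ?thesis
    unfolding coord_basis_def x_def[symmetric] expand
  proof (intro conjI allI ballI impI)
    fix n
    show "x ^ (n div m) * B (n mod m) \<in> N (Suc j)"
      unfolding x_def using B_N N_mono by (intro power_N x) auto
  next
    fix u assume "u \<in> N (Suc j)"
    then obtain g where g: "\<And>a. g a \<in> N j" "u - (\<Sum>a<p. x ^ a * g a) \<in> K"
      using A.filt_sum[of u p] unfolding filt x_def by blast
    have "\<exists>c. g a - (\<Sum>i<m. scal (c i) * B i) \<in> K" for a
      using B g(1) by (auto simp: coord_basis_def)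
    then obtain c where c: "\<And>a. g a - (\<Sum>i<m. scal (c a i) * B i) \<in> K" by metis
    have "u - (\<Sum>a<p. x ^ a * g a) + (\<Sum>a<p. x ^ a * (g a - (\<Sum>i<m. scal (c a i) * B i))) \<in> K"
      using A.x_F by (intro K_add g K_sum K_mult c) (auto simp: x_def)
    then have "u - (\<Sum>a<p. x ^ a * (\<Sum>i<m. scal (c a i) * B i)) \<in> K"
      by (simp add: right_diff_distrib sum_subtractf)
    then show "\<exists>c. u - (\<Sum>a<p. x ^ a * (\<Sum>i<m. scal (c (a * m + i)) * B i)) \<in> K"
      by (intro exI[of _ "\<lambda>n. c (n div m) (n mod m)"]) simp
  next
    fix c :: "nat \<Rightarrow> 'k" and n :: nat
    assume sum: "(\<Sum>a<p. x ^ a * (\<Sum>i<m. scal (c (a * m + i)) * B i)) \<in> K" and n: "n < p * m"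
    have m: "0 < m" using n by (cases m) auto
    have a: "n div m < p" using n by (simp add: less_mult_imp_div_less)
    have "(\<Sum>i<m. scal (c (n div m * m + i)) * B i) \<in> K"
      by (rule A.sum_independent[OF sum[unfolded x_def] _ order_refl a])
        (intro N_sum N_closed(5) B_N)
    moreover have indep: "\<And>c. (\<Sum>i<m. scal (c i) * B i) \<in> K \<Longrightarrow> \<forall>i<m. c i = 0"
      using B unfolding coord_basis_def by blast
    ultimately have "\<forall>i<m. c (n div m * m + i) = 0"
      using indep[of "\<lambda>i. c (n div m * m + i)"] by blast
    then show "c n = 0" using m by (metis div_mult_mod_eq mod_less_divisor)
  qed
qed

text \<open>One induction carries both claims since they use the same adjoined generator:
  \<open>filt_descend\<close> moves a nonzero vector one stage down, and the powers of x below p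
  multiply the size of the basis by p.\<close>

lemma chain:
  assumes "j0 + n \<le> j1"
  shows "(\<forall>u\<in>N (j0 + n) - K. \<exists>w\<in>FF. w * u - 1 \<in> K) \<and> (\<exists>B. coord_basis (j0 + n) (p ^ n) B)"
  using assms
proof (induction n)
  case 0
  have "\<exists>w\<in>FF. w * u - 1 \<in> K" if u: "u \<in> N j0" "u \<notin> K" for u
  proof -
    obtain d where d: "u - scal d \<in> K" using N_j0 u by blast
    then have "d \<noteq> 0" using u by auto
    then have "scal (inverse d) * scal d = (1 :: ('k, int \<times> nat \<Rightarrow> 'k) free_alg)"
      by (metis left_inverse scal_mult scal_simps(2))
    moreover have "scal (inverse d) * (u - scal d) \<in> K" using d by (intro K_mult) auto
    ultimately show ?thesis
      by (intro bexI[of _ "scal (inverse d)"]) (simp_all add: right_diff_distrib)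
  qed
  moreover have "coord_basis j0 1 (\<lambda>_. 1)"
    unfolding coord_basis_def
  proof (intro conjI allI ballI impI)
    fix u assume "u \<in> N j0"
    then obtain d where "u - scal d \<in> K" using N_j0 by blast
    moreover have "{..<1::nat} = {0}" by auto
    ultimately show "\<exists>c. u - (\<Sum>i<1::nat. scal (c i) * 1) \<in> K"
      by (intro exI[of _ "\<lambda>_. d"]) (simp del: sum_constant)
  next
    fix c :: "nat \<Rightarrow> 'k" and i :: nat
    assume "(\<Sum>i<1. scal (c i) * 1) \<in> K" "i < 1"
    then show "c i = 0" using scal_K by (simp add: lessThan_Suc)
  qed (rule N_closed(3))
  ultimately show ?case by auto
next
  case (Suc n)
  define j where "j = j0 + n"
  have j: "j0 \<le> j" "j < j1" using Suc.prems by (auto simp: j_def)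
  obtain i k where ik: "(i, k) \<in> X" "rank (i, k) = j" using rank_surj j by (auto simp: j1_def)
  obtain y z c z' where A: "adjoin FF K (N j) (gen ` C j) (range scal) (gen (E i k)) y z c z' p"
    using adjoin_step[OF j ik] .
  interpret A: adjoin FF K "N j" "gen ` C j" "range scal" "gen (E i k)" y z c z' p by (rule A)
  have IH: "\<forall>u\<in>N j - K. \<exists>w\<in>FF. w * u - 1 \<in> K" "\<exists>B. coord_basis j (p ^ n) B"
    using Suc by (auto simp: j_def)
  have "\<exists>w\<in>FF. w * u - 1 \<in> K" if u: "u \<in> N (Suc j)" "u \<notin> K" for u
  proof -
    obtain w where w: "w \<in> FF" "w * u \<in> N j - K"
      using A.filt_descend[of u p] u unfolding filt_eq_N[OF A ik] by blast
    then obtain v where "v \<in> FF" "v * (w * u) - 1 \<in> K" using IH(1) by blast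
    then show ?thesis using w by (intro bexI[of _ "v * w"]) (auto simp: mult.assoc)
  qed
  moreover obtain B where "coord_basis j (p ^ n) B" using IH(2) by blast
  ultimately show ?case using coord_basis_step[OF A ik] by (auto simp: j_def)
qed

theorem eigen_ideal_maximal:
  assumes "u \<in> FF" "u \<notin> K"
  shows "\<exists>w\<in>FF. w * u - 1 \<in> K"
  using chain[of "j1 - j0"] j01(1) assms by (simp add: N_j1)

theorem eigen_ideal_basis:
  obtains B where "coord_basis j1 (p ^ nat ((int l + 1) * (s + 1))) B"
  using chain[of "j1 - j0"] j01(1) that unfolding j01(2)[symmetric] by auto

end

section \<open>The simple module\<close>

context red_module
begin

abbreviation "U \<equiv> underlying_space L \<chi> M"

lemma underlying_simps [simp]:
  "carrier U = carrier M" "\<zero>\<^bsub>U\<^esub> = \<zero>\<^bsub>M\<^esub>" "x \<oplus>\<^bsub>U\<^esub> y = x \<oplus>\<^bsub>M\<^esub> y" "c \<odot>\<^bsub>U\<^esub> x = act (scal c) x"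
  by (simp_all add: underlying_space_def restrict_scalars_def act_def)

lemma vectorspace_underlying: "vectorspace class_ring U"
proof -
  have ab: "abelian_group U"
  proof (rule abelian_groupI)
    fix x assume "x \<in> carrier U"
    then show "\<exists>y\<in>carrier U. y \<oplus>\<^bsub>U\<^esub> x = \<zero>\<^bsub>U\<^esub>"
      by (intro bexI[of _ "\<ominus>\<^bsub>M\<^esub> x"]) (simp_all add: M.l_neg)
  qed (simp_all add: M.add.m_ac)
  have "module class_ring U"
  proof (intro moduleI class_cring.cring_axioms ab)
    fix x assume x: "x \<in> carrier U"
    have "act (scal 1) x = x" using x act_simps(3)[of x] by (simp only: scal_simps underlying_simps)
    then show "\<one>\<^bsub>class_ring\<^esub> \<odot>\<^bsub>U\<^esub> x = x" by simp
  qed (simp_all add: act_simps)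
  then show ?thesis by (intro vectorspace.intro class_field.field_axioms)
qed

text \<open>Bases are sets of vectors whereas \<open>B\<close> is a family. So the family is first
  shown injective, and coefficients are carried over along its inverse.\<close>

lemma has_dimension_underlying:
  assumes cyclic: "carrier M = (\<lambda>f. act f v) ` F" and v: "v \<in> carrier M"
    and B: "\<And>i. B i \<in> F"
    and spans: "\<And>f. f \<in> F \<Longrightarrow> \<exists>c. f - (\<Sum>i<m. scal (c i) * B i) \<in> ann v"
    and indep: "\<And>c. (\<Sum>i<m. scal (c i) * B i) \<in> ann v \<Longrightarrow> \<forall>i<m. c i = 0"
  shows "has_dimension U m"
proof -
  interpret U: vectorspace class_ring U by (rule vectorspace_underlying)
  define b where "b i = act (B i) v" for i
  have b: "b i \<in> carrier M" for i using B v by (simp add: b_def)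
  have sumF: "(\<Sum>i\<in>I. scal (c i) * B i) \<in> F" for c I
    using B by (intro free_on_sum) auto
  have finsum: "finsum U (\<lambda>i. c i \<odot>\<^bsub>U\<^esub> b i) I = act (\<Sum>i\<in>I. scal (c i) * B i) v" if "finite I" for c I
    using that
  proof (induction I rule: finite_induct)
    case empty
    then show ?case using v U.M.finsum_empty by (simp add: act_zero)
  next
    case (insert i I)
    have "c i \<odot>\<^bsub>U\<^esub> b i = act (scal (c i) * B i) v" using B v by (simp add: b_def act_simps)
    moreover have "c i \<odot>\<^bsub>U\<^esub> b i \<in> carrier U" for i using b by simp
    ultimately show ?case
      using insert B v sumF[of c I] by (subst U.M.finsum_insert) (auto simp: act_simps)
  qed
  have inj: "inj_on b {..<m}"
  proof (rule inj_onI, rule ccontr)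
    fix i j assume ij: "i \<in> {..<m}" "j \<in> {..<m}" "b i = b j" "i \<noteq> j"
    \<comment> \<open>The coefficients of the relation B i - B j that a coincidence would
      produce.\<close>
    define c :: "nat \<Rightarrow> 'k" where "c n = (if n = i then 1 else if n = j then - 1 else 0)" for n
    have "(\<Sum>n<m. scal (c n) * B n) = (\<Sum>n\<in>{i, j}. scal (c n) * B n)"
      using ij by (intro sum.mono_neutral_right) (auto simp: c_def)
    also have "\<dots> = B i - B j" using ij(4) by (simp add: c_def)
    finally have "(\<Sum>n<m. scal (c n) * B n) \<in> ann v"
      using ij(3) act_eq_iff[OF B B v, of i j] by (simp add: b_def)
    then have "c i = 0" using indep ij by blast
    then show False by (simp add: c_def)
  qed
  have lincomb: "U.lincomb a (b ` I) = act (\<Sum>i\<in>I. scal (a (b i)) * B i) v" if "I \<subseteq> {..<m}" for a I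
  proof -
    have "U.lincomb a (b ` I) = finsum U (\<lambda>i. a (b i) \<odot>\<^bsub>U\<^esub> b i) I"
      unfolding U.lincomb_def using b inj_on_subset[OF inj that]
      by (intro U.M.finsum_reindex) auto
    then show ?thesis using finsum[of I "\<lambda>i. a (b i)"] finite_subset[OF that] by simp
  qed
  have gen: "U.gen_set (b ` {..<m})"
  proof
    show "U.span (b ` {..<m}) \<subseteq> carrier U" using b by (intro U.span_is_subset2) auto
    show "carrier U \<subseteq> U.span (b ` {..<m})"
    proof
      fix x assume "x \<in> carrier U"
      then obtain f where f: "f \<in> F" "x = act f v" using cyclic by auto
      obtain c where c: "f - (\<Sum>i<m. scal (c i) * B i) \<in> ann v" using spans[OF f(1)] by blast
      define a where "a y = c (the_inv_into {..<m} b y)" for y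
      have "a (b i) = c i" if "i < m" for i
        using the_inv_into_f_f[OF inj, of i] that by (simp add: a_def)
      then have "U.lincomb a (b ` {..<m}) = act (\<Sum>i<m. scal (c i) * B i) v"
        using lincomb[of "{..<m}" a] by simp
      also have "\<dots> = x" using iffD2[OF act_eq_iff[OF f(1) sumF v] c] f(2) by simp
      finally show "x \<in> U.span (b ` {..<m})"
        unfolding U.span_def by (intro CollectI exI[of _ a] exI[of _ "b ` {..<m}"]) auto
    qed
  qed
  have "U.lin_indpt (b ` {..<m})"
  proof
    assume "U.lin_dep (b ` {..<m})"
    then obtain A a w where A: "finite A" "A \<subseteq> b ` {..<m}" "U.lincomb a A = \<zero>\<^bsub>U\<^esub>" "w \<in> A" "a w \<noteq> 0"
      unfolding U.lin_dep_def by auto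
    obtain I where I: "I \<subseteq> {..<m}" "A = b ` I" using A(2) by (meson subset_image_iff)
    define c where "c i = (if i \<in> I then a (b i) else 0)" for i
    have "(\<Sum>i\<in>I. scal (a (b i)) * B i) = (\<Sum>i<m. scal (c i) * B i)"
      using I(1) by (intro sum.mono_neutral_cong_left) (auto simp: c_def)
    moreover have "act (\<Sum>i\<in>I. scal (a (b i)) * B i) v = \<zero>\<^bsub>M\<^esub>"
      using A(3) lincomb[OF I(1), of a] I(2) by simp
    ultimately have "(\<Sum>i<m. scal (c i) * B i) \<in> ann v" using sumF by (simp add: ann_def)
    then have c0: "\<forall>i<m. c i = 0" by (rule indep)
    obtain i where i: "i \<in> I" "w = b i" using A(4) I(2) by blast
    then have "a w = 0" using c0 I(1) by (auto simp: c_def)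
    then show False using A(5) by simp
  qed
  then have basis: "U.basis (b ` {..<m})"
    unfolding U.basis_def using gen b by auto
  have "U.fin_dim" unfolding U.fin_dim_def using gen b by (intro exI[of _ "b ` {..<m}"]) auto
  moreover have "U.dim = m"
    using U.dim_basis[OF _ basis] card_image[OF inj] by simp
  ultimately show ?thesis
    unfolding has_dimension_def using vectorspace_underlying by blast
qed

end

section \<open>The subalgebra H and uniqueness\<close>

context witt_leading
begin

lemma supp_act:
  assumes x: "x \<in> supp P" and y: "y \<in> supp Q"
    and PQ: "\<And>i k j m. \<lbrakk>P (i, k); Q (j, m)\<rbrakk> \<Longrightarrow> S (i + j, k + m)"
  shows "act x y \<in> supp S"
  unfolding supp_def
proof (intro CollectI conjI allI impI)
  show "act x y \<in> V" by (rule witt_act_in_space)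
  fix q assume q: "act x y q \<noteq> 0"
  show "S q"
  proof (rule ccontr)
    assume S: "\<not> S q"
    have "x (i, k) * y (j, m) * (of_int (j + 1) * E (i + j) (k + m) q) = 0" for i k j m
    proof (rule ccontr)
      assume n: "x (i, k) * y (j, m) * (of_int (j + 1) * E (i + j) (k + m) q) \<noteq> 0"
      then have "x (i, k) \<noteq> 0" "y (j, m) \<noteq> 0" "q = (i + j, k + m)"
        by (auto simp: witt_basis_def split: if_splits)
      then show False using PQ x y S by (auto simp: supp_def)
    qed
    then have "act x y q = 0"
      unfolding witt_act_def by (intro sum.neutral ballI) (auto intro!: sum.neutral)
    then show False using q by simp
  qed
qed

lemma H_V: "H \<subseteq> V"
  unfolding H_supp by (rule supp_V)

lemma H_ge: "H \<subseteq> supp (\<lambda>q. s \<le> fst q)"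
  unfolding H_supp by (rule C_H) simp

text \<open>Each application of \<open>act x\<close> raises the degree by at least s \<ge> 1, so p
  of them push \<open>E 0 0\<close> beyond degree p - 2.\<close>

lemma pmap_H:
  assumes "x \<in> H" shows "pmap x = (\<lambda>q. 0)"
proof -
  have x: "x \<in> supp (\<lambda>q. s \<le> fst q)" using assms H_ge by blast
  have "(act x ^^ n) (E 0 0) \<in> supp (\<lambda>q. int n \<le> fst q)" for n
  proof (induction n)
    case (Suc n)
    show ?case
      unfolding funpow.simps o_apply by (rule supp_act[OF x Suc]) (use s_bounds in auto)
  qed (auto intro: supp_E)
  then have "pmap x \<in> supp (\<lambda>q. int p \<le> fst q)" by (simp add: witt_p_map_def)
  then show ?thesis
    unfolding supp_def by (intro ext) (fastforce simp: mem_witt_space mem_X)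
qed

lemma bracket_H:
  assumes "x \<in> H" "y \<in> H" shows "brk x y \<in> H"
proof -
  have "brk x y \<in> supp (\<lambda>q. s \<le> fst q)"
    by (rule supp_bracket[OF subsetD[OF H_ge assms(1)] subsetD[OF H_ge assms(2)]]) (use s_bounds in auto)
  then show ?thesis
    unfolding H_supp by (rule supp_mono) (metis prod.collapse rank_j0)
qed

lemma lie_induced_H: "lie_induced W \<chi> H"
proof -
  have "lie_carrier (W\<lparr>carrier := H\<rparr>)"
  proof
    fix x y c assume x: "x \<in> carrier (W\<lparr>carrier := H\<rparr>)" and y: "y \<in> carrier (W\<lparr>carrier := H\<rparr>)"
    show "x \<oplus>\<^bsub>W\<lparr>carrier := H\<rparr>\<^esub> y \<in> carrier (W\<lparr>carrier := H\<rparr>)"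
      using x y by (simp add: witt_sel H_supp supp_add)
    show "bracket (W\<lparr>carrier := H\<rparr>) x y \<in> carrier (W\<lparr>carrier := H\<rparr>)"
      using x y by (simp add: witt_sel bracket_H)
  next
    fix x c assume x: "x \<in> carrier (W\<lparr>carrier := H\<rparr>)"
    show "c \<odot>\<^bsub>W\<lparr>carrier := H\<rparr>\<^esub> x \<in> carrier (W\<lparr>carrier := H\<rparr>)"
      using x by (simp add: witt_sel H_supp supp_scale)
    show "p_map (W\<lparr>carrier := H\<rparr>) x \<in> carrier (W\<lparr>carrier := H\<rparr>)"
      using x supp_zero by (simp add: witt_sel pmap_H) (simp add: H_supp)
  qed
  moreover have "linear_form (W\<lparr>carrier := H\<rparr>) \<chi>"
    using \<chi>_add[OF subsetD[OF H_V] subsetD[OF H_V]] \<chi>_scale[OF subsetD[OF H_V]]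
    by (simp add: linear_form_def witt_sel)
  moreover have "\<chi> (\<lambda>q. 0) = 0" by (rule \<chi>_height[OF supp_zero])
  moreover have "\<chi> (brk x y) = 0" if "x \<in> H" "y \<in> H" for x y
    using that H_ge by (intro \<chi>_bracket_H) auto
  ultimately show ?thesis
    using H_V LC.lie_carrier_axioms
    by (intro lie_induced.intro lie_subalgebra.intro lie_subalgebra_axioms.intro
        lie_character.intro lie_character_axioms.intro) (auto simp: witt_sel pmap_H)
qed

lemma witt_eigenI: "eigen_ideal W H \<chi> K \<Longrightarrow> witt_eigen p l \<chi> r s K"
  by (simp add: witt_eigen_def witt_eigen_axioms_def witt_leading_axioms)

lemma eigen_ideal_unique:
  assumes K: "eigen_ideal W H \<chi> K1" "eigen_ideal W H \<chi> K2"
  shows "K1 = K2"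
proof -
  have sub: "K1 \<subseteq> K2" if K: "eigen_ideal W H \<chi> K1" "eigen_ideal W H \<chi> K2" for K1 K2
  proof
    have eig: "eigen_ideal W H \<chi> (K1 \<inter> K2)"
      using K unfolding eigen_ideal_def alg_left_ideal_def by auto
    have K1: "alg_left_ideal V K1" "1 \<notin> K1" using K(1) by (auto simp: eigen_ideal_def W_carrier)
    fix u assume u: "u \<in> K1"
    show "u \<in> K2"
    proof (rule ccontr)
      assume "u \<notin> K2"
      moreover have "u \<in> FF" using u K1 by (auto simp: alg_left_ideal_def)
      \<comment> \<open>Maximality is applied to the intersection, so that w u - 1 also lies in
        \<open>K1\<close>, which together with u in \<open>K1\<close> forces 1 into
        \<open>K1\<close>.\<close>
      ultimately obtain w where w: "w \<in> FF" "w * u - 1 \<in> K1 \<inter> K2"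
        using witt_eigen.eigen_ideal_maximal[OF witt_eigenI[OF eig]] by blast
      have "w * u \<in> K1" using K1 w(1) u by (auto simp: alg_left_ideal_def)
      then have "w * u - (w * u - 1) \<in> K1" using w(2) by (rule alg_left_ideal_diff[OF K1(1) _ IntD1])
      moreover have "w * u - (w * u - 1) = 1" by simp
      ultimately show False using K1(2) by (simp only:)
    qed
  qed
  show ?thesis using sub[OF K] sub[OF K(2,1)] by blast
qed

lemma eigenvector_exists:
  assumes "alg_left_ideal V K" "JJ \<subseteq> K" "1 \<notin> K"
  obtains u where "u \<in> FF" "eigen_ideal W H \<chi> {f \<in> FF. f * u \<in> K}"
proof -
  interpret witt_ideal p l ty \<chi> r s K by unfold_locales (use assms in auto)
  show thesis using eigen_ideal_exists[OF assms(3)] that .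
qed

text \<open>\<open>JJ\<close> itself is a proper left ideal, so the eigenvector is found in the
  regular module.\<close>

lemma eigen_ideal_nonempty:
  obtains K where "eigen_ideal W H \<chi> K"
proof -
  have "alg_left_ideal V JJ"
    using LC.alg_ideal_J by (auto simp: alg_left_ideal_def alg_ideal_def W_carrier)
  then show thesis using eigenvector_exists one_notin_red_kernel that by blast
qed

theorem induced_module_simple:
  defines "I \<equiv> induced_module W H \<chi>"
  shows "simple_left_module (red_env (W\<lparr>carrier := H\<rparr>) \<chi>) (one_dim_module \<chi>)"
    and "simple_left_module (red_env W \<chi>) I"
    and "simple_left_module (red_env W \<chi>) Y \<Longrightarrow> left_module_isomorphic (red_env W \<chi>) Y I"
    and "has_dimension (underlying_space W \<chi> I) (p ^ nat ((int l + 1) * (s + 1)))"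
proof -
  interpret Ind: lie_induced W \<chi> H by (rule lie_induced_H)
  obtain K where K: "eigen_ideal W H \<chi> K" by (rule eigen_ideal_nonempty)
  note vac = Ind.vac_eigen_ideal[OF K]
  interpret Ev: witt_eigen p l ty \<chi> r s "Ind.I.ann Ind.vac" by (rule witt_eigenI[OF vac])
  show "simple_left_module (red_env (W\<lparr>carrier := H\<rparr>) \<chi>) (one_dim_module \<chi>)"
    by (rule Ind.chr.simple_one_dim)
  show "simple_left_module (red_env W \<chi>) I"
    unfolding I_def
    by (rule Ind.I.simple_if_maximal[OF Ind.induced_cyclic Ind.vac_closed Ind.vac_nonzero[OF K]])
      (use Ev.eigen_ideal_maximal in \<open>simp add: W_carrier\<close>)
  show "has_dimension (underlying_space W \<chi> I) (p ^ nat ((int l + 1) * (s + 1)))"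
  proof -
    obtain B where "Ev.coord_basis j1 (p ^ nat ((int l + 1) * (s + 1))) B" by (rule Ev.eigen_ideal_basis)
    then show ?thesis
      unfolding I_def Ev.coord_basis_def Ev.N_j1
      by (intro Ind.I.has_dimension_underlying[OF Ind.induced_cyclic Ind.vac_closed, where B = B])
        (auto simp: W_carrier)
  qed
  show "left_module_isomorphic (red_env W \<chi>) Y I" if simple: "simple_left_module (red_env W \<chi>) Y"
  proof -
    interpret M: red_module W \<chi> Y
      using simple LC.lie_carrier_axioms by (simp add: red_module_def simple_left_module_def)
    obtain v where v: "v \<in> carrier Y" "v \<noteq> \<zero>\<^bsub>Y\<^esub>"
      using simple M.M.zero_closed unfolding simple_left_module_def by blast
    \<comment> \<open>An arbitrary nonzero v need not be an eigenvector. Passing to u v gives one,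
      and it still generates \<open>Y\<close> by simplicity; its annihilator must then be that of
      \<open>vac\<close>.\<close>
    obtain u where u: "u \<in> FF" "eigen_ideal W H \<chi> {f \<in> FF. f * u \<in> M.ann v}"
      using eigenvector_exists[of "M.ann v"] M.ann_left_ideal[OF v(1)] M.J_ann[OF v(1)] M.one_ann[OF v(1)] v(2)
      by (auto simp: W_carrier)
    define w where "w = M.act u v"
    have w: "w \<in> carrier Y" using u v by (simp add: w_def W_carrier)
    have ann: "M.ann w = {f \<in> FF. f * u \<in> M.ann v}"
      using u(1) v(1) by (auto simp: M.ann_def w_def M.act_simps W_carrier)
    have eig: "eigen_ideal W H \<chi> (M.ann w)" using u(2) by (simp only: ann)
    then have "w \<noteq> \<zero>\<^bsub>Y\<^esub>" using M.one_ann[OF w] by (simp add: eigen_ideal_def)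
    then show ?thesis
      unfolding I_def
      by (intro cyclic_isomorphic[OF M.red_module_axioms Ind.I.red_module_axioms w _ Ind.vac_closed
            Ind.induced_cyclic eigen_ideal_unique[OF eig vac]] M.simple_cyclic[OF simple w])
  qed
qed

end

theorem theorem4p2:
  fixes p l :: nat
    and \<chi> :: "(int \<times> nat \<Rightarrow> 'k::alg_closed_field) \<Rightarrow> 'k"
    and r s :: int
  assumes "CHAR('k) = p" and "p > 3"
    and "linear_form (witt_current p l) \<chi>"
    and "r = witt_height p l \<chi>"
    and "1 < r" and "r < int p - 1"
    and "\<chi> (witt_basis p l (r - 1) l) \<noteq> 0"
    and "s = \<lfloor>of_int r / (2::real)\<rfloor>"
  shows
    "let W = witt_current p l;
         H = witt_filtration p l s;
         S = induced_module W H \<chi>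
     in simple_left_module (red_env (W\<lparr>carrier := H\<rparr>) \<chi>) (one_dim_module \<chi>)
        \<and> simple_left_module (red_env W \<chi>) S
        \<and> (\<forall>M :: ((('k, int \<times> nat \<Rightarrow> 'k) free_alg) set set, 'm) module.
             simple_left_module (red_env W \<chi>) M \<longrightarrow> left_module_isomorphic (red_env W \<chi>) M S)
        \<and> has_dimension (underlying_space W \<chi> S) (p ^ nat ((int l + 1) * (s + 1)))"
proof -
  have "s = r div 2"
    using assms(8) floor_divide_of_int_eq[of r 2, where ?'a = real] by simp
  then interpret witt_leading p l "TYPE('k)" \<chi> r s
    by unfold_locales (use assms in simp_all)
  show ?thesis
    unfolding Let_def by (intro conjI allI impI induced_module_simple)
qed

end
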